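(* Let $Q\in\mathcal Q_\psi$ be a fixed privacy mechanism and suppose $P_{VZ}\in\mathcal P_{VZ}(Q,\mathcal P_{\mathfrak V\mathfrak X})$, where $\mathcal P_{\mathfrak V\mathfrak X}$ is the set of all probability laws on $\mathfrak V\times\mathfrak X$. Suppose that the consistency assumption (A) and the rate assumption (B) stated in the context hold for the private nuisance estimators $(\check r,\check\mu,\check\gamma,\check p,\check e)$. Then the private one-step estimator $\hat\psi_n$ satisfies $$\sqrt n\,\big(\hat\psi_n-\psi(P_{VZ})\big)\rightsquigarrow\mathcal N\big(0,\,P_{VZ}\tilde\psi^2\big)\quad\text{under }P_{VZ},\text{ as }n\to\infty,$$ where $\psi(P_{VZ})=\chi(P_{VX})$ and $\tilde\psi=Q_{\mathcal X}^{-1}\tilde\chi$.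
   Context: Data and target. $(V,X)$ has law $P_{VX}$ on a measurable space $\mathfrak V\times\mathfrak X$, $\mathfrak V$ a product space. $Ph=\int h\,dP$; for a data-dependent function the integral is over its argument only. $V_1,V_2$ are collections of coordinates of $V$ with values in $\mathcal V_1$ and the finite set $\mathcal V_2$; $v_1,v_2$ are the corresponding coordinates of $v$. For given $m,g:\mathfrak V\times\mathfrak X\to\mathbb R$, $\mu_{\mathcal X}(v_1,x)=\mathbb E[m(V,X)\mid V_1=v_1,X=x]\in L_2(P_{V_1X})$, $\gamma_{\mathcal V}(v_2)=\mathbb E[g(V,X)\mid V_2=v_2]$; $c\in\mathcal V_2$ is fixed, $p_{V_2}(c)=\mathbb P(V_2=c)>0$. $\Gamma\subset\mathbb R$ contains the range of $g$ and $\gamma_{\mathcal V}(c)$; $f:\mathfrak V\times\mathfrak X\times L_2(P_{V_1X})\times\Gamma\to\mathbb R$ satisfies: for all $\gamma\in\Gamma$, $\mu\mapsto\mathbb E f(V,X,\mu,\gamma)$ is $L_2(P_{VX})$-continuous and $\mu\mapsto f(V,X,\mu,\gamma)$ is a.s. linear; for all $\mu$, $\gamma\mapsto f(V,X,\mu,\gamma)$ is a.s. twice continuously differentiable with derivatives $\partial_\gamma f,\partial^2_\gamma f$. Integrability: $\mathbb E f(V,X,\mu_{\mathcal X},\gamma_{\mathcal V}(c))^2<\infty$, $\mathbb E1\{V_2=c\}g(V,X)^2<\infty$, $\mathbb E[m(V,X)^2\mid V_1,X]<\infty$ a.s. Target: $\chi(P_{VX})=\mathbb E f(V,X,\mu_{\mathcal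 X},\gamma_{\mathcal V}(c))$. $r\in L_2(P_{V_1X})$ is the unique function with $\mathbb E f(V,X,\mu,\gamma_{\mathcal V}(c))=\mathbb E\,r(V_1,X)\mu(V_1,X)$ for all $\mu\in L_2(P_{V_1X})$. Put $e=\mathbb E\,\partial_\gamma f(V,X,\mu_{\mathcal X},\gamma_{\mathcal V}(c))$ and $\tilde\chi(v,x)=r(v_1,x)(m(v,x)-\mu_{\mathcal X}(v_1,x))+\frac{1\{v_2=c\}}{p_{V_2}(c)}(g(v,x)-\gamma_{\mathcal V}(c))e+f(v,x,\mu_{\mathcal X},\gamma_{\mathcal V}(c))-\chi(P_{VX})$. Mechanisms. A privacy mechanism is a Markov kernel $Q(B\mid x)$ from $\mathfrak X$ to a measurable space $\mathfrak Z$; given $(V,X)$, $Z\sim Q(\cdot\mid X)$, and $P_{VZ}$ is the law of $(V,Z)$: $P_{VZ}(B_v,B_z)=\int_{B_v}\int_{\mathfrak X}Q(B_z\mid x)dP_{VX}(v,x)$. $\mathcal P_{VZ}(Q,\mathcal P)$ is the set of such laws as the law of $(V,X)$ ranges over $\mathcal P$. $\mathcal Q_J^I$: $\mathfrak X=\{x_1,\dots,x_J\}$, $\mathfrak Z=\{z_1,\dots,z_J\}$ finite, $P_{VX}$ has a density w.r.t. $\nu_V\times$counting measure, and the matrix $Q$ with $(j,k)$ entry $Q(\{z_j\}\mid x_k)$ is invertible. $\mathcal Q_\delta$: $\mathfrak Z=\mathfrak X$ and $Q(B\mid x)=\alpha\delta_x(B)+(1-\alpha)\bar Q(B)$, $\alpha\in(0,1)$,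 $\bar Q$ a probability measure on $\mathfrak X$. $\mathcal Q_\psi=\mathcal Q_J^I\cup\mathcal Q_\delta$. For $Q\in\mathcal Q_\psi$, $P_{VX}$ is determined by $P_{VZ}$ and $\psi(P_{VZ}):=\chi(P_{VX})$. $Q_{\mathcal X}^{-1}$ is the inverse of $(Q_{\mathcal X}k)(v,x)=\int k(v,z)Q(dz\mid x)$: for $Q\in\mathcal Q_J^I$, $((Q_{\mathcal X}^{-1}h)(v,z_j))_j=(Q^\top)^{-1}(h(v,x_j))_j$; for $Q\in\mathcal Q_\delta$, $(Q_{\mathcal X}^{-1}h)(v,z)=\frac1\alpha h(v,z)-\frac{1-\alpha}{\alpha}\int h(v,x)\bar Q(dx)$. Estimator. $\bar{\mathcal S}=((V_i,Z_i))_{i\le n}$, $\bar{\mathcal S}'=((V_i',Z_i'))_{i\le n}$, $\bar{\mathcal S}''=((V_i'',Z_i''))_{i\le n}$ are mutually independent i.i.d. samples from $P_{VZ}$. $\check r,\check\mu$ are $L_2(P_{V_1X})$-valued estimators of $r,\mu_{\mathcal X}$ computed from $\bar{\mathcal S}'$. With $N_c=\sum_i1\{V'_{2i}=c\}$ and $g_c(v,x)=1\{v_2=c\}g(v,x)$: $\check p=N_c/n$ and $\check\gamma=\frac1{\check p}\frac1n\sum_i(Q_{\mathcal X}^{-1}g_c)(V_i',Z_i')$ (taking values in $\Gamma$), estimators of $p_{V_2}(c)$, $\gamma_{\mathcal V}(c)$. With $\bar f(\cdot,\mu,\gamma)=Q_{\mathcal X}^{-1}[(v,x)\mapsto f(v,x,\mu,\gamma)]$: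 $\check e=\frac1n\sum_i\partial_\gamma\bar f(V_i'',Z_i'',\check\mu,\check\gamma)$. For an arbitrary initial real-valued estimate $\psi(\hat P_{VZ})$, $\check{\tilde\chi}(v,x)=\check r(v_1,x)(m(v,x)-\check\mu(v_1,x))+\frac{1\{v_2=c\}}{\check p}(g(v,x)-\check\gamma)\check e+f(v,x,\check\mu,\check\gamma)-\psi(\hat P_{VZ})$, $\hat{\tilde\psi}=Q_{\mathcal X}^{-1}\check{\tilde\chi}$, and $\hat\psi_n=\psi(\hat P_{VZ})+\frac1n\sum_{i=1}^n\hat{\tilde\psi}(V_i,Z_i)$ (which does not depend on $\psi(\hat P_{VZ})$). Notation. $o_{P_{VZ}},O_{P_{VZ}}$ are stochastic orders under sampling from $P_{VZ}$; $\|\cdot\|_\infty$ is the supremum norm; $\rho((\mu,\gamma),(\mu',\gamma'))=\|\mu-\mu'\|_{L_2(P_{VX})}+|\gamma-\gamma'|$. Assumption (A) (consistency). Either $Q\in\mathcal Q_\delta$ (set $\iota=1$), or $Q\in\mathcal Q_J^I$ and $(V,X)$ takes values in a finite set with density $p_{VX}$ w.r.t. counting measure (set $\iota=0$). Let $\|h\|_{\mathrm L}=\|h\|_{L_2(P_{VX})}+\iota\|h\|_{L_2(P_V\otimes\bar Q)}$, $P_{\mathrm L}=P_{VX}+\iota P_V\otimes\bar Q$, and $\mathrm L$ the set of $h:\mathfrak V\times\mathfrak X\to\mathbb R$ with $\|h\|_{\mathrm L}<\infty$. Then $\tilde\chi,\check{\tilde\chi},r\in\mathrm L$; as $\rho((\mu,\gamma),(\mu_{\mathcal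 X},\gamma_{\mathcal V}(c)))\to0$, $\|f(\cdot,\mu,\gamma)-f(\cdot,\mu_{\mathcal X},\gamma_{\mathcal V}(c))\|_{\mathrm L}\to0$ and $\|\partial_\gamma f(\cdot,\mu,\gamma)-\partial_\gamma f(\cdot,\mu_{\mathcal X},\gamma_{\mathcal V}(c))\|_{\mathrm L}\to0$; $\|\check r-r\|_{\mathrm L}=o_{P_{VZ}}(1)$, $\check\gamma-\gamma_{\mathcal V}(c)=o_{P_{VZ}}(1)$, $\check p-p_{V_2}(c)=o_{P_{VZ}}(1)$. Further, either (i) $\|m-\mu_{\mathcal X}\|_\infty<\infty$ and $\|\mu_{\mathcal X}-\check\mu\|_\infty=o_{P_{VZ}}(1)$; or (ii) $\|m-\check\mu\|_\infty=O_{P_{VZ}}(1)$, $\|\mu_{\mathcal X}-\check\mu\|_{\mathrm L}=o_{P_{VZ}}(1)$, and $P_{\mathrm L}(|r|>\bar R)=0$ for some constant $\bar R<\infty$. (One may replace $\|\cdot\|_{\mathrm L}$ by $\|\cdot\|_\infty$ and the last condition by $\|r\|_\infty<\infty$.) Assumption (B) (rates). $P_{VX}[(\check\mu-\mu_{\mathcal X})(\check r-r)]=o_{P_{VZ}}(n^{-1/2})$, $\check\gamma-\gamma_{\mathcal V}(c)=O_{P_{VZ}}(n^{-1/2})$, $\check p-p_{V_2}(c)=O_{P_{VZ}}(n^{-1/2})$, and $P_{VX}\,\partial_\gamma^2f(V,X,\check\mu,\tilde\gamma)=O_{P_{VZ}}(1)$ for $\tilde\gamma$ between $\check\gamma$ and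 $\gamma_{\mathcal V}(c)$.
   Formalization: For Q_J^I with the L-norm (not the sup-norm), p_VX(v,x)>0 for all x whenever P(V=v)>0 is required, else the claim fails; Γ is an interval; f is C² in γ also P_L-a.e.; the derivative of f-bar in γ is read as Q_X^{-1} applied to that of f, as it need not exist otherwise. *)

theory Defs
  imports "HOL-Probability.Probability"
begin

section \<open>Norms and stochastic orders\<close>

text \<open>Elements of \<open>L\<^sub>2(M)\<close> are represented by functions (not by equivalence classes).\<close>

definition L2 :: "'b measure \<Rightarrow> ('b \<Rightarrow> real) set" where
  "L2 M = {h \<in> borel_measurable M. integrable M (\<lambda>w. (h w)\<^sup>2)}"

definition L2_norm :: "'b measure \<Rightarrow> ('b \<Rightarrow> real) \<Rightarrow> ennreal" where
  "L2_norm M h = (if h \<in> L2 M then ennreal (sqrt (\<integral>w. (h w)\<^sup>2 \<partial>M)) else \<infinity>)"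

text \<open>The norm \<open>\<parallel>h\<parallel>\<^sub>L\<close> is the sum of the \<open>L\<^sub>2\<close>-norms over a list of laws: \<open>[P\<^sub>V\<^sub>X]\<close> when
  \<open>\<iota> = 0\<close>, and \<open>[P\<^sub>V\<^sub>X, P\<^sub>V \<Otimes> Qbar]\<close> when \<open>\<iota> = 1\<close>. Accordingly \<open>P\<^sub>L\<close>-null means null for
  every law in the list.\<close>

definition L_norm :: "'b measure list \<Rightarrow> ('b \<Rightarrow> real) \<Rightarrow> ennreal" where
  "L_norm Ps h = (\<Sum>R\<leftarrow>Ps. L2_norm R h)"

definition sup_norm :: "'b set \<Rightarrow> ('b \<Rightarrow> real) \<Rightarrow> ennreal" where
  "sup_norm S h = (SUP w\<in>S. ennreal \<bar>h w\<bar>)"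

text \<open>Outer probability is used because, e.g., suprema of random functions need not be
  measurable; for measurable events it is the probability.\<close>

definition o_P :: "'w measure \<Rightarrow> (nat \<Rightarrow> 'w \<Rightarrow> ennreal) \<Rightarrow> bool" where
  "o_P M Y \<longleftrightarrow> (\<forall>\<epsilon>>0::real.
     (\<lambda>n. outer_measure_of M {\<omega> \<in> space M. ennreal \<epsilon> < Y n \<omega>}) \<longlonglongrightarrow> 0)"

definition O_P :: "'w measure \<Rightarrow> (nat \<Rightarrow> 'w \<Rightarrow> ennreal) \<Rightarrow> bool" where
  "O_P M Y \<longleftrightarrow> (\<forall>\<epsilon>>0::real. \<exists>C::real. \<forall>\<^sub>F n in sequentially.
     outer_measure_of M {\<omega> \<in> space M. ennreal C < Y n \<omega>} < ennreal \<epsilon>)"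

text \<open>\<open>\<bar>P h\<bar>\<close>, with an undefined integral counted as infinite.\<close>

definition abs_mean :: "'b measure \<Rightarrow> ('b \<Rightarrow> real) \<Rightarrow> ennreal" where
  "abs_mean P h = (if integrable P h then ennreal \<bar>\<integral>w. h w \<partial>P\<bar> else \<infinity>)"

text \<open>The law \<open>N(0, s)\<close>; the case \<open>s = 0\<close> is the point mass at \<open>0\<close>.\<close>

definition centered_normal :: "real \<Rightarrow> real measure" where
  "centered_normal s = distr std_normal_distribution borel (\<lambda>x. sqrt s * x)"


section \<open>The target\<close>

text \<open>A point \<open>v\<close> of the product space is a function on the coordinate index set, and the
  collection of its coordinates with index in \<open>K1\<close> is \<open>restrict v K1\<close>.\<close>

definition V1X :: "'k set \<Rightarrow> ('k \<Rightarrow> 'c) \<times> 'a \<Rightarrow> ('k \<Rightarrow> 'c) \<times> 'a" where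
  "V1X K1 = (\<lambda>(v, x). (restrict v K1, x))"

definition V2 :: "'k set \<Rightarrow> ('k \<Rightarrow> 'c) \<times> 'a \<Rightarrow> ('k \<Rightarrow> 'c)" where
  "V2 K2 = (\<lambda>(v, x). restrict v K2)"

text \<open>\<open>\<phi>(t) = E[h | T = t]\<close>. The library's \<^const>\<open>real_cond_exp\<close> is the difference of the conditional
  expectations of the positive and negative parts, so that \<open>h\<close> itself need not be integrable.\<close>

definition cond_mean ::
  "'b measure \<Rightarrow> ('b \<Rightarrow> 't) \<Rightarrow> 't measure \<Rightarrow> ('b \<Rightarrow> real) \<Rightarrow> ('t \<Rightarrow> real) \<Rightarrow> bool" where
  "cond_mean P T N h \<phi> \<longleftrightarrow> \<phi> \<in> borel_measurable N \<and>
     (AE w in P. real_cond_exp P (vimage_algebra (space P) T N) h w = \<phi> (T w))"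

definition C2_in_gamma ::
  "real set \<Rightarrow> (real \<Rightarrow> real) \<Rightarrow> (real \<Rightarrow> real) \<Rightarrow> (real \<Rightarrow> real) \<Rightarrow> bool" where
  "C2_in_gamma \<Gamma> F F' F'' \<longleftrightarrow>
     (\<forall>\<gamma>\<in>\<Gamma>. (F has_real_derivative F' \<gamma>) (at \<gamma> within \<Gamma>) \<and>
            (F' has_real_derivative F'' \<gamma>) (at \<gamma> within \<Gamma>)) \<and> continuous_on \<Gamma> F''"

text \<open>The common form of \<open>\<chi>\<close>-tilde (at the true nuisance parameters) and of its estimate (at
  the estimated ones).\<close>

definition score where
  "score K1 K2 c m g f r \<mu> \<gamma> p e k = (\<lambda>w :: ('k \<Rightarrow> 'c) \<times> 'a.
     r (V1X K1 w) * (m w - \<mu> (V1X K1 w)) + of_bool (V2 K2 w = c) / p * (g w - \<gamma>) * e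
     + f w \<mu> \<gamma> - k :: real)"


section \<open>Privacy mechanisms\<close>

definition law_VZ ::
  "'v measure \<Rightarrow> 'z measure \<Rightarrow> ('a \<Rightarrow> 'z measure) \<Rightarrow> ('v \<times> 'a) measure \<Rightarrow> ('v \<times> 'z) measure" where
  "law_VZ MV MZ Q P = P \<bind> (\<lambda>(v, x). distr (Q x) (MV \<Otimes>\<^sub>M MZ) (Pair v))"

lemma emeasure_law_VZ:
  assumes P: "prob_space P" "sets P = sets (MV \<Otimes>\<^sub>M MX)"
    and Q: "Q \<in> MX \<rightarrow>\<^sub>M prob_algebra MZ"
    and B: "Bv \<in> sets MV" "Bz \<in> sets MZ"
  shows "emeasure (law_VZ MV MZ Q P) (Bv \<times> Bz) =
    (\<integral>\<^sup>+(v, x). indicator Bv v * emeasure (Q x) Bz \<partial>P)"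
proof -
  have ne: "space P \<noteq> {}"
    using prob_space.not_empty[OF P(1)] .
  have QZ: "sets (Q x) = sets MZ" if "x \<in> space MX" for x
    using measurable_space[OF Q that] by (simp add: space_prob_algebra)
  have PS: "space P = space MV \<times> space MX"
    using sets_eq_imp_space_eq[OF P(2)] by (simp add: space_pair_measure)
  have Q': "Q \<in> MX \<rightarrow>\<^sub>M subprob_algebra MZ"
    by (rule measurable_prob_algebraD[OF Q])
  have K: "(\<lambda>(v, x). distr (Q x) (MV \<Otimes>\<^sub>M MZ) (Pair v)) \<in>
      P \<rightarrow>\<^sub>M subprob_algebra (MV \<Otimes>\<^sub>M MZ)"
    unfolding case_prod_beta
  proof (rule measurable_distr2[where M = "MZ"])
    show "(\<lambda>(w, z). (fst w, z)) \<in> P \<Otimes>\<^sub>M MZ \<rightarrow>\<^sub>M MV \<Otimes>\<^sub>M MZ"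
      by (subst measurable_cong_sets[OF sets_pair_measure_cong[OF P(2) refl] refl]) measurable
    show "(\<lambda>w. Q (snd w)) \<in> P \<rightarrow>\<^sub>M subprob_algebra MZ"
      by (subst measurable_cong_sets[OF P(2) refl]) (rule measurable_compose[OF measurable_snd Q'])
  qed
  have "emeasure (law_VZ MV MZ Q P) (Bv \<times> Bz) =
      (\<integral>\<^sup>+w. emeasure ((\<lambda>(v, x). distr (Q x) (MV \<Otimes>\<^sub>M MZ) (Pair v)) w) (Bv \<times> Bz) \<partial>P)"
    unfolding law_VZ_def by (rule emeasure_bind[OF ne K]) (simp add: B)
  also have "\<dots> = (\<integral>\<^sup>+(v, x). indicator Bv v * emeasure (Q x) Bz \<partial>P)"
  proof (intro nn_integral_cong, clarify)
    fix v x assume "(v, x) \<in> space P"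
    then have v: "v \<in> space MV" and x: "x \<in> space MX" by (auto simp: PS)
    have M: "Pair v \<in> Q x \<rightarrow>\<^sub>M MV \<Otimes>\<^sub>M MZ"
      by (subst measurable_cong_sets[OF QZ[OF x] refl]) (rule measurable_Pair1'[OF v])
    have "Pair v -` (Bv \<times> Bz) \<inter> space (Q x) = (if v \<in> Bv then Bz else {})"
      using sets.sets_into_space[OF B(2)] sets_eq_imp_space_eq[OF QZ[OF x]] by auto
    then show "emeasure (distr (Q x) (MV \<Otimes>\<^sub>M MZ) (Pair v)) (Bv \<times> Bz) =
        indicator Bv v * emeasure (Q x) Bz"
      by (subst emeasure_distr[OF M]) (auto simp: B split: split_indicator)
  qed
  finally show ?thesis .
qed

definition Q_op :: "('a \<Rightarrow> 'z measure) \<Rightarrow> ('v \<times> 'z \<Rightarrow> real) \<Rightarrow> 'v \<times> 'a \<Rightarrow> real" where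
  "Q_op Q k = (\<lambda>(v, x). \<integral>z. k (v, z) \<partial>Q x)"

text \<open>The class \<open>Q\<^sub>J\<^sup>I\<close> with \<open>J = CARD('j)\<close> and the enumerations \<open>xs\<close>, \<open>zs\<close> of the two finite spaces.\<close>

definition mech_matrix :: "('a \<Rightarrow> 'z measure) \<Rightarrow> ('j \<Rightarrow> 'a) \<Rightarrow> ('j \<Rightarrow> 'z) \<Rightarrow> real^'j^'j::finite" where
  "mech_matrix Q xs zs = (\<chi> j k. measure (Q (xs k)) {zs j})"

definition mech_J ::
  "'v measure \<Rightarrow> 'a measure \<Rightarrow> 'z measure \<Rightarrow> ('v \<times> 'a) measure \<Rightarrow> ('a \<Rightarrow> 'z measure) \<Rightarrow>
    ('j::finite \<Rightarrow> 'a) \<Rightarrow> ('j \<Rightarrow> 'z) \<Rightarrow> bool" where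
  "mech_J MV MX MZ P Q xs zs \<longleftrightarrow>
     Q \<in> MX \<rightarrow>\<^sub>M prob_algebra MZ \<and>
     bij_betw xs UNIV (space MX) \<and> sets MX = Pow (space MX) \<and>
     bij_betw zs UNIV (space MZ) \<and> sets MZ = Pow (space MZ) \<and>
     (\<exists>\<nu> p. sigma_finite_measure \<nu> \<and> sets \<nu> = sets MV \<and>
        p \<in> borel_measurable (\<nu> \<Otimes>\<^sub>M count_space (space MX)) \<and>
        P = density (\<nu> \<Otimes>\<^sub>M count_space (space MX)) p) \<and>
     invertible (mech_matrix Q xs zs)"

definition inv_J ::
  "('a \<Rightarrow> 'z measure) \<Rightarrow> ('j::finite \<Rightarrow> 'a) \<Rightarrow> ('j \<Rightarrow> 'z) \<Rightarrow> ('v \<times> 'a \<Rightarrow> real) \<Rightarrow> 'v \<times> 'z \<Rightarrow> real" where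
  "inv_J Q xs zs h = (\<lambda>(v, z).
     (matrix_inv (transpose (mech_matrix Q xs zs)) *v (\<chi> j. h (v, xs j))) $ (inv zs z))"

definition mech_delta ::
  "'a measure \<Rightarrow> 'a measure \<Rightarrow> ('a \<Rightarrow> 'a measure) \<Rightarrow> real \<Rightarrow> 'a measure \<Rightarrow> bool" where
  "mech_delta MX MZ Q \<alpha> Qbar \<longleftrightarrow>
     Q \<in> MX \<rightarrow>\<^sub>M prob_algebra MZ \<and> sets MZ = sets MX \<and>
     0 < \<alpha> \<and> \<alpha> < 1 \<and> prob_space Qbar \<and> sets Qbar = sets MX \<and>
     (\<forall>x\<in>space MX. \<forall>B\<in>sets MX. measure (Q x) B = \<alpha> * indicator B x + (1 - \<alpha>) * measure Qbar B)"

definition inv_delta :: "real \<Rightarrow> 'a measure \<Rightarrow> ('v \<times> 'a \<Rightarrow> real) \<Rightarrow> 'v \<times> 'a \<Rightarrow> real" where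
  "inv_delta \<alpha> Qbar h = (\<lambda>(v, z).
     1 / \<alpha> * h (v, z) - (1 - \<alpha>) / \<alpha> * (\<integral>x. h (v, x) \<partial>Qbar))"

lemma Q_op_inv_J:
  fixes Q :: "'a \<Rightarrow> 'z measure" and xs :: "'j::finite \<Rightarrow> 'a" and zs :: "'j \<Rightarrow> 'z"
  assumes J: "mech_J MV MX MZ P Q xs zs" and x: "x \<in> space MX"
  shows "Q_op Q (inv_J Q xs zs h) (v, x) = h (v, x)"
proof -
  define A where "A = transpose (mech_matrix Q xs zs)"
  define H :: "real^'j" where "H = (\<chi> j. h (v, xs j))"
  have Q: "Q \<in> MX \<rightarrow>\<^sub>M prob_algebra MZ" and inv: "invertible (mech_matrix Q xs zs)"
    and SZ: "sets MZ = Pow (space MZ)" and inj: "inj zs" and range: "range zs = space MZ"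
    using J by (auto simp: mech_J_def bij_betw_def)
  have "x \<in> range xs"
    using J x by (simp add: mech_J_def bij_betw_def)
  then obtain j where j: "x = xs j" by auto
  have SQ: "sets (Q x) = sets MZ" and PQ: "prob_space (Q x)"
    using measurable_space[OF Q x] by (auto simp: space_prob_algebra)
  interpret Qx: prob_space "Q x" by (rule PQ)
  have SQ': "sets (Q x) = Pow (range zs)"
    using SQ SZ range by simp
  have Qx: "Q x = point_measure (range zs) (\<lambda>z. ennreal (measure (Q x) {z}))"
    by (rule measure_eqI_finite[where A = "range zs"])
      (auto simp: SQ' sets_point_measure emeasure_point_measure_finite Qx.emeasure_eq_measure)
  have "A ** matrix_inv A = mat 1"
    using transpose_invertible[OF inv] unfolding A_def invertible_def matrix_inv_def
    by (metis (mono_tags, lifting) someI_ex)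
  then have AH: "A *v (matrix_inv A *v H) = H"
    by (metis matrix_vector_mul_assoc matrix_vector_mul_lid)
  have "Q_op Q (inv_J Q xs zs h) (v, x) =
      (\<Sum>z\<in>range zs. measure (Q x) {z} * inv_J Q xs zs h (v, z))"
    unfolding Q_op_def case_prod_conv
    by (subst Qx) (simp add: lebesgue_integral_point_measure_finite)
  also have "\<dots> = (\<Sum>i\<in>UNIV. measure (Q x) {zs i} * (matrix_inv A *v H) $ i)"
    by (subst sum.reindex[OF inj]) (simp add: inv_J_def A_def H_def inv_f_f[OF inj])
  also have "\<dots> = (A *v (matrix_inv A *v H)) $ j"
    by (subst (2) matrix_vector_mult_def)
      (simp add: A_def transpose_def mech_matrix_def j)
  also have "\<dots> = h (v, x)"
    unfolding AH by (simp add: H_def j)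
  finally show ?thesis .
qed

lemma nn_integral_mech_delta:
  assumes D: "mech_delta MX MZ Q \<alpha> Qbar" and x: "x \<in> space MX" and k: "k \<in> borel_measurable MX"
  shows "(\<integral>\<^sup>+z. k z \<partial>Q x) = ennreal \<alpha> * k x + ennreal (1 - \<alpha>) * (\<integral>\<^sup>+z. k z \<partial>Qbar)"
proof -
  have Q: "Q \<in> MX \<rightarrow>\<^sub>M prob_algebra MZ" and SZ: "sets MZ = sets MX" and a: "0 < \<alpha>" "\<alpha> < 1"
    and Pb: "prob_space Qbar" and Sb: "sets Qbar = sets MX"
    and mq: "\<And>B. B \<in> sets MX \<Longrightarrow> measure (Q x) B = \<alpha> * indicator B x + (1 - \<alpha>) * measure Qbar B"
    using D x by (auto simp: mech_delta_def)
  have SQ: "sets (Q x) = sets MX" and PQ: "prob_space (Q x)"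
    using measurable_space[OF Q x] SZ by (auto simp: space_prob_algebra)
  interpret Qx: prob_space "Q x" by (rule PQ)
  interpret Qb: prob_space Qbar by (rule Pb)
  have mQ: "borel_measurable (Q x) = borel_measurable MX" "borel_measurable Qbar = borel_measurable MX"
    by (auto intro!: measurable_cong_sets simp: SQ Sb)
  show ?thesis
    using k
  proof (induction rule: borel_measurable_induct)
    case (cong f g)
    then show ?case
      using sets_eq_imp_space_eq[OF SQ] sets_eq_imp_space_eq[OF Sb] x
      by (metis (no_types, lifting) nn_integral_cong)
  next
    case (set B)
    then have "(\<integral>\<^sup>+z. indicator B z \<partial>Q x) = ennreal (\<alpha> * indicator B x + (1 - \<alpha>) * measure Qbar B)"
      by (simp add: SQ Qx.emeasure_eq_measure mq)
    also have "\<dots> = ennreal \<alpha> * indicator B x + ennreal (1 - \<alpha>) * (\<integral>\<^sup>+z. indicator B z \<partial>Qbar)"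
      using a set by (simp add: Sb Qb.emeasure_eq_measure ennreal_plus ennreal_mult ennreal_indicator)
    finally show ?case .
  next
    case (mult u b)
    then show ?case
      by (simp add: nn_integral_cmult mQ distrib_left ac_simps)
  next
    case (add u w)
    then show ?case
      by (simp add: nn_integral_add mQ distrib_left ac_simps)
  next
    case (seq U)
    have inc: "incseq (\<lambda>i. U i x)" "incseq (\<lambda>i. \<integral>\<^sup>+z. U i z \<partial>Qbar)"
      using seq by (auto simp: incseq_def le_fun_def intro!: nn_integral_mono)
    have "(\<integral>\<^sup>+z. (SUP i. U i) z \<partial>Q x) = (SUP i. \<integral>\<^sup>+z. U i z \<partial>Q x)"
      using seq by (simp add: image_comp nn_integral_monotone_convergence_SUP mQ)
    also have "\<dots> = (SUP i. ennreal \<alpha> * U i x + ennreal (1 - \<alpha>) * (\<integral>\<^sup>+z. U i z \<partial>Qbar))"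
      using seq by simp
    also have "\<dots> = (SUP i. ennreal \<alpha> * U i x) + (SUP i. ennreal (1 - \<alpha>) * (\<integral>\<^sup>+z. U i z \<partial>Qbar))"
      by (rule ennreal_SUP_add)
        (use inc in \<open>auto simp: incseq_def intro!: mult_left_mono\<close>)
    also have "\<dots> = ennreal \<alpha> * (SUP i. U i) x + ennreal (1 - \<alpha>) * (\<integral>\<^sup>+z. (SUP i. U i) z \<partial>Qbar)"
      using seq by (simp add: image_comp nn_integral_monotone_convergence_SUP mQ SUP_mult_left_ennreal)
    finally show ?case
      by (simp add: image_comp)
  qed
qed

lemma Q_op_inv_delta:
  assumes D: "mech_delta MX MZ Q \<alpha> Qbar" and x: "x \<in> space MX"
    and h: "integrable Qbar (\<lambda>x. h (v, x))"
  shows "Q_op Q (inv_delta \<alpha> Qbar h) (v, x) = h (v, x)"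
proof -
  have Q: "Q \<in> MX \<rightarrow>\<^sub>M prob_algebra MZ" and SZ: "sets MZ = sets MX" and a: "0 < \<alpha>" "\<alpha> < 1"
    and Sb: "sets Qbar = sets MX"
    using D x by (auto simp: mech_delta_def)
  have SQ: "sets (Q x) = sets MX" and PQ: "prob_space (Q x)"
    using measurable_space[OF Q x] SZ by (auto simp: space_prob_algebra)
  interpret Qx: prob_space "Q x" by (rule PQ)
  define k where "k z = h (v, z)" for z
  have k: "k \<in> borel_measurable MX"
    using borel_measurable_integrable[OF h] unfolding measurable_cong_sets[OF Sb refl] k_def .
  then have kQ: "k \<in> borel_measurable (Q x)" and kb: "k \<in> borel_measurable Qbar"
    unfolding measurable_cong_sets[OF SQ refl] measurable_cong_sets[OF Sb refl] by auto
  have hb: "integrable Qbar k"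
    using h by (simp add: k_def[abs_def])
  note nn = nn_integral_mech_delta[OF D x]
  define p q where "p = (\<integral>\<^sup>+z. ennreal (k z) \<partial>Qbar)" and "q = (\<integral>\<^sup>+z. ennreal (- k z) \<partial>Qbar)"
  have fin: "p < \<infinity>" "q < \<infinity>"
    using hb by (auto simp: real_integrable_def p_def q_def less_top)
  have pos: "(\<integral>\<^sup>+z. ennreal (k z) \<partial>Q x) = ennreal \<alpha> * ennreal (k x) + ennreal (1 - \<alpha>) * p"
    and neg: "(\<integral>\<^sup>+z. ennreal (- k z) \<partial>Q x) = ennreal \<alpha> * ennreal (- k x) + ennreal (1 - \<alpha>) * q"
    using k by (auto intro!: nn simp: p_def q_def)
  have int: "integrable (Q x) k"
    using fin by (auto simp: real_integrable_def kQ pos neg ennreal_mult_eq_top_iff)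
  have "(\<integral>z. k z \<partial>Q x) = \<alpha> * k x + (1 - \<alpha>) * (\<integral>z. k z \<partial>Qbar)"
    using fin a unfolding real_lebesgue_integral_def[OF int] real_lebesgue_integral_def[OF hb] pos neg
      p_def[symmetric] q_def[symmetric]
    by (cases "0 \<le> k x")
      (auto simp: enn2real_plus enn2real_mult ennreal_mult_less_top ennreal_neg algebra_simps)
  moreover have "Q_op Q (inv_delta \<alpha> Qbar h) (v, x) =
      1 / \<alpha> * (\<integral>z. k z \<partial>Q x) - (1 - \<alpha>) / \<alpha> * (\<integral>z. k z \<partial>Qbar)"
    using int by (simp add: Q_op_def inv_delta_def k_def[symmetric] Qx.prob_space)
  ultimately show ?thesis
    using a by (simp add: k_def[symmetric] field_simps)
qed

definition finitely_supported :: "'v measure \<Rightarrow> 'a measure \<Rightarrow> ('v \<times> 'a) measure \<Rightarrow> bool" where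
  "finitely_supported MV MX P \<longleftrightarrow> (\<exists>A\<subseteq>space MV. finite A \<and> (\<forall>v\<in>A. {v} \<in> sets MV) \<and>
     measure P (A \<times> space MX) = 1)"

text \<open>The density \<open>p\<^sub>V\<^sub>X\<close> is positive on \<open>A \<times> \<XX>\<close>, where \<open>A\<close> is the set of values of \<open>V\<close>. Without this,
  \<open>\<parallel>h\<parallel>\<close> in \<open>L\<^sub>2(P\<^sub>V\<^sub>X)\<close> would not control the inverse of the mechanism applied to \<open>h\<close>, which involves
  all values \<open>h(v, x\<^sub>1), \<dots>, h(v, x\<^sub>J)\<close>.\<close>

definition positive_density :: "'v measure \<Rightarrow> 'a measure \<Rightarrow> ('v \<times> 'a) measure \<Rightarrow> bool" where
  "positive_density MV MX P \<longleftrightarrow> (\<forall>v\<in>space MV. \<forall>x\<in>space MX. \<forall>x'\<in>space MX.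
     0 < measure P {(v, x)} \<longrightarrow> 0 < measure P {(v, x')})"


section \<open>Estimators\<close>

text \<open>A sample of size \<open>n\<close> is a function \<open>s\<close> on \<open>{..<n}\<close>, i.e. an element of a product space.\<close>

definition sample :: "(nat \<Rightarrow> 'w \<Rightarrow> 'b) \<Rightarrow> nat \<Rightarrow> 'w \<Rightarrow> nat \<Rightarrow> 'b" where
  "sample S n \<omega> = (\<lambda>i\<in>{..<n}. S i \<omega>)"

definition avg :: "nat \<Rightarrow> ('b \<Rightarrow> real) \<Rightarrow> (nat \<Rightarrow> 'b) \<Rightarrow> real" where
  "avg n h s = (1 / real n) * (\<Sum>i<n. h (s i))"

definition p_est :: "'k set \<Rightarrow> ('k \<Rightarrow> 'c) \<Rightarrow> nat \<Rightarrow> (nat \<Rightarrow> ('k \<Rightarrow> 'c) \<times> 'a) \<Rightarrow> real" where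
  "p_est K2 c n s = avg n (\<lambda>u. of_bool (V2 K2 u = c)) s"

definition gamma_est where
  "gamma_est Qinv K2 c g n s =
     1 / p_est K2 c n s * avg n (Qinv (\<lambda>w. of_bool (V2 K2 w = c) * g w)) s"

text \<open>Here \<open>f'\<close> stands for \<open>\<partial>\<^sub>\<gamma> f\<close>: the \<open>\<gamma>\<close>-derivative of the transform of \<open>f\<close> is taken under the
  integral with respect to \<open>Qbar\<close>, i.e. it is the transform of \<open>\<partial>\<^sub>\<gamma> f\<close>.\<close>

definition e_est where
  "e_est Qinv f' \<mu> \<gamma> n s = avg n (Qinv (\<lambda>w. f' w \<mu> \<gamma>)) s"

end

theory Submission
  imports Defs
begin

text \<open>Write \<open>T\<close> for the inverse mechanism operator, \<open>h\<^sub>0\<close> for the efficient score without its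
  centring and \<open>h\<^sub>n\<close> for its estimate, and let \<open>D\<^sub>n = h\<^sub>n - h\<^sub>0\<close>. As \<open>T\<close> is linear and fixes constants,
  \<open>\<surd>n\<close> times the error of the estimator is \<open>\<surd>n\<close> times the average of \<open>T\<close> applied to the centred score,
  plus the empirical process at \<open>T D\<^sub>n\<close>, plus the bias \<open>\<surd>n P D\<^sub>n\<close>. The first term obeys the central limit
  theorem. Given the two auxiliary samples, the second has variance at most a constant times
  \<open>\<parallel>D\<^sub>n\<parallel>\<^sub>L\<^sup>2\<close>, which tends to zero by consistency. In the bias, conditional centring of the residual and
  the Riesz representation leave the product of the errors of \<open>\<mu>\<close> and \<open>r\<close> and a term
  \<open>(\<gamma>\<^sub>n - \<gamma>\<^sub>c) \<cdot> o\<^sub>P(1)\<close>, because continuity of \<open>\<partial>\<^sub>\<gamma> f\<close> makes the increment of \<open>P f\<close> in \<open>\<gamma>\<close> equal to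
  \<open>(\<gamma>\<^sub>n - \<gamma>\<^sub>c)(e + o\<^sub>P(1))\<close> and the second score term subtracts \<open>(\<gamma>\<^sub>n - \<gamma>\<^sub>c)(e + o\<^sub>P(1))\<close>.\<close>

section \<open>Convergence in probability as convergence along a filter\<close>

text \<open>Two obstacles shape the details. The inverse operator contains a Bochner integral, which
  is 0 for a non-integrable section, so \<open>T\<close> is additive only at points with integrable
  sections. That all points of the main sample are of this kind, with probability tending to one, is
  itself proved by Chebyshev's inequality with variance bound 0. Moreover, the estimates are
  controlled only with probability tending to one: elsewhere their norms may be infinite, and no
  moment over the auxiliary samples need exist. Hence limits are taken along a filter, and
  conditional variances enter only on the event where they are small. A third sample serves the
  plug-in estimate of e, because its summands already depend on the second one. The increment of P f
  in \<gamma> is compared with the slope at the true parameters; the estimate of e then only has to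
  be consistent, without any rate.\<close>

lemma outer_measure_of_Un_le:
  "outer_measure_of M (A \<union> B) \<le> outer_measure_of M A + outer_measure_of M B"
proof (cases "A \<subseteq> space M \<and> B \<subseteq> space M")
  case True
  then obtain E F where E: "E \<in> sets M" "A \<subseteq> E" "outer_measure_of M A = emeasure M E"
    and F: "F \<in> sets M" "B \<subseteq> F" "outer_measure_of M B = emeasure M F"
    by (metis outer_measure_of_attain)
  have "outer_measure_of M (A \<union> B) \<le> outer_measure_of M (E \<union> F)"
    using E F by (intro outer_measure_of_mono) auto
  also have "\<dots> \<le> emeasure M E + emeasure M F"
    using E F by (simp add: emeasure_subadditive)
  finally show ?thesis using E F by simp
next
  case False
  \<comment> \<open>\<open>outer_measure_of\<close> is an infimum over measurable supersets. A set
    that leaves the space has none, and the infimum of the empty set is \<infinity>.\<close>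
  have top: "outer_measure_of M C = \<infinity>" if "\<not> C \<subseteq> space M" for C
  proof -
    have "{D \<in> sets M. C \<subseteq> D} = {}"
      using that sets.sets_into_space by blast
    then show ?thesis unfolding outer_measure_of_def by (simp only:) simp
  qed
  have "outer_measure_of M A = \<infinity> \<or> outer_measure_of M B = \<infinity>"
    using False top[of A] top[of B] by argo
  then show ?thesis by auto
qed

text \<open>The filter of the events with probability approaching one. Along it, \<open>o\<^sub>P(1)\<close> is ordinary
  convergence to zero.\<close>

definition wpa1 :: "'w measure \<Rightarrow> (nat \<times> 'w) filter" where
  "wpa1 M = Abs_filter (\<lambda>A. (\<lambda>n. outer_measure_of M {\<omega> \<in> space M. \<not> A (n, \<omega>)}) \<longlonglongrightarrow> 0)"

text \<open>Subadditivity of outer measure makes these events a filter; closure under conjunction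
  (case 2) is where it enters.\<close>

lemma eventually_wpa1:
  "eventually A (wpa1 M) \<longleftrightarrow> (\<lambda>n. outer_measure_of M {\<omega> \<in> space M. \<not> A (n, \<omega>)}) \<longlonglongrightarrow> 0"
  unfolding wpa1_def
proof (rule eventually_Abs_filter, standard, goal_cases)
  case 1
  show ?case by simp
next
  case (2 A B)
  let ?o = "\<lambda>A n. outer_measure_of M {\<omega> \<in> space M. \<not> A (n, \<omega>)}"
  have "(\<lambda>n. ?o A n + ?o B n) \<longlonglongrightarrow> 0 + 0"
    using 2 by (intro tendsto_add) auto
  then have lim: "(\<lambda>n. ?o A n + ?o B n) \<longlonglongrightarrow> 0" by simp
  have "?o (\<lambda>x. A x \<and> B x) n \<le> ?o A n + ?o B n" for n
    by (rule order_trans[OF outer_measure_of_mono outer_measure_of_Un_le]) auto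
  then show ?case
    by (intro tendsto_sandwich[OF _ _ tendsto_const lim]) auto
next
  case (3 A B)
  have "outer_measure_of M {\<omega> \<in> space M. \<not> B (n, \<omega>)} \<le> outer_measure_of M {\<omega> \<in> space M. \<not> A (n, \<omega>)}" for n
    using 3(1) by (intro outer_measure_of_mono) auto
  then show ?case
    by (intro tendsto_sandwich[OF _ _ tendsto_const 3(2)]) auto
qed

lemma eventually_wpa1_D:
  "eventually A (wpa1 M) \<Longrightarrow> (\<lambda>n. outer_measure_of M {\<omega> \<in> space M. \<not> A (n, \<omega>)}) \<longlonglongrightarrow> 0"
  by (simp add: eventually_wpa1)

lemma eventually_wpa1_space: "eventually (\<lambda>(n, \<omega>). \<omega> \<in> space M) (wpa1 M)"
  by (simp add: eventually_wpa1)

lemma eventually_wpa1_sequentially: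
  assumes "eventually A sequentially"
  shows "eventually (\<lambda>(n, \<omega>). A n) (wpa1 M)"
proof -
  have "eventually (\<lambda>n. outer_measure_of M {\<omega> \<in> space M. \<not> A n} = 0) sequentially"
    using assms by eventually_elim simp
  then show ?thesis
    by (simp add: eventually_wpa1 tendsto_eventually)
qed

lemma eventually_wpa1_AE:
  assumes "\<And>n. AE \<omega> in M. A n \<omega>"
  shows "eventually (\<lambda>(n, \<omega>). A n \<omega>) (wpa1 M)"
proof -
  have "outer_measure_of M {\<omega> \<in> space M. \<not> A n \<omega>} = 0" for n
  proof -
    obtain E where "{\<omega> \<in> space M. \<not> A n \<omega>} \<subseteq> E" "E \<in> sets M" "emeasure M E = 0"
      using assms[of n] by (rule AE_E)
    then have "outer_measure_of M {\<omega> \<in> space M. \<not> A n \<omega>} \<le> 0"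
      using outer_measure_of_mono[of _ E M] by (metis outer_measure_of_eq)
    then show ?thesis by simp
  qed
  then show ?thesis by (simp add: eventually_wpa1)
qed

lemma o_P_iff_tendsto: "o_P M Y \<longleftrightarrow> ((\<lambda>(n, \<omega>). Y n \<omega>) \<longlongrightarrow> 0) (wpa1 M)"
proof
  assume "o_P M Y"
  then have ev: "eventually (\<lambda>(n, \<omega>). Y n \<omega> \<le> ennreal \<epsilon>) (wpa1 M)" if "\<epsilon> > 0" for \<epsilon>
    using that by (simp add: o_P_def eventually_wpa1 not_le)
  show "((\<lambda>(n, \<omega>). Y n \<omega>) \<longlongrightarrow> 0) (wpa1 M)"
  proof (rule order_tendstoI)
    fix a :: ennreal assume "0 < a"
    then obtain e :: ennreal where e: "0 < e" "e < a" using dense by blast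
    then obtain e' where e': "e = ennreal e'" "e' > 0"
      by (cases e) (auto simp: less_top[symmetric])
    show "eventually (\<lambda>x. (case x of (n, \<omega>) \<Rightarrow> Y n \<omega>) < a) (wpa1 M)"
      using ev[OF e'(2)] by eventually_elim (use e e' in \<open>auto intro: le_less_trans\<close>)
  qed simp
next
  assume lim: "((\<lambda>(n, \<omega>). Y n \<omega>) \<longlongrightarrow> 0) (wpa1 M)"
  show "o_P M Y"
    unfolding o_P_def
  proof safe
    fix \<epsilon> :: real assume "0 < \<epsilon>"
    then have "eventually (\<lambda>(n, \<omega>). Y n \<omega> \<le> ennreal \<epsilon>) (wpa1 M)"
      using order_tendstoD(2)[OF lim, of "ennreal \<epsilon>"] by (auto elim!: eventually_mono)
    then show "(\<lambda>n. outer_measure_of M {\<omega> \<in> space M. ennreal \<epsilon> < Y n \<omega>}) \<longlonglongrightarrow> 0"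
      by (simp add: eventually_wpa1 not_le)
  qed
qed

lemma ennreal_dense_above_0: "0 < b \<Longrightarrow> \<exists>d::real. d > 0 \<and> ennreal d < b"
proof -
  assume "0 < b"
  then obtain d where "0 < d" "d < b" using dense by blast
  then show ?thesis by (cases d) auto
qed

text \<open>The non-strict bound matches \<open>o_P\<close>, whose exceptional event is a strict
  inequality; halving the tolerance recovers the strict one.\<close>

lemma tendsto_wpa1_real_iff:
  fixes Y :: "nat \<times> 'w \<Rightarrow> real"
  shows "(Y \<longlongrightarrow> 0) (wpa1 M) \<longleftrightarrow> (\<forall>\<epsilon>>0. eventually (\<lambda>x. \<bar>Y x\<bar> \<le> \<epsilon>) (wpa1 M))"
proof
  assume "(Y \<longlongrightarrow> 0) (wpa1 M)"
  then show "\<forall>\<epsilon>>0. eventually (\<lambda>x. \<bar>Y x\<bar> \<le> \<epsilon>) (wpa1 M)"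
    by (auto simp: tendsto_iff dist_real_def elim!: eventually_mono)
next
  assume *: "\<forall>\<epsilon>>0. eventually (\<lambda>x. \<bar>Y x\<bar> \<le> \<epsilon>) (wpa1 M)"
  show "(Y \<longlongrightarrow> 0) (wpa1 M)"
    unfolding tendsto_iff dist_real_def
  proof safe
    fix e :: real assume "e > 0"
    then show "eventually (\<lambda>x. \<bar>Y x - 0\<bar> < e) (wpa1 M)"
      using *[rule_format, of "e / 2"] by (auto elim!: eventually_mono)
  qed
qed

lemma tendsto_wpa1_ennrealI:
  fixes Y :: "nat \<times> 'w \<Rightarrow> ennreal"
  assumes "\<And>\<epsilon>. \<epsilon> > 0 \<Longrightarrow> eventually (\<lambda>x. Y x \<le> ennreal \<epsilon>) (wpa1 M)"
  shows "(Y \<longlongrightarrow> 0) (wpa1 M)"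
proof (rule order_tendstoI)
  fix b :: ennreal assume b: "0 < b"
  obtain d' where d': "d' > 0" "ennreal d' < b" using ennreal_dense_above_0[OF b] by blast
  show "eventually (\<lambda>x. Y x < b) (wpa1 M)"
    using assms[OF d'(1)] by eventually_elim (use d' in auto)
qed simp

lemma o_P_real_tendsto:
  assumes "o_P M (\<lambda>n \<omega>. ennreal \<bar>X n \<omega>\<bar>)"
  shows "((\<lambda>x. X (fst x) (snd x)) \<longlongrightarrow> 0) (wpa1 M)"
  unfolding tendsto_wpa1_real_iff
proof safe
  fix \<epsilon> :: real assume "\<epsilon> > 0"
  then show "eventually (\<lambda>x. \<bar>X (fst x) (snd x)\<bar> \<le> \<epsilon>) (wpa1 M)"
    using assms by (simp add: o_P_def eventually_wpa1 not_le ennreal_less_iff)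
qed

lemma o_P_eventually_le:
  assumes "o_P M Y" "\<epsilon> > 0"
  shows "eventually (\<lambda>x. Y (fst x) (snd x) \<le> ennreal \<epsilon>) (wpa1 M)"
  using assms by (simp add: o_P_def eventually_wpa1 not_le)

text \<open>Off an event of small probability Y is at most a constant C, hence h (Y) at most h (C),
  while X is eventually below any tolerance. The function h allows the coefficient to be Y itself or
  a square of it; it has to be finite at reals, not at \<infinity>.\<close>

lemma O_P_mult_tendsto_0:
  fixes Y :: "nat \<Rightarrow> 'w \<Rightarrow> ennreal" and X Z :: "nat \<times> 'w \<Rightarrow> ennreal"
  assumes Y: "O_P M Y" and X: "(X \<longlongrightarrow> 0) (wpa1 M)"
    and Z: "eventually (\<lambda>(n, \<omega>). Z (n, \<omega>) \<le> h (Y n \<omega>) * X (n, \<omega>)) (wpa1 M)"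
    and h: "mono h" "\<And>C::real. h (ennreal C) < \<infinity>"
  shows "(Z \<longlongrightarrow> 0) (wpa1 M)"
proof -
  have "o_P M (\<lambda>n \<omega>. Z (n, \<omega>))"
    unfolding o_P_def
  proof (safe, rule order_tendstoI)
    fix \<epsilon> :: real and b :: ennreal assume \<epsilon>: "\<epsilon> > 0" and b: "0 < b"
    obtain b' where b': "b' > 0" "ennreal b' < b" using ennreal_dense_above_0[OF b] by blast
    obtain C :: real where C: "eventually (\<lambda>n. outer_measure_of M {\<omega> \<in> space M. ennreal C < Y n \<omega>} < ennreal (b' / 2)) sequentially"
      using Y b' unfolding O_P_def by (meson half_gt_zero)
    obtain H where H: "h (ennreal C) = ennreal H" "H \<ge> 0"
      using h(2)[of C] by (cases "h (ennreal C)") auto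
    \<comment> \<open>The tolerance for X is divided by H + 1 because H may be 0.\<close>
    let ?A = "\<lambda>(n, \<omega>). Z (n, \<omega>) \<le> h (Y n \<omega>) * X (n, \<omega>) \<and> X (n, \<omega>) \<le> ennreal (\<epsilon> / (H + 1))"
    have "0 < ennreal (\<epsilon> / (H + 1))" using \<epsilon> H by simp
    from Z order_tendstoD(2)[OF X this] have "eventually ?A (wpa1 M)"
      by eventually_elim auto
    from eventually_wpa1_D[OF this]
    have A: "eventually (\<lambda>n. outer_measure_of M {\<omega> \<in> space M. \<not> ?A (n, \<omega>)} < ennreal (b' / 2)) sequentially"
      using b' by (intro order_tendstoD(2)) auto
    show "eventually (\<lambda>n. outer_measure_of M {\<omega> \<in> space M. ennreal \<epsilon> < Z (n, \<omega>)} < b) sequentially"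
      using A C
    proof eventually_elim
      case (elim n)
      have "{\<omega> \<in> space M. ennreal \<epsilon> < Z (n, \<omega>)} \<subseteq>
          {\<omega> \<in> space M. \<not> ?A (n, \<omega>)} \<union> {\<omega> \<in> space M. ennreal C < Y n \<omega>}"
      proof (clarsimp simp: not_less)
        fix \<omega> assume lt: "ennreal \<epsilon> < Z (n, \<omega>)" and Y: "Y n \<omega> \<le> ennreal C"
          and Z: "Z (n, \<omega>) \<le> h (Y n \<omega>) * X (n, \<omega>)" and X: "X (n, \<omega>) \<le> ennreal (\<epsilon> / (H + 1))"
        have "Z (n, \<omega>) \<le> ennreal H * ennreal (\<epsilon> / (H + 1))"
          using Z monoD[OF h(1) Y] X H(1) by (metis (no_types, lifting) mult_mono' order_trans zero_le)
        also have "\<dots> \<le> ennreal \<epsilon>"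
          using H \<epsilon> by (simp add: ennreal_mult[symmetric] field_simps)
        finally show False using lt by simp
      qed
      then have "outer_measure_of M {\<omega> \<in> space M. ennreal \<epsilon> < Z (n, \<omega>)} \<le>
          outer_measure_of M {\<omega> \<in> space M. \<not> ?A (n, \<omega>)} + outer_measure_of M {\<omega> \<in> space M. ennreal C < Y n \<omega>}"
        by (meson order_trans outer_measure_of_mono outer_measure_of_Un_le)
      also have "\<dots> < ennreal (b' / 2) + ennreal (b' / 2)"
        using elim by (intro add_strict_mono) auto
      also have "\<dots> < b"
        using b' by (simp flip: ennreal_plus)
      finally show ?case .
    qed
  qed simp
  then show ?thesis by (simp add: o_P_iff_tendsto)
qed

lemma O_P_mult_tendsto_0_real:
  fixes Y X :: "nat \<times> 'w \<Rightarrow> real"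
  assumes Y: "O_P M (\<lambda>n \<omega>. ennreal \<bar>Y (n, \<omega>)\<bar>)" and X: "(X \<longlongrightarrow> 0) (wpa1 M)"
  shows "((\<lambda>x. Y x * X x) \<longlongrightarrow> 0) (wpa1 M)"
proof -
  have "((\<lambda>x. ennreal \<bar>X x\<bar>) \<longlongrightarrow> ennreal \<bar>0\<bar>) (wpa1 M)"
    by (intro tendsto_ennrealI tendsto_rabs X)
  then have X': "((\<lambda>x. ennreal \<bar>X x\<bar>) \<longlongrightarrow> 0) (wpa1 M)" by simp
  have "((\<lambda>x. ennreal \<bar>Y x * X x\<bar>) \<longlongrightarrow> 0) (wpa1 M)"
  proof (rule O_P_mult_tendsto_0[OF Y X', where h = "\<lambda>x. x"])
    show "eventually (\<lambda>(n, \<omega>). ennreal \<bar>Y (n, \<omega>) * X (n, \<omega>)\<bar> \<le>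
        ennreal \<bar>Y (n, \<omega>)\<bar> * ennreal \<bar>X (n, \<omega>)\<bar>) (wpa1 M)"
      by (rule always_eventually) (auto simp: abs_mult ennreal_mult)
  qed (auto simp: mono_def)
  then have "((\<lambda>x. \<bar>Y x * X x\<bar>) \<longlongrightarrow> 0) (wpa1 M)"
    by (subst (asm) ennreal_0[symmetric], subst (asm) tendsto_ennreal_iff) simp_all
  then show ?thesis by (rule tendsto_rabs_zero_cancel)
qed

section \<open>The central limit theorem with a negligible remainder\<close>

lemma norm_iexp_diff_le: "norm (iexp a - iexp b) \<le> \<bar>a - b\<bar>" for a b :: real
proof -
  have "iexp a = iexp b * iexp (a - b)"
    by (simp add: algebra_simps flip: exp_add)
  then have "iexp a - iexp b = iexp b * (iexp (a - b) - 1)"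
    by (simp only:) (simp add: algebra_simps)
  then have "norm (iexp a - iexp b) = norm (iexp (a - b) - 1)"
    by (simp add: norm_mult)
  then show ?thesis
    using iexp_approx1[of "a - b" 0] by simp
qed

lemma real_distribution_centered_normal: "real_distribution (centered_normal s)"
proof -
  interpret prob_space std_normal_distribution
    by (rule prob_space_normal_density) simp
  show ?thesis
    unfolding centered_normal_def by (rule real_distribution_distr) simp
qed

text \<open>Levy's theorem reduces the claim to characteristic functions. As \<open>iexp\<close> is
  1-Lipschitz and has modulus 1, those of Y and X at t differ by at most
  \<open>\<bar>t\<bar> * \<epsilon>\<close> plus twice the probability that Y and X are more than
  \<epsilon> apart.\<close>

lemma (in prob_space) slutsky:
  fixes X Y :: "nat \<Rightarrow> 'a \<Rightarrow> real"
  assumes X: "\<And>n. random_variable borel (X n)" and Y: "\<And>n. random_variable borel (Y n)"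
    and L: "real_distribution L" and conv: "weak_conv_m (\<lambda>n. distr M borel (X n)) L"
    and diff: "((\<lambda>(n, \<omega>). Y n \<omega> - X n \<omega>) \<longlongrightarrow> 0) (wpa1 M)"
  shows "weak_conv_m (\<lambda>n. distr M borel (Y n)) L"
proof (rule levy_continuity)
  note [measurable] = X Y
  show "real_distribution (distr M borel (Y n))" for n
    by (rule real_distribution_distr) simp
  show "real_distribution L" by fact
  fix t
  have chX: "(\<lambda>n. char (distr M borel (X n)) t) \<longlonglongrightarrow> char L t"
    by (rule levy_continuity1[OF _ L conv]) (rule real_distribution_distr, simp)
  have "(\<lambda>n. char (distr M borel (Y n)) t - char (distr M borel (X n)) t) \<longlonglongrightarrow> 0"
    unfolding tendsto_iff
  proof safe
    fix e :: real assume e: "e > 0"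
    \<comment> \<open>The summand 1 covers t = 0. Each of the two error terms is then below e / 2,
      the second because the probability is below e / 4.\<close>
    define \<epsilon> where "\<epsilon> = e / (2 * (\<bar>t\<bar> + 1))"
    have \<epsilon>: "\<epsilon> > 0" "\<bar>t\<bar> * \<epsilon> < e / 2"
      using e by (auto simp: \<epsilon>_def field_simps)
    let ?B = "\<lambda>n. {\<omega> \<in> space M. \<epsilon> < \<bar>Y n \<omega> - X n \<omega>\<bar>}"
    have "eventually (\<lambda>x. \<bar>(case x of (n, \<omega>) \<Rightarrow> Y n \<omega> - X n \<omega>)\<bar> \<le> \<epsilon>) (wpa1 M)"
      using diff \<epsilon>(1) by (simp add: tendsto_wpa1_real_iff)
    from eventually_wpa1_D[OF this] have "(\<lambda>n. emeasure M (?B n)) \<longlonglongrightarrow> 0"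
      by (simp add: not_le)
    then have "eventually (\<lambda>n. emeasure M (?B n) < ennreal (e / 4)) sequentially"
      using e by (intro order_tendstoD(2)) auto
    then show "eventually (\<lambda>n. dist (char (distr M borel (Y n)) t - char (distr M borel (X n)) t) 0 < e) sequentially"
    proof eventually_elim
      case (elim n)
      have B: "prob (?B n) < e / 4"
        using elim e by (simp add: emeasure_eq_measure ennreal_less_iff)
      have intB: "integrable M (\<lambda>\<omega>. 2 * indicator (?B n) \<omega> :: real)"
        by (intro integrable_mult_right integrable_real_indicator) (auto simp: less_top[symmetric])
      have int: "integrable M (\<lambda>\<omega>. iexp (t * Z \<omega>))" if "random_variable borel Z" for Z
        using that by (intro integrable_const_bound[where B = 1]) auto
      have "char (distr M borel (Y n)) t - char (distr M borel (X n)) t =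
          (CLINT \<omega>|M. iexp (t * Y n \<omega>) - iexp (t * X n \<omega>))"
        unfolding char_def by (subst (1 2) integral_distr) (simp_all only: Bochner_Integration.integral_diff[OF int int] X Y, simp_all)
      also have "norm \<dots> \<le> (\<integral>\<omega>. norm (iexp (t * Y n \<omega>) - iexp (t * X n \<omega>)) \<partial>M)"
        by (rule integral_norm_bound)
      also have "\<dots> \<le> (\<integral>\<omega>. \<bar>t\<bar> * \<epsilon> + 2 * indicator (?B n) \<omega> \<partial>M)"
      proof (rule integral_mono)
        show "integrable M (\<lambda>\<omega>. norm (iexp (t * Y n \<omega>) - iexp (t * X n \<omega>)))"
          by (intro integrable_norm Bochner_Integration.integrable_diff int) auto
        show "norm (iexp (t * Y n \<omega>) - iexp (t * X n \<omega>)) \<le> \<bar>t\<bar> * \<epsilon> + 2 * indicator (?B n) \<omega>"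
          if "\<omega> \<in> space M" for \<omega>
        proof (cases "\<omega> \<in> ?B n")
          case True
          have "norm (iexp (t * Y n \<omega>) - iexp (t * X n \<omega>)) \<le> 1 + 1"
            by (rule order_trans[OF norm_triangle_ineq4]) simp
          then show ?thesis using True \<epsilon> by (simp add: add_increasing)
        next
          case False
          then have "\<bar>Y n \<omega> - X n \<omega>\<bar> \<le> \<epsilon>" using that by auto
          then have "\<bar>t * Y n \<omega> - t * X n \<omega>\<bar> \<le> \<bar>t\<bar> * \<epsilon>"
            by (simp add: abs_mult mult_left_mono flip: right_diff_distrib)
          then show ?thesis
            using norm_iexp_diff_le[of "t * Y n \<omega>" "t * X n \<omega>"] False by simp
        qed
        show "integrable M (\<lambda>\<omega>. \<bar>t\<bar> * \<epsilon> + 2 * indicator (?B n) \<omega>)"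
          using intB by simp
      qed
      also have "\<dots> = \<bar>t\<bar> * \<epsilon> + 2 * prob (?B n)"
        by (subst Bochner_Integration.integral_add) (use intB in \<open>simp_all add: prob_space\<close>)
      also have "\<dots> < e" using B \<epsilon> by simp
      finally show ?case by simp
    qed
  qed
  from tendsto_add[OF this chX] show "(\<lambda>n. char (distr M borel (Y n)) t) \<longlonglongrightarrow> char L t"
    by simp
qed

text \<open>The variance may be 0, and normalising by the standard deviation is then impossible. In
  that case the averages vanish almost surely and all characteristic functions are 1; otherwise the
  normalised theorem is rescaled by \<open>sqrt v\<close> inside the characteristic
  function.\<close>

lemma (in prob_space) clt_avg:
  fixes S :: "nat \<Rightarrow> 'a \<Rightarrow> 'b" and h :: "'b \<Rightarrow> real"
  assumes ind: "indep_vars (\<lambda>_. R) S UNIV" and law: "\<And>i. distr M R (S i) = R"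
    and h: "h \<in> borel_measurable R" "integrable R (\<lambda>u. (h u)\<^sup>2)" "(\<integral>u. h u \<partial>R) = 0"
  shows "weak_conv_m (\<lambda>n. distr M borel (\<lambda>\<omega>. sqrt (real n) * avg n h (sample S n \<omega>)))
    (centered_normal (\<integral>u. (h u)\<^sup>2 \<partial>R))"
proof -
  define v where "v = (\<integral>u. (h u)\<^sup>2 \<partial>R)"
  have S: "S i \<in> M \<rightarrow>\<^sub>M R" for i
    using ind by (auto simp: indep_vars_def)
  note [measurable] = S h(1)
  have hS: "(\<lambda>\<omega>. h (S i \<omega>)) \<in> borel_measurable M" for i by measurable
  have avg: "avg n h (sample S n \<omega>) = (\<Sum>i<n. h (S i \<omega>)) / real n" for n \<omega>
    by (simp add: avg_def sample_def)
  have v0: "v \<ge> 0" unfolding v_def by simp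
  have integ: "integrable M (\<lambda>\<omega>. (h (S i \<omega>))\<^sup>2)" for i
    using integrable_distr[OF S[of i], of "\<lambda>u. (h u)\<^sup>2"] h(2) by (simp add: law)
  have m0: "expectation (\<lambda>\<omega>. h (S i \<omega>)) = 0" for i
    using integral_distr[OF S[of i] h(1)] by (simp add: law h(3))
  have m2: "expectation (\<lambda>\<omega>. (h (S i \<omega>))\<^sup>2) = v" for i
    using integral_distr[OF S[of i], of "\<lambda>u. (h u)\<^sup>2"] by (simp add: law v_def)
  have rv: "random_variable borel (\<lambda>\<omega>. sqrt (real n) * avg n h (sample S n \<omega>))" for n
    unfolding avg by measurable
  have [measurable]: "(\<lambda>\<omega>. avg n h (sample S n \<omega>)) \<in> borel_measurable M" for n
    unfolding avg by measurable
  have charN: "char (centered_normal v) t = char std_normal_distribution (sqrt v * t)" for t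
    unfolding centered_normal_def char_def by (subst integral_distr) (auto simp: ac_simps)
  show ?thesis
    unfolding v_def[symmetric]
  proof (cases "v = 0")
    case True
    have z: "AE \<omega> in M. h (S i \<omega>) = 0" for i
      using integral_nonneg_eq_0_iff_AE[OF integ[of i]] m2[of i] True by simp
    have "char (distr M borel (\<lambda>\<omega>. sqrt (real n) * avg n h (sample S n \<omega>))) t = 1" for n t
    proof -
      have "AE \<omega> in M. \<forall>i\<in>{..<n}. h (S i \<omega>) = 0"
        by (rule AE_finite_allI) (auto simp: z)
      then have "AE \<omega> in M. iexp (t * (sqrt (real n) * avg n h (sample S n \<omega>))) = 1"
        by eventually_elim (simp add: avg)
      then have "(CLINT \<omega>|M. iexp (t * (sqrt (real n) * avg n h (sample S n \<omega>)))) = (CLINT \<omega>|M. 1)"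
        by (intro integral_cong_AE) auto
      then show ?thesis
        unfolding char_def using rv[of n] by (simp add: integral_distr prob_space)
    qed
    moreover have "char (centered_normal v) t = 1" for t
    proof -
      interpret N: real_distribution std_normal_distribution by (rule real_dist_normal_dist)
      show ?thesis using charN[of t] N.char_zero True by simp
    qed
    ultimately show "weak_conv_m (\<lambda>n. distr M borel (\<lambda>\<omega>. sqrt (real n) * avg n h (sample S n \<omega>))) (centered_normal v)"
      by (intro levy_continuity real_distribution_distr rv real_distribution_centered_normal) simp
  next
    case False
    then have v: "v > 0" using v0 by simp
    have clt: "weak_conv_m (\<lambda>n. distr M borel (\<lambda>\<omega>. (\<Sum>i<n. h (S i \<omega>)) / sqrt (real n * (sqrt v)\<^sup>2))) std_normal_distribution"
    proof (rule central_limit_theorem_zero_mean)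
      show "indep_vars (\<lambda>i. borel) (\<lambda>i \<omega>. h (S i \<omega>)) UNIV"
        by (rule indep_vars_compose2[OF ind]) simp
      show "distr M borel (\<lambda>\<omega>. h (S n \<omega>)) = distr R borel h" for n
        using distr_distr[OF h(1) S, of n] by (simp add: law comp_def)
    qed (use v m0 m2 integ in auto)
    show "weak_conv_m (\<lambda>n. distr M borel (\<lambda>\<omega>. sqrt (real n) * avg n h (sample S n \<omega>))) (centered_normal v)"
    proof (intro levy_continuity real_distribution_distr rv real_distribution_centered_normal)
      fix t
      have "char (distr M borel (\<lambda>\<omega>. sqrt (real n) * avg n h (sample S n \<omega>))) t =
          char (distr M borel (\<lambda>\<omega>. (\<Sum>i<n. h (S i \<omega>)) / sqrt (real n * (sqrt v)\<^sup>2))) (sqrt v * t)" for n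
      proof -
        have eq: "sqrt (real n) * avg n h (sample S n \<omega>) = sqrt v * ((\<Sum>i<n. h (S i \<omega>)) / sqrt (real n * (sqrt v)\<^sup>2))" for \<omega>
        proof -
          \<comment> \<open>At n = 0 both sides are 0, since division by 0 gives 0.\<close>
          have "sqrt (real n) * (x / real n) = x / sqrt (real n)" for x
            using sqrt_divide_self_eq[of "real n"] by (simp add: divide_inverse mult_ac)
          then show ?thesis
            unfolding avg using v by (simp add: real_sqrt_mult)
        qed
        show ?thesis
          unfolding char_def eq by (subst (1 2) integral_distr) (auto simp: ac_simps)
      qed
      then show "(\<lambda>n. char (distr M borel (\<lambda>\<omega>. sqrt (real n) * avg n h (sample S n \<omega>))) t) \<longlonglongrightarrow> char (centered_normal v) t"
        unfolding charN
        by (simp only:) (rule levy_continuity1[OF _ real_dist_normal_dist clt], rule real_distribution_distr, measurable)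
    qed
  qed
qed

lemma (in prob_space) square_expectation_le:
  fixes X :: "'a \<Rightarrow> real"
  assumes "X \<in> borel_measurable M" "integrable M (\<lambda>\<omega>. (X \<omega>)\<^sup>2)"
  shows "(expectation X)\<^sup>2 \<le> expectation (\<lambda>\<omega>. (X \<omega>)\<^sup>2)"
  using variance_eq[OF square_integrable_imp_integrable[OF assms] assms(2)] variance_positive[of X] by linarith

section \<open>Chebyshev's inequality conditionally on an independent sample\<close>

text \<open>By induction on the index set: the new variable is independent of the sum of the others,
  so the cross term factors into a product of means, one of which is 0.\<close>

lemma (in prob_space) second_moment_sum_indep:
  fixes X :: "'i \<Rightarrow> 'a \<Rightarrow> real"
  assumes "finite I" "indep_vars (\<lambda>_. borel) X I"
    and "\<And>i. i \<in> I \<Longrightarrow> integrable M (\<lambda>\<omega>. (X i \<omega>)\<^sup>2)" "\<And>i. i \<in> I \<Longrightarrow> expectation (X i) = 0"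
  shows "integrable M (\<lambda>\<omega>. (\<Sum>i\<in>I. X i \<omega>)\<^sup>2) \<and>
    expectation (\<lambda>\<omega>. (\<Sum>i\<in>I. X i \<omega>)\<^sup>2) = (\<Sum>i\<in>I. expectation (\<lambda>\<omega>. (X i \<omega>)\<^sup>2))"
  using assms
proof (induction I rule: finite_induct)
  case (insert j I)
  let ?T = "\<lambda>\<omega>. \<Sum>i\<in>I. X i \<omega>"
  have IH: "integrable M (\<lambda>\<omega>. (?T \<omega>)\<^sup>2)"
    "expectation (\<lambda>\<omega>. (?T \<omega>)\<^sup>2) = (\<Sum>i\<in>I. expectation (\<lambda>\<omega>. (X i \<omega>)\<^sup>2))"
    using insert.IH[OF indep_vars_subset[OF insert.prems(1)]] insert.prems by auto
  have rv: "random_variable borel (X i)" if "i \<in> insert j I" for i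
    using insert.prems(1) that by (auto simp: indep_vars_def)
  have int: "integrable M (X i)" if "i \<in> insert j I" for i
    using rv[OF that] insert.prems(2)[OF that] by (rule square_integrable_imp_integrable)
  have ind: "indep_var borel (X j) borel ?T"
    by (rule indep_vars_sum[OF insert.hyps insert.prems(1)])
  have intT: "integrable M ?T" using int by auto
  have cross: "integrable M (\<lambda>\<omega>. X j \<omega> * ?T \<omega>)" "expectation (\<lambda>\<omega>. X j \<omega> * ?T \<omega>) = 0"
    using indep_var_integrable[OF ind int intT] indep_var_lebesgue_integral[OF ind int intT] insert.prems(3)
    by auto
  have eq: "(\<Sum>i\<in>insert j I. X i \<omega>)\<^sup>2 = (X j \<omega>)\<^sup>2 + (?T \<omega>)\<^sup>2 + 2 * (X j \<omega> * ?T \<omega>)" for \<omega>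
    using insert.hyps by (simp add: power2_sum)
  have i1: "integrable M (\<lambda>\<omega>. (X j \<omega>)\<^sup>2 + (?T \<omega>)\<^sup>2)" and i2: "integrable M (\<lambda>\<omega>. 2 * (X j \<omega> * ?T \<omega>))"
    using IH(1) cross(1) insert.prems(2) by auto
  show ?case
    unfolding eq using i1 i2 IH cross insert.prems(2) insert.hyps
    by (auto simp: Bochner_Integration.integral_add)
qed simp

text \<open>Independence turns the joint law of U and the block I into a product, so by Fubini the
  parameter may be frozen and the variance computed for a fixed function. No moment bound is assumed
  for all parameters: those whose second moment exceeds \<delta> are charged to the second
  summand.\<close>

lemma (in prob_space) conditional_chebyshev:
  fixes S :: "'i \<Rightarrow> 'a \<Rightarrow> 'b" and G :: "('i \<Rightarrow> 'b) \<Rightarrow> 'b \<Rightarrow> real"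
  assumes ind: "indep_vars (\<lambda>_. R) S (I \<union> J)" "I \<inter> J = {}" "finite I"
    and law: "\<And>i. i \<in> I \<Longrightarrow> distr M R (S i) = R"
    and R: "prob_space R"
  defines "A \<equiv> PiM J (\<lambda>_. R)" and "U \<equiv> \<lambda>\<omega>. \<lambda>j\<in>J. S j \<omega>"
  assumes G[measurable]: "(\<lambda>(a, t). G a t) \<in> borel_measurable (A \<Otimes>\<^sub>M R)"
    and pos: "\<epsilon> > 0" "\<delta> \<ge> 0"
  shows "outer_measure_of M {\<omega> \<in> space M. \<epsilon> < \<bar>\<Sum>i\<in>I. G (U \<omega>) (S i \<omega>) - (\<integral>t. G (U \<omega>) t \<partial>R)\<bar>} \<le>
    ennreal (real (card I) * \<delta> / \<epsilon>\<^sup>2) +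
    outer_measure_of M {\<omega> \<in> space M. \<not> (\<integral>\<^sup>+t. ennreal ((G (U \<omega>) t)\<^sup>2) \<partial>R) \<le> ennreal \<delta>}"
proof -
  interpret R: prob_space R by (rule R)
  define SI where "SI = (\<lambda>\<omega>. \<lambda>i\<in>I. S i \<omega>)"
  have indU: "indep_var A U (PiM I (\<lambda>_. R)) SI"
    unfolding A_def U_def SI_def by (rule indep_var_restrict[OF ind(1)]) (use ind(2) in auto)
  have indI: "indep_vars (\<lambda>_. R) S I"
    by (rule indep_vars_subset[OF ind(1)]) auto
  have U[measurable]: "U \<in> M \<rightarrow>\<^sub>M A" and Sn[measurable]: "SI \<in> M \<rightarrow>\<^sub>M PiM I (\<lambda>_. R)"
    using indep_var_rv1[OF indU] indep_var_rv2[OF indU] by auto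
  have S[measurable]: "i \<in> I \<Longrightarrow> S i \<in> M \<rightarrow>\<^sub>M R" for i
    using indI by (auto simp: indep_vars_def)
  define H where "H a t = G a t - (\<integral>t. G a t \<partial>R)" for a t
  define good where "good = {a \<in> space A. (\<integral>\<^sup>+t. ennreal ((G a t)\<^sup>2) \<partial>R) \<le> ennreal \<delta>}"
  have good[measurable]: "good \<in> sets A"
    unfolding good_def by measurable
  have Hm[measurable]: "(\<lambda>(a, t). H a t) \<in> borel_measurable (A \<Otimes>\<^sub>M R)"
    unfolding H_def by measurable
  \<comment> \<open>Truncation by \<open>good\<close> bounds the integral however large the moments
    are elsewhere. With extended-real values Fubini asks for no integrability.\<close>
  define Phi where "Phi = (\<lambda>(a, s). indicator good a * ennreal ((\<Sum>i\<in>I. H a (s i))\<^sup>2))"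
  have comp_meas: "(\<lambda>x. H (fst x) (snd x i)) \<in> borel_measurable (A \<Otimes>\<^sub>M PiM I (\<lambda>_. R))" if "i \<in> I" for i
  proof -
    have "(\<lambda>x. (fst x, snd x i)) \<in> A \<Otimes>\<^sub>M PiM I (\<lambda>_. R) \<rightarrow>\<^sub>M A \<Otimes>\<^sub>M R"
      using that by (intro measurable_Pair measurable_fst measurable_compose[OF measurable_snd measurable_component_singleton]) auto
    from measurable_compose[OF this Hm] show ?thesis by simp
  qed
  have Phi[measurable]: "Phi \<in> borel_measurable (A \<Otimes>\<^sub>M PiM I (\<lambda>_. R))"
    unfolding Phi_def case_prod_beta by (intro borel_measurable_times_ennreal measurable_compose[OF measurable_fst] measurable_compose[OF _ measurable_ennreal] borel_measurable_power borel_measurable_sum comp_meas) auto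
  have Phi_S: "Phi (a, SI \<omega>) = indicator good a * ennreal ((\<Sum>i\<in>I. H a (S i \<omega>))\<^sup>2)" for a \<omega>
    by (simp add: Phi_def SI_def)
  have bound: "(\<integral>\<^sup>+\<omega>. Phi (a, SI \<omega>) \<partial>M) \<le> ennreal (real (card I) * \<delta>)" if a: "a \<in> space A" for a
  proof (cases "a \<in> good")
    case True
    have Ga[measurable]: "G a \<in> borel_measurable R"
      using measurable_Pair2[OF G a] by simp
    have "(\<integral>\<^sup>+t. ennreal ((G a t)\<^sup>2) \<partial>R) \<le> ennreal \<delta>"
      using True by (simp add: good_def)
    then have i2: "integrable R (\<lambda>t. (G a t)\<^sup>2)" and le: "(\<integral>t. (G a t)\<^sup>2 \<partial>R) \<le> \<delta>"
      using pos(2) by (auto intro!: integrableI_bounded simp: le_less_trans nn_integral_eq_integral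
          integral_eq_nn_integral enn2real_leI)
    have i1: "integrable R (G a)"
      by (rule R.square_integrable_imp_integrable[OF Ga i2])
    have Ha: "H a \<in> borel_measurable R" "integrable R (\<lambda>t. (H a t)\<^sup>2)" "(\<integral>t. H a t \<partial>R) = 0"
      using i1 i2 by (auto simp: H_def[abs_def] power2_diff R.prob_space)
    \<comment> \<open>Centring does not increase the second moment.\<close>
    have var: "(\<integral>t. (H a t)\<^sup>2 \<partial>R) \<le> \<delta>"
      using R.variance_eq[OF i1 i2] le by (simp add: H_def) (smt (verit) zero_le_power2)
    have ii: "integrable M (\<lambda>\<omega>. (H a (S i \<omega>))\<^sup>2)" "expectation (\<lambda>\<omega>. H a (S i \<omega>)) = 0"
      "expectation (\<lambda>\<omega>. (H a (S i \<omega>))\<^sup>2) = (\<integral>t. (H a t)\<^sup>2 \<partial>R)" if "i \<in> I" for i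
      using Ha integrable_distr[OF S[OF that], of "\<lambda>t. (H a t)\<^sup>2"] integral_distr[OF S[OF that] Ha(1)]
        integral_distr[OF S[OF that], of "\<lambda>t. (H a t)\<^sup>2"] law[OF that] by auto
    have "indep_vars (\<lambda>_. borel) (\<lambda>i \<omega>. H a (S i \<omega>)) I"
      by (rule indep_vars_compose2[OF indI]) (rule Ha(1))
    from second_moment_sum_indep[OF ind(3) this]
    have "integrable M (\<lambda>\<omega>. (\<Sum>i\<in>I. H a (S i \<omega>))\<^sup>2)"
      "expectation (\<lambda>\<omega>. (\<Sum>i\<in>I. H a (S i \<omega>))\<^sup>2) = (\<Sum>i\<in>I. (\<integral>t. (H a t)\<^sup>2 \<partial>R))"
      using ii by auto
    then show ?thesis
      using var True by (simp add: Phi_S nn_integral_eq_integral mult_left_mono ennreal_leI)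
  qed (simp add: Phi_S)
  let ?E = "{\<omega> \<in> space M. U \<omega> \<in> good \<and> \<epsilon> < \<bar>\<Sum>i\<in>I. H (U \<omega>) (S i \<omega>)\<bar>}"
  have HS[measurable]: "(\<lambda>\<omega>. H (U \<omega>) (S i \<omega>)) \<in> borel_measurable M" if "i \<in> I" for i
    using measurable_compose[OF measurable_Pair[OF U S[OF that]] Hm] by simp
  have sumS[measurable]: "(\<lambda>\<omega>. \<Sum>i\<in>I. H (U \<omega>) (S i \<omega>)) \<in> borel_measurable M"
    by (intro borel_measurable_sum HS) auto
  have joint: "distr M (A \<Otimes>\<^sub>M PiM I (\<lambda>_. R)) (\<lambda>\<omega>. (U \<omega>, SI \<omega>)) =
      distr M A U \<Otimes>\<^sub>M distr M (PiM I (\<lambda>_. R)) (SI)"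
    using indU by (simp add: indep_var_distribution_eq)
  interpret DU: prob_space "distr M A U" by (rule prob_space_distr) simp
  interpret DS: prob_space "distr M (PiM I (\<lambda>_. R)) (SI)" by (rule prob_space_distr) simp
  have "(\<integral>\<^sup>+\<omega>. Phi (U \<omega>, SI \<omega>) \<partial>M) =
      (\<integral>\<^sup>+x. Phi x \<partial>(distr M A U \<Otimes>\<^sub>M distr M (PiM I (\<lambda>_. R)) (SI)))"
    unfolding joint[symmetric] by (simp add: nn_integral_distr)
  also have "\<dots> = (\<integral>\<^sup>+a. \<integral>\<^sup>+s. Phi (a, s) \<partial>distr M (PiM I (\<lambda>_. R)) (SI) \<partial>distr M A U)"
    by (rule DS.nn_integral_fst[symmetric]) simp
  also have "\<dots> \<le> (\<integral>\<^sup>+a. ennreal (real (card I) * \<delta>) \<partial>distr M A U)"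
    using bound by (intro nn_integral_mono) (simp add: nn_integral_distr)
  also have "\<dots> = ennreal (real (card I) * \<delta>)"
    using DU.emeasure_space_1 by simp
  finally have int: "(\<integral>\<^sup>+\<omega>. Phi (U \<omega>, SI \<omega>) \<partial>M) \<le> ennreal (real (card I) * \<delta>)" .
  have "emeasure M ?E = (\<integral>\<^sup>+\<omega>. indicator ?E \<omega> \<partial>M)"
    by simp
  \<comment> \<open>Markov's inequality for the truncated square.\<close>
  also have "\<dots> \<le> (\<integral>\<^sup>+\<omega>. ennreal (1 / \<epsilon>\<^sup>2) * Phi (U \<omega>, SI \<omega>) \<partial>M)"
  proof (rule nn_integral_mono)
    fix \<omega> assume "\<omega> \<in> space M"
    show "indicator ?E \<omega> \<le> ennreal (1 / \<epsilon>\<^sup>2) * Phi (U \<omega>, SI \<omega>)"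
    proof (cases "\<omega> \<in> ?E")
      case True
      then have "\<epsilon>\<^sup>2 \<le> (\<Sum>i\<in>I. H (U \<omega>) (S i \<omega>))\<^sup>2"
        using pos by (simp add: abs_le_square_iff[symmetric])
      then have "1 \<le> 1 / \<epsilon>\<^sup>2 * (\<Sum>i\<in>I. H (U \<omega>) (S i \<omega>))\<^sup>2"
        using pos by (simp add: field_simps)
      then have "1 \<le> ennreal (1 / \<epsilon>\<^sup>2) * ennreal ((\<Sum>i\<in>I. H (U \<omega>) (S i \<omega>))\<^sup>2)"
        using pos by (simp flip: ennreal_mult)
      then show ?thesis using True by (simp add: Phi_S)
    qed simp
  qed
  also have "\<dots> = ennreal (1 / \<epsilon>\<^sup>2) * (\<integral>\<^sup>+\<omega>. Phi (U \<omega>, SI \<omega>) \<partial>M)"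
    by (rule nn_integral_cmult) simp
  also have "\<dots> \<le> ennreal (1 / \<epsilon>\<^sup>2) * ennreal (real (card I) * \<delta>)"
    by (rule mult_left_mono[OF int]) simp
  also have "\<dots> = ennreal (real (card I) * \<delta> / \<epsilon>\<^sup>2)"
    using pos by (simp flip: ennreal_mult)
  finally have E: "outer_measure_of M ?E \<le> ennreal (real (card I) * \<delta> / \<epsilon>\<^sup>2)"
    by simp
  have "outer_measure_of M {\<omega> \<in> space M. \<epsilon> < \<bar>\<Sum>i\<in>I. G (U \<omega>) (S i \<omega>) - (\<integral>t. G (U \<omega>) t \<partial>R)\<bar>} \<le>
      outer_measure_of M (?E \<union> {\<omega> \<in> space M. \<not> (\<integral>\<^sup>+t. ennreal ((G (U \<omega>) t)\<^sup>2) \<partial>R) \<le> ennreal \<delta>})"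
    using measurable_space[OF U] by (intro outer_measure_of_mono) (auto simp: H_def good_def)
  also have "\<dots> \<le> outer_measure_of M ?E +
      outer_measure_of M {\<omega> \<in> space M. \<not> (\<integral>\<^sup>+t. ennreal ((G (U \<omega>) t)\<^sup>2) \<partial>R) \<le> ennreal \<delta>}"
    by (rule outer_measure_of_Un_le)
  finally show ?thesis
    using E by (meson add_right_mono order_trans)
qed

section \<open>Integrated first-order expansions\<close>

text \<open>On each cell the increment of F is F' at an intermediate point times the cell length,
  and uniform continuity of F' compares that point with the left endpoint. Derivatives within {0..1}
  are one-sided at the ends, as required when the segment reaches the boundary of \<Gamma>.\<close>

lemma riemann_sum_derivative_tendsto:
  fixes F F' :: "real \<Rightarrow> real"
  assumes F: "\<And>t. t \<in> {0..1} \<Longrightarrow> (F has_real_derivative F' t) (at t within {0..1})"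
    and cont: "continuous_on {0..1} F'"
  shows "(\<lambda>n. (\<Sum>i<n. F' (real i / real n)) / real n) \<longlonglongrightarrow> F 1 - F 0"
  unfolding tendsto_iff
proof safe
  fix e :: real assume e: "e > 0"
  have "uniformly_continuous_on {0..1} F'"
    using cont by (rule compact_uniformly_continuous) simp
  then obtain d where d: "d > 0" "\<And>s t. s \<in> {0..1} \<Longrightarrow> t \<in> {0..1} \<Longrightarrow> dist t s < d \<Longrightarrow> dist (F' t) (F' s) < e / 2"
    using e unfolding uniformly_continuous_on_def by (meson half_gt_zero)
  obtain N :: nat where N: "1 / d < real N" using reals_Archimedean2 by blast
  show "eventually (\<lambda>n. dist ((\<Sum>i<n. F' (real i / real n)) / real n) (F 1 - F 0) < e) sequentially"
    using eventually_gt_at_top[of "max N 0"]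
  proof eventually_elim
    case (elim n)
    then have n: "n > 0" "1 / real n < d"
      using N d(1) by (auto simp: field_simps) (smt (verit) mult_less_cancel_left_pos of_nat_less_iff mult.commute)
    have step: "\<bar>F' (real i / real n) / real n - (F (real (Suc i) / real n) - F (real i / real n))\<bar> \<le> e / 2 / real n"
      if i: "i < n" for i
    proof -
      let ?l = "real i / real n" and ?u = "real (Suc i) / real n"
      have lu: "0 \<le> ?l" "?l \<le> ?u" "?u \<le> 1" using i n by (auto simp: field_simps)
      have "\<exists>x\<in>{?l..?u}. F ?u - F ?l = F' x * (?u - ?l)"
        using lu by (intro mvt_very_simple)
          (auto intro!: has_field_derivative_imp_has_derivative DERIV_subset[OF F] intro: order_trans[OF lu(1)])
      then obtain x where x: "x \<in> {?l..?u}" "F ?u - F ?l = F' x * (?u - ?l)" by blast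
      have "?u - ?l = 1 / real n" using n by (simp add: field_simps)
      moreover from this have "dist ?l x < d" using x(1) n(2) by (auto simp: dist_real_def)
      then have "dist (F' ?l) (F' x) < e / 2"
        using d(2)[of x ?l] x(1) lu order_trans[OF lu(1), of x] by auto
      ultimately show ?thesis
        using x(2) n by (simp add: dist_real_def flip: diff_divide_distrib)
          (simp add: field_simps)
    qed
    have tele: "(\<Sum>i<n. F (real (Suc i) / real n) - F (real i / real n)) = F 1 - F 0"
      using n by (subst sum_lessThan_telescope[of "\<lambda>i. F (real i / real n)"]) simp
    have "\<bar>(\<Sum>i<n. F' (real i / real n)) / real n - (F 1 - F 0)\<bar> =
        \<bar>\<Sum>i<n. F' (real i / real n) / real n - (F (real (Suc i) / real n) - F (real i / real n))\<bar>"
      by (simp add: sum_subtractf sum_divide_distrib flip: tele)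
    also have "\<dots> \<le> (\<Sum>i<n. e / 2 / real n)"
      by (intro order_trans[OF sum_abs] sum_mono step) simp
    also have "\<dots> < e" using n e by simp
    finally show ?case by (simp add: dist_real_def)
  qed
qed

lemma closed_segment_near:
  fixes a b s :: real
  assumes "is_interval \<Gamma>" "a \<in> \<Gamma>" "b \<in> \<Gamma>" "\<bar>b - a\<bar> \<le> \<delta>" "s \<in> closed_segment a b"
  shows "s \<in> \<Gamma> \<and> \<bar>s - a\<bar> \<le> \<delta>"
proof -
  have "closed_segment a b \<subseteq> \<Gamma>"
    using assms by (simp add: closed_segment_subset is_interval_convex)
  moreover have "dist s a \<le> dist a b"
    using dist_in_closed_segment[OF assms(5)] by simp
  ultimately show ?thesis using assms(4,5) by (auto simp: dist_real_def)
qed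

lemma sum_squared_le_card_mult:
  fixes x :: "'i \<Rightarrow> real"
  shows "(\<Sum>i\<in>I. x i)\<^sup>2 \<le> real (card I) * (\<Sum>i\<in>I. (x i)\<^sup>2)"
  using Cauchy_Schwarz_ineq_sum[of x "\<lambda>_. 1" I] by (simp add: mult.commute)

text \<open>The intermediate point of a Taylor expansion would depend on \<open>w\<close>. Riemann sums of the
  derivative along the segment, together with Fatou's lemma, avoid it.\<close>

lemma nn_integral_first_order_remainder_le:
  fixes F F' F'' :: "'b \<Rightarrow> real \<Rightarrow> real"
  assumes \<Gamma>: "is_interval \<Gamma>" "a \<in> \<Gamma>" "b \<in> \<Gamma>"
    and F: "AE w in R. C2_in_gamma \<Gamma> (F w) (F' w) (F'' w)"
    and meas: "\<And>s. s \<in> \<Gamma> \<Longrightarrow> (\<lambda>w. F' w s) \<in> borel_measurable R" "k \<in> borel_measurable R"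
    and bound: "\<And>s. s \<in> closed_segment a b \<Longrightarrow> (\<integral>\<^sup>+w. ennreal ((F' w s - k w)\<^sup>2) \<partial>R) \<le> \<epsilon>"
  shows "(\<integral>\<^sup>+w. ennreal ((F w b - F w a - (b - a) * k w)\<^sup>2) \<partial>R) \<le> ennreal ((b - a)\<^sup>2) * \<epsilon>"
proof -
  define g where "g t = a + t * (b - a)" for t
  have seg: "g t \<in> closed_segment a b" if "t \<in> {0..1}" for t
    using that by (auto simp: g_def in_segment algebra_simps intro!: exI[of _ t])
  have "closed_segment a b \<subseteq> \<Gamma>"
    using \<Gamma> by (simp add: closed_segment_subset is_interval_convex)
  then have g\<Gamma>: "g t \<in> \<Gamma>" if "t \<in> {0..1}" for t using seg[OF that] by blast
  have in01: "real i / real n \<in> {0..1}" if "i < n" for i n using that by (auto simp: field_simps)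
  \<comment> \<open>A grid mean of deviations from \<open>k w\<close>: with \<open>k\<close> inside
    every summand, the assumed bound applies at each grid point.\<close>
  define h where "h n w = (b - a) * ((\<Sum>i<n. F' w (g (real i / real n)) - k w) / real n)" for n w
  have hm: "h n \<in> borel_measurable R" for n
    unfolding h_def using meas g\<Gamma>[OF in01] by (intro borel_measurable_times borel_measurable_divide borel_measurable_sum borel_measurable_diff) auto
  have lim: "AE w in R. (\<lambda>n. ennreal ((h n w)\<^sup>2)) \<longlonglongrightarrow> ennreal ((F w b - F w a - (b - a) * k w)\<^sup>2)"
    using F
  proof eventually_elim
    case (elim w)
    then have der: "\<And>s. s \<in> \<Gamma> \<Longrightarrow> (F w has_real_derivative F' w s) (at s within \<Gamma>)"
      and der': "\<And>s. s \<in> \<Gamma> \<Longrightarrow> (F' w has_real_derivative F'' w s) (at s within \<Gamma>)"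
      by (auto simp: C2_in_gamma_def)
    have cont: "continuous_on \<Gamma> (F' w)"
      using der' by (meson DERIV_isCont has_field_derivative_imp_has_derivative differentiable_imp_continuous_on
          differentiable_on_def differentiable_def)
    have "(\<lambda>n. (\<Sum>i<n. F' w (g (real i / real n)) * (b - a)) / real n) \<longlonglongrightarrow> F w (g 1) - F w (g 0)"
    proof (rule riemann_sum_derivative_tendsto)
      show "((\<lambda>t. F w (g t)) has_real_derivative F' w (g t) * (b - a)) (at t within {0..1})"
        if "t \<in> {0..1}" for t
      proof (rule DERIV_image_chain[of "F w" _ g, unfolded comp_def])
        show "(g has_real_derivative (b - a)) (at t within {0..1})"
          unfolding g_def by (auto intro!: derivative_eq_intros)
        show "(F w has_real_derivative F' w (g t)) (at (g t) within g ` {0..1})"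
          by (rule DERIV_subset[OF der]) (use g\<Gamma> that in auto)
      qed
      have "continuous_on {0..1} (\<lambda>t. F' w (g t))"
        by (rule continuous_on_compose2[OF cont]) (auto simp: g_def intro!: continuous_intros g\<Gamma>[unfolded g_def])
      then show "continuous_on {0..1} (\<lambda>t. F' w (g t) * (b - a))" by (intro continuous_intros)
    qed
    then have "(\<lambda>n. (\<Sum>i<n. F' w (g (real i / real n)) * (b - a)) / real n - (b - a) * k w) \<longlonglongrightarrow> F w b - F w a - (b - a) * k w"
      by (intro tendsto_diff tendsto_const) (simp add: g_def)
    moreover have "eventually (\<lambda>n. (\<Sum>i<n. F' w (g (real i / real n)) * (b - a)) / real n - (b - a) * k w = h n w) sequentially"
      using eventually_gt_at_top[of 0]
      by eventually_elim (simp add: h_def sum_subtractf field_simps sum_distrib_left sum_distrib_right)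
    ultimately have "(\<lambda>n. h n w) \<longlonglongrightarrow> F w b - F w a - (b - a) * k w"
      by (simp add: filterlim_cong)
    then show ?case by (intro tendsto_ennrealI tendsto_power)
  qed
  have "(\<integral>\<^sup>+w. ennreal ((F w b - F w a - (b - a) * k w)\<^sup>2) \<partial>R) = (\<integral>\<^sup>+w. liminf (\<lambda>n. ennreal ((h n w)\<^sup>2)) \<partial>R)"
    by (intro nn_integral_cong_AE eventually_mono[OF lim] lim_imp_Liminf[symmetric]) auto
  also have "\<dots> \<le> liminf (\<lambda>n. \<integral>\<^sup>+w. ennreal ((h n w)\<^sup>2) \<partial>R)"
    by (rule nn_integral_liminf) (use hm in measurable)
  also have "\<dots> \<le> ennreal ((b - a)\<^sup>2) * \<epsilon>"
  proof -
    have "eventually (\<lambda>n. (\<integral>\<^sup>+w. ennreal ((h n w)\<^sup>2) \<partial>R) \<le> ennreal ((b - a)\<^sup>2) * \<epsilon>) sequentially"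
      using eventually_gt_at_top[of 0]
    proof eventually_elim
      case (elim n)
      \<comment> \<open>By Cauchy-Schwarz the squared mean of n terms is at most 1 / n times the sum
        of their squares; together with the factor from b - a this is the constant.\<close>
      define c where "c = ennreal ((b - a)\<^sup>2) * ennreal (1 / real n)"
      have dm: "(\<lambda>w. F' w (g (real i / real n)) - k w) \<in> borel_measurable R" if "i \<in> {..<n}" for i
        using meas g\<Gamma>[OF in01[of i n]] that by (intro borel_measurable_diff) auto
      have "(\<integral>\<^sup>+w. ennreal ((h n w)\<^sup>2) \<partial>R) \<le>
          (\<integral>\<^sup>+w. c * (\<Sum>i<n. ennreal ((F' w (g (real i / real n)) - k w)\<^sup>2)) \<partial>R)"
      proof (rule nn_integral_mono)
        fix w
        let ?x = "\<lambda>i. F' w (g (real i / real n)) - k w"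
        have "(h n w)\<^sup>2 = (b - a)\<^sup>2 * ((\<Sum>i<n. ?x i)\<^sup>2 / (real n)\<^sup>2)"
          by (simp add: h_def power_mult_distrib power_divide)
        also have "\<dots> \<le> (b - a)\<^sup>2 * ((real n * (\<Sum>i<n. (?x i)\<^sup>2)) / (real n)\<^sup>2)"
          using sum_squared_le_card_mult[of ?x "{..<n}"] by (intro mult_left_mono divide_right_mono) auto
        also have "\<dots> = (b - a)\<^sup>2 * (1 / real n) * (\<Sum>i<n. (?x i)\<^sup>2)"
          using elim by (simp add: power2_eq_square)
        finally have "(h n w)\<^sup>2 \<le> (b - a)\<^sup>2 * (1 / real n) * (\<Sum>i<n. (?x i)\<^sup>2)" .
        then have "ennreal ((h n w)\<^sup>2) \<le> ennreal ((b - a)\<^sup>2 * (1 / real n) * (\<Sum>i<n. (?x i)\<^sup>2))"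
          by (rule ennreal_leI)
        also have "\<dots> = c * (\<Sum>i<n. ennreal ((?x i)\<^sup>2))"
          unfolding c_def by (subst ennreal_mult; (subst ennreal_mult)?) (simp_all add: sum_nonneg)
        finally show "ennreal ((h n w)\<^sup>2) \<le> c * (\<Sum>i<n. ennreal ((?x i)\<^sup>2))" .
      qed
      also have "\<dots> = c * (\<Sum>i<n. \<integral>\<^sup>+w. ennreal ((F' w (g (real i / real n)) - k w)\<^sup>2) \<partial>R)"
      proof -
        have dm2: "(\<lambda>w. ennreal ((F' w (g (real i / real n)) - k w)\<^sup>2)) \<in> borel_measurable R" if "i \<in> {..<n}" for i
          using dm[OF that] by measurable
        show ?thesis
          by (subst nn_integral_cmult[OF borel_measurable_sum[OF dm2]], assumption, subst nn_integral_sum[OF dm2], assumption, rule refl)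
      qed
      also have "\<dots> \<le> c * (\<Sum>i<n. \<epsilon>)"
        by (intro mult_left_mono sum_mono bound seg in01) auto
      also have "\<dots> = ennreal ((b - a)\<^sup>2) * (ennreal (1 / real n) * ennreal (real n)) * \<epsilon>"
        by (simp add: c_def mult_ac ennreal_of_nat_eq_real_of_nat)
      also have "ennreal (1 / real n) * ennreal (real n) = 1"
        using elim by (simp flip: ennreal_mult)
      finally show ?case by simp
    qed
    then have "liminf (\<lambda>n. \<integral>\<^sup>+w. ennreal ((h n w)\<^sup>2) \<partial>R) \<le> liminf (\<lambda>n. ennreal ((b - a)\<^sup>2) * \<epsilon>)"
      by (rule Liminf_mono)
    then show ?thesis by (simp add: Liminf_const)
  qed
  finally show ?thesis .
qed

section \<open>Laws of privatised observations\<close>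

text \<open>Both mechanism classes are covered by one form of the inverse operator,
  \<open>(T h)(v, z) = a h(v, z) + \<integral> \<kappa>(z, x) h(v, x) Q\<^sub>b(dx)\<close> with bounded \<open>\<kappa>\<close>: for \<open>\<Q>\<^sub>\<delta>\<close> the kernel \<open>\<kappa>\<close> is
  constant and \<open>Q\<^sub>b\<close> is \<open>Qbar\<close>; for \<open>\<Q>\<^sub>J\<^sup>I\<close> we have \<open>a = 0\<close> and \<open>Q\<^sub>b\<close> is uniform.
  The functional \<open>sqn\<close> plays the role of \<open>\<parallel>\<cdot>\<parallel>\<^sub>L\<^sup>2\<close>; unlike the norm it needs no Minkowski
  inequality, and it makes sense for every function.\<close>

lemma prob_space_pair_measure:
  assumes "prob_space M" "prob_space N"
  shows "prob_space (M \<Otimes>\<^sub>M N)"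
proof -
  interpret M: prob_space M by fact
  interpret N: prob_space N by fact
  interpret pair_prob_space M N ..
  show ?thesis by (rule prob_space_axioms)
qed

text \<open>\<open>dominated\<close> is asked only for a \<noteq> 0, since otherwise the operator
  never evaluates h at the observed value and the sigma-algebras of \<open>MZ\<close> and
  \<open>MX\<close> need not agree. \<open>unbiased\<close> carries two side conditions: the image
  must be integrable, and a finite second moment under the product law makes almost every section
  integrable, which is what inverting the mixture mechanism takes.\<close>

locale private_law =
  fixes MV :: "'v measure" and MX MZ :: "'a measure" and P PVZ :: "('v \<times> 'a) measure"
    and Qb :: "'a measure" and a B :: real and \<kappa> :: "'a \<Rightarrow> 'a \<Rightarrow> real"
  assumes P: "prob_space P" "sets P = sets (MV \<Otimes>\<^sub>M MX)"
    and PVZ: "prob_space PVZ" "sets PVZ = sets (MV \<Otimes>\<^sub>M MZ)"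
    and Qb: "prob_space Qb" "sets Qb = sets MX"
    and identity_part: "a = 0 \<or> sets MZ = sets MX"
    and \<kappa>_meas: "(\<lambda>(z, x). \<kappa> z x) \<in> borel_measurable (MZ \<Otimes>\<^sub>M MX)"
    and \<kappa>_bound: "\<And>z x. \<bar>\<kappa> z x\<bar> \<le> B"
    and \<kappa>_const: "\<And>z. a + (\<integral>x. \<kappa> z x \<partial>Qb) = 1"
    and marginal: "distr PVZ MV fst = distr P MV fst"
    and dominated: "\<And>h. a \<noteq> 0 \<Longrightarrow> h \<in> borel_measurable (MV \<Otimes>\<^sub>M MX) \<Longrightarrow>
      (\<integral>\<^sup>+u. h u \<partial>PVZ) \<le> (\<integral>\<^sup>+u. h u \<partial>P) + (\<integral>\<^sup>+u. h u \<partial>(distr P MV fst \<Otimes>\<^sub>M Qb))"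
    and unbiased: "\<And>h. h \<in> borel_measurable (MV \<Otimes>\<^sub>M MX) \<Longrightarrow>
      integrable PVZ (\<lambda>u. a * h u + (\<integral>x. \<kappa> (snd u) x * h (fst u, x) \<partial>Qb)) \<Longrightarrow>
      (\<integral>\<^sup>+u. ennreal ((h u)\<^sup>2) \<partial>(distr P MV fst \<Otimes>\<^sub>M Qb)) < \<infinity> \<Longrightarrow>
      (\<integral>u. a * h u + (\<integral>x. \<kappa> (snd u) x * h (fst u, x) \<partial>Qb) \<partial>PVZ) = (\<integral>u. h u \<partial>P)"
begin

definition PV where "PV = distr P MV fst"

definition P2 where "P2 = PV \<Otimes>\<^sub>M Qb"

definition sqn :: "('v \<times> 'a \<Rightarrow> real) \<Rightarrow> ennreal" where
  "sqn h = (\<integral>\<^sup>+u. ennreal ((h u)\<^sup>2) \<partial>P) + (\<integral>\<^sup>+u. ennreal ((h u)\<^sup>2) \<partial>P2)"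

definition T :: "('v \<times> 'a \<Rightarrow> real) \<Rightarrow> 'v \<times> 'a \<Rightarrow> real" where
  "T h = (\<lambda>u. a * h u + (\<integral>x. \<kappa> (snd u) x * h (fst u, x) \<partial>Qb))"

text \<open>Marks the points at which \<open>T\<close> is additive: a non-integrable section
  contributes the integral 0, which is not additive. Only the first component matters because
  \<kappa> is bounded.\<close>

definition section_integrable :: "('v \<times> 'a \<Rightarrow> real) \<Rightarrow> 'v \<Rightarrow> bool" where
  "section_integrable h v \<longleftrightarrow> integrable Qb (\<lambda>x. h (v, x))"

sublocale P: prob_space P by (rule P)
sublocale PVZ: prob_space PVZ by (rule PVZ)
sublocale Qb: prob_space Qb by (rule Qb)

lemma fst_meas: "fst \<in> P \<rightarrow>\<^sub>M MV"
  by (subst measurable_cong_sets[OF P(2) refl]) simp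

sublocale PV: prob_space PV
  unfolding PV_def by (rule P.prob_space_distr[OF fst_meas])

lemma sets_PV: "sets PV = sets MV"
  by (simp add: PV_def)

lemma sets_P2: "sets P2 = sets P"
  unfolding P2_def P(2) by (rule sets_pair_measure_cong[OF sets_PV Qb(2)])

sublocale P2: prob_space P2
  unfolding P2_def by (rule prob_space_pair_measure[OF PV.prob_space_axioms Qb(1)])

lemma space_P2: "space P2 = space P"
  by (rule sets_eq_imp_space_eq[OF sets_P2])

lemma space_P: "space P = space MV \<times> space MX"
  using sets_eq_imp_space_eq[OF P(2)] by (simp add: space_pair_measure)

lemma measurable_P2_iff: "borel_measurable P2 = borel_measurable P"
  by (rule measurable_cong_sets[OF sets_P2 refl])

lemma measurable_P_iff: "borel_measurable P = borel_measurable (MV \<Otimes>\<^sub>M MX)"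
  by (rule measurable_cong_sets[OF P(2) refl])

section \<open>Measurability of the operator and of sections\<close>

lemma measurable_section:
  assumes "(\<lambda>(s, w). H s w) \<in> borel_measurable (A \<Otimes>\<^sub>M P)" "f \<in> N \<rightarrow>\<^sub>M A" "g \<in> N \<rightarrow>\<^sub>M MV"
  shows "(\<lambda>(u, x). H (f u) (g u, x)) \<in> borel_measurable (N \<Otimes>\<^sub>M Qb)"
proof -
  have "sets (N \<Otimes>\<^sub>M Qb) = sets (N \<Otimes>\<^sub>M MX)" "sets (A \<Otimes>\<^sub>M P) = sets (A \<Otimes>\<^sub>M (MV \<Otimes>\<^sub>M MX))"
    by (intro sets_pair_measure_cong refl Qb(2) P(2))+
  note eq = measurable_cong_sets[OF this(1) refl] measurable_cong_sets[OF this(2) refl]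
  have H: "(\<lambda>(s, w). H s w) \<in> borel_measurable (A \<Otimes>\<^sub>M (MV \<Otimes>\<^sub>M MX))"
    using assms(1) unfolding eq .
  have "(\<lambda>p. (f (fst p), g (fst p), snd p)) \<in> N \<Otimes>\<^sub>M MX \<rightarrow>\<^sub>M A \<Otimes>\<^sub>M (MV \<Otimes>\<^sub>M MX)"
    using assms(2,3) by measurable
  from measurable_compose[OF this H] show ?thesis
    unfolding eq by (simp add: case_prod_beta')
qed

text \<open>Joint in parameter and argument, since \<open>T\<close> is applied to functions that
  depend on the auxiliary samples. The identity part relies on equal sigma-algebras only when a
  \<noteq> 0.\<close>

lemma T_measurable:
  assumes H: "(\<lambda>(s, w). H s w) \<in> borel_measurable (A \<Otimes>\<^sub>M P)"
  shows "(\<lambda>(s, u). T (H s) u) \<in> borel_measurable (A \<Otimes>\<^sub>M PVZ)"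
proof -
  let ?N = "A \<Otimes>\<^sub>M (MV \<Otimes>\<^sub>M MZ)"
  have N: "borel_measurable (A \<Otimes>\<^sub>M PVZ) = borel_measurable ?N"
    by (intro measurable_cong_sets sets_pair_measure_cong refl PVZ(2))
  have "(\<lambda>(p, x). H (fst p) (fst (snd p), x)) \<in> borel_measurable (?N \<Otimes>\<^sub>M Qb)"
    by (rule measurable_section[OF H]) measurable
  moreover have "(\<lambda>(p, x). \<kappa> (snd (snd p)) x) \<in> borel_measurable (?N \<Otimes>\<^sub>M Qb)"
  proof -
    have "sets (?N \<Otimes>\<^sub>M Qb) = sets (?N \<Otimes>\<^sub>M MX)"
      by (intro sets_pair_measure_cong refl Qb(2))
    note eq = measurable_cong_sets[OF this refl]
    have "(\<lambda>q. (snd (snd (fst q)), snd q)) \<in> ?N \<Otimes>\<^sub>M MX \<rightarrow>\<^sub>M MZ \<Otimes>\<^sub>M MX"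
      by measurable
    from measurable_compose[OF this \<kappa>_meas] show ?thesis
      unfolding eq by (simp add: case_prod_beta')
  qed
  ultimately have "(\<lambda>(p, x). \<kappa> (snd (snd p)) x * H (fst p) (fst (snd p), x)) \<in> borel_measurable (?N \<Otimes>\<^sub>M Qb)"
    unfolding case_prod_beta' by (rule borel_measurable_times[rotated])
  then have int: "(\<lambda>p. \<integral>x. \<kappa> (snd (snd p)) x * H (fst p) (fst (snd p), x) \<partial>Qb) \<in> borel_measurable ?N"
    by (rule Qb.borel_measurable_lebesgue_integral)
  have "(\<lambda>p. a * H (fst p) (snd p)) \<in> borel_measurable ?N"
  proof (cases "a = 0")
    case False
    then have "sets MZ = sets MX" using identity_part by simp
    then have "sets ?N = sets (A \<Otimes>\<^sub>M P)"
      by (intro sets_pair_measure_cong refl) (simp add: P(2) cong: sets_pair_measure_cong)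
    note eq = measurable_cong_sets[OF this refl]
    have "(\<lambda>p. H (fst p) (snd p)) \<in> borel_measurable ?N"
      using H unfolding eq by (simp add: case_prod_beta')
    then show ?thesis by simp
  qed simp
  from borel_measurable_add[OF this int] show ?thesis
    unfolding N by (simp add: T_def case_prod_beta')
qed

lemma T_measurable1:
  assumes h: "h \<in> borel_measurable P"
  shows "T h \<in> borel_measurable PVZ"
proof -
  \<comment> \<open>A one-point parameter space reduces a fixed function to the joint
    statement.\<close>
  let ?A = "count_space {()}"
  have "(\<lambda>(s, w). h w) \<in> borel_measurable (?A \<Otimes>\<^sub>M P)"
    unfolding case_prod_beta' by (rule measurable_compose[OF measurable_snd h])
  from T_measurable[OF this] have "(\<lambda>(s, u). T h u) \<in> borel_measurable (?A \<Otimes>\<^sub>M PVZ)" .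
  from measurable_compose[OF measurable_Pair1' this, of "()"] show ?thesis by simp
qed

lemma section_meas:
  assumes "h \<in> borel_measurable P" "v \<in> space MV"
  shows "(\<lambda>x. h (v, x)) \<in> borel_measurable Qb"
proof -
  have "(\<lambda>x. (v, x)) \<in> MX \<rightarrow>\<^sub>M MV \<Otimes>\<^sub>M MX" using assms(2) by simp
  from measurable_compose[OF this] assms(1)[unfolded measurable_P_iff] show ?thesis
    unfolding measurable_cong_sets[OF Qb(2) refl] by blast
qed

lemma \<kappa>_section: "z \<in> space MZ \<Longrightarrow> \<kappa> z \<in> borel_measurable Qb"
  unfolding measurable_cong_sets[OF Qb(2) refl] using measurable_Pair2[OF \<kappa>_meas, of z] by simp

lemma \<kappa>_mult_integrable:
  assumes "z \<in> space MZ" "integrable Qb h"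
  shows "integrable Qb (\<lambda>x. \<kappa> z x * h x)"
proof (rule Bochner_Integration.integrable_bound[of _ "\<lambda>x. B * h x"])
  have "0 \<le> B" using \<kappa>_bound[of z z] by linarith
  then show "AE x in Qb. norm (\<kappa> z x * h x) \<le> norm (B * h x)"
    using \<kappa>_bound by (auto simp: abs_mult intro!: mult_right_mono AE_I2)
qed (use assms \<kappa>_section in auto)

lemma space_PVZ: "space PVZ = space MV \<times> space MZ"
  using sets_eq_imp_space_eq[OF PVZ(2)] by (simp add: space_pair_measure)

section \<open>Additivity, second moment bounds and preservation of means\<close>

lemma T_add:
  assumes "u \<in> space PVZ" "section_integrable h (fst u)" "section_integrable k (fst u)"
  shows "T (\<lambda>w. h w + k w) u = T h u + T k u"
proof -
  have "snd u \<in> space MZ" using assms(1) by (auto simp: space_PVZ)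
  from \<kappa>_mult_integrable[OF this] show ?thesis
    using assms(2,3) by (simp add: T_def section_integrable_def distrib_left)
qed

text \<open>A Markov kernel fixes constants, hence so does its inverse;
  \<open>\<kappa>_const\<close> is the corresponding normalisation. This is what makes an arbitrary
  initial estimate cancel.\<close>

lemma T_const: "T (\<lambda>w. c) u = c"
proof -
  have "T (\<lambda>w. c) u = c * (a + (\<integral>x. \<kappa> (snd u) x \<partial>Qb))"
    by (simp add: T_def algebra_simps)
  then show ?thesis by (simp add: \<kappa>_const)
qed

text \<open>Privatisation leaves V untouched, so V has the law \<open>PV\<close> under
  \<open>PVZ\<close> as well, and averaging a section over \<open>Qb\<close> sees V only.\<close>

lemma nn_integral_P2: "h \<in> borel_measurable P2 \<Longrightarrow>
  (\<integral>\<^sup>+u. \<integral>\<^sup>+x. h (fst u, x) \<partial>Qb \<partial>PVZ) = (\<integral>\<^sup>+u. h u \<partial>P2)" for h :: "_ \<Rightarrow> ennreal"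
proof -
  assume h: "h \<in> borel_measurable P2"
  have fstZ: "fst \<in> PVZ \<rightarrow>\<^sub>M MV"
    by (subst measurable_cong_sets[OF PVZ(2) refl]) simp
  have m: "(\<lambda>v. \<integral>\<^sup>+x. h (v, x) \<partial>Qb) \<in> borel_measurable PV"
    using h unfolding P2_def by (rule Qb.borel_measurable_nn_integral_fst)
  then have "(\<integral>\<^sup>+v. \<integral>\<^sup>+x. h (v, x) \<partial>Qb \<partial>distr PVZ MV fst) = (\<integral>\<^sup>+u. \<integral>\<^sup>+x. h (fst u, x) \<partial>Qb \<partial>PVZ)"
    using fstZ by (intro nn_integral_distr) (auto simp: measurable_cong_sets[OF sets_PV refl])
  then show ?thesis
    using Qb.nn_integral_fst[OF h[unfolded P2_def]] by (simp add: marginal P2_def PV_def)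
qed

lemma sq_meas: "h \<in> borel_measurable N \<Longrightarrow> (\<lambda>u. ennreal ((h u)\<^sup>2)) \<in> borel_measurable N" for h :: "_ \<Rightarrow> real"
  by measurable

text \<open>The second summand of \<open>sqn\<close> gives this control: by Fubini almost every
  section has a finite second moment under \<open>Qb\<close>, and on a probability space that
  implies integrability.\<close>

lemma section_integrable_AE:
  assumes h: "h \<in> borel_measurable P" and fin: "sqn h < \<infinity>"
  shows "AE u in PVZ. section_integrable h (fst u)"
proof -
  have hm: "(\<lambda>u. ennreal ((h u)\<^sup>2)) \<in> borel_measurable P2"
    using h by (intro sq_meas) (simp add: measurable_P2_iff)
  have "(\<integral>\<^sup>+u. \<integral>\<^sup>+x. ennreal ((h (fst u, x))\<^sup>2) \<partial>Qb \<partial>PVZ) \<noteq> \<infinity>"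
    using fin unfolding nn_integral_P2[OF hm] sqn_def by auto
  moreover have "(\<lambda>u. \<integral>\<^sup>+x. ennreal ((h (fst u, x))\<^sup>2) \<partial>Qb) \<in> borel_measurable PVZ"
  proof -
    have fstZ: "fst \<in> PVZ \<rightarrow>\<^sub>M PV"
      by (subst measurable_cong_sets[OF PVZ(2) sets_PV]) simp
    show ?thesis
      using measurable_compose[OF fstZ Qb.borel_measurable_nn_integral_fst[OF hm[unfolded P2_def]]] .
  qed
  ultimately have "AE u in PVZ. (\<integral>\<^sup>+x. ennreal ((h (fst u, x))\<^sup>2) \<partial>Qb) \<noteq> \<infinity>"
    by (intro nn_integral_PInf_AE) auto
  then show ?thesis
  proof (rule AE_mp, intro AE_I2 impI)
    fix u assume u: "u \<in> space PVZ" and fin: "(\<integral>\<^sup>+x. ennreal ((h (fst u, x))\<^sup>2) \<partial>Qb) \<noteq> \<infinity>"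
    have m: "(\<lambda>x. h (fst u, x)) \<in> borel_measurable Qb"
      using u by (intro section_meas[OF h]) (auto simp: space_PVZ)
    have "integrable Qb (\<lambda>x. (h (fst u, x))\<^sup>2)"
      using fin m by (intro integrableI_bounded) (auto simp: less_top)
    then show "section_integrable h (fst u)"
      unfolding section_integrable_def using m by (rule Qb.square_integrable_imp_integrable[rotated])
  qed
qed

lemma section_square_le:
  assumes u: "u \<in> space PVZ" and h: "h \<in> borel_measurable P"
  shows "ennreal ((\<integral>x. \<kappa> (snd u) x * h (fst u, x) \<partial>Qb)\<^sup>2) \<le> ennreal (B\<^sup>2) * (\<integral>\<^sup>+x. ennreal ((h (fst u, x))\<^sup>2) \<partial>Qb)"
proof (cases "(\<integral>\<^sup>+x. ennreal ((h (fst u, x))\<^sup>2) \<partial>Qb) = \<infinity>")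
  case True
  show ?thesis
  \<comment> \<open>For B = 0 the right-hand side is 0 times \<infinity>, that is 0, so the
    left-hand side must vanish too; it does, because \<kappa> is then identically 0.\<close>
  proof (cases "B = 0")
    case True
    then have "\<kappa> z x = 0" for z x using \<kappa>_bound[of z x] by simp
    then show ?thesis by simp
  qed (use True in \<open>simp add: ennreal_mult_top\<close>)
next
  case False
  let ?g = "\<lambda>x. \<kappa> (snd u) x * h (fst u, x)"
  have m: "(\<lambda>x. h (fst u, x)) \<in> borel_measurable Qb" and m': "\<kappa> (snd u) \<in> borel_measurable Qb"
    using u section_meas[OF h] \<kappa>_section by (auto simp: space_PVZ)
  have g: "?g \<in> borel_measurable Qb" using m m' by simp
  have le: "(\<integral>\<^sup>+x. ennreal ((?g x)\<^sup>2) \<partial>Qb) \<le> ennreal (B\<^sup>2) * (\<integral>\<^sup>+x. ennreal ((h (fst u, x))\<^sup>2) \<partial>Qb)"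
  proof -
    have "(\<kappa> (snd u) x)\<^sup>2 \<le> B\<^sup>2" for x
      using \<kappa>_bound[of "snd u" x] by (metis abs_ge_zero power2_abs power_mono)
    then have "(?g x)\<^sup>2 \<le> B\<^sup>2 * (h (fst u, x))\<^sup>2" for x
      by (simp add: power_mult_distrib mult_right_mono)
    then have "(\<integral>\<^sup>+x. ennreal ((?g x)\<^sup>2) \<partial>Qb) \<le> (\<integral>\<^sup>+x. ennreal (B\<^sup>2) * ennreal ((h (fst u, x))\<^sup>2) \<partial>Qb)"
      by (intro nn_integral_mono) (simp flip: ennreal_mult add: ennreal_leI)
    then show ?thesis using m by (simp add: nn_integral_cmult)
  qed
  also have "\<dots> < \<infinity>" using False by (simp add: ennreal_mult_less_top less_top)
  finally have i2: "integrable Qb (\<lambda>x. (?g x)\<^sup>2)"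
    using g by (intro integrableI_bounded) auto
  have "ennreal ((\<integral>x. ?g x \<partial>Qb)\<^sup>2) \<le> (\<integral>\<^sup>+x. ennreal ((?g x)\<^sup>2) \<partial>Qb)"
    using Qb.square_expectation_le[OF g i2] i2 by (simp add: nn_integral_eq_integral ennreal_leI)
  then show ?thesis using le by (rule order_trans)
qed

text \<open>The square of a sum is at most twice the sum of the squares. The identity part passes
  from \<open>PVZ\<close> to P and \<open>P2\<close> by \<open>dominated\<close>; the kernel part is
  bounded on each section by B and Jensen's inequality. Both sides may be infinite, so finiteness of
  \<open>sqn\<close> alone transfers to the image.\<close>

lemma T_bound:
  assumes h: "h \<in> borel_measurable P"
  shows "(\<integral>\<^sup>+u. ennreal ((T h u)\<^sup>2) \<partial>PVZ) \<le> ennreal (2 * a\<^sup>2 + 2 * B\<^sup>2) * sqn h"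
proof -
  let ?S = "\<lambda>u. \<integral>\<^sup>+x. ennreal ((h (fst u, x))\<^sup>2) \<partial>Qb"
  have hm: "(\<lambda>u. ennreal ((h u)\<^sup>2)) \<in> borel_measurable P2"
    using h by (intro sq_meas) (simp add: measurable_P2_iff)
  have fstZ: "fst \<in> PVZ \<rightarrow>\<^sub>M PV"
    by (subst measurable_cong_sets[OF PVZ(2) sets_PV]) simp
  have Sm: "?S \<in> borel_measurable PVZ"
    using measurable_compose[OF fstZ Qb.borel_measurable_nn_integral_fst[OF hm[unfolded P2_def]]] .
  have ah: "(\<lambda>u. ennreal (2 * a\<^sup>2 * (h u)\<^sup>2)) \<in> borel_measurable PVZ"
    and ah_le: "(\<integral>\<^sup>+u. ennreal (2 * a\<^sup>2 * (h u)\<^sup>2) \<partial>PVZ) \<le> ennreal (2 * a\<^sup>2) * sqn h"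
  proof -
    show "(\<lambda>u. ennreal (2 * a\<^sup>2 * (h u)\<^sup>2)) \<in> borel_measurable PVZ"
    proof (cases "a = 0")
      case False
      then have "sets PVZ = sets P"
        unfolding P(2) PVZ(2) using identity_part by (intro sets_pair_measure_cong refl) auto
      then show ?thesis using h by (subst measurable_cong_sets[OF _ refl]) auto
    qed simp
    show "(\<integral>\<^sup>+u. ennreal (2 * a\<^sup>2 * (h u)\<^sup>2) \<partial>PVZ) \<le> ennreal (2 * a\<^sup>2) * sqn h"
    proof (cases "a = 0")
      case False
      then have "sets PVZ = sets P"
        unfolding P(2) PVZ(2) using identity_part by (intro sets_pair_measure_cong refl) auto
      then have m: "(\<lambda>u. ennreal ((h u)\<^sup>2)) \<in> borel_measurable PVZ"
        using sq_meas[OF h] by (subst measurable_cong_sets[OF _ refl]) auto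
      have "(\<integral>\<^sup>+u. ennreal (2 * a\<^sup>2 * (h u)\<^sup>2) \<partial>PVZ) = ennreal (2 * a\<^sup>2) * (\<integral>\<^sup>+u. ennreal ((h u)\<^sup>2) \<partial>PVZ)"
        using m by (simp add: ennreal_mult nn_integral_cmult)
      also have "\<dots> \<le> ennreal (2 * a\<^sup>2) * sqn h"
        unfolding sqn_def P2_def PV_def using sq_meas[OF h]
        by (intro mult_left_mono dominated[OF False]) (auto simp: measurable_P_iff)
      finally show ?thesis .
    qed simp
  qed
  have "(\<integral>\<^sup>+u. ennreal ((T h u)\<^sup>2) \<partial>PVZ) \<le>
      (\<integral>\<^sup>+u. ennreal (2 * a\<^sup>2 * (h u)\<^sup>2) + ennreal (2 * B\<^sup>2) * ?S u \<partial>PVZ)"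
  proof (rule nn_integral_mono)
    fix u assume u: "u \<in> space PVZ"
    let ?I = "\<integral>x. \<kappa> (snd u) x * h (fst u, x) \<partial>Qb"
    have "(T h u)\<^sup>2 \<le> 2 * a\<^sup>2 * (h u)\<^sup>2 + 2 * ?I\<^sup>2"
      using sum_squares_bound[of "a * h u" ?I] by (simp add: T_def power2_sum power_mult_distrib)
    then have "ennreal ((T h u)\<^sup>2) \<le> ennreal (2 * a\<^sup>2 * (h u)\<^sup>2) + 2 * ennreal (?I\<^sup>2)"
      by (auto dest!: ennreal_leI simp: ennreal_mult)
    also have "\<dots> \<le> ennreal (2 * a\<^sup>2 * (h u)\<^sup>2) + 2 * (ennreal (B\<^sup>2) * ?S u)"
      by (intro add_left_mono mult_left_mono section_square_le[OF u h]) simp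
    also have "2 * (ennreal (B\<^sup>2) * ?S u) = ennreal (2 * B\<^sup>2) * ?S u"
      by (simp add: ennreal_mult mult.assoc)
    finally show "ennreal ((T h u)\<^sup>2) \<le> ennreal (2 * a\<^sup>2 * (h u)\<^sup>2) + ennreal (2 * B\<^sup>2) * ?S u" .
  qed
  also have "\<dots> = (\<integral>\<^sup>+u. ennreal (2 * a\<^sup>2 * (h u)\<^sup>2) \<partial>PVZ) + ennreal (2 * B\<^sup>2) * (\<integral>\<^sup>+u. ennreal ((h u)\<^sup>2) \<partial>P2)"
    using ah Sm nn_integral_P2[OF hm] by (simp add: nn_integral_add nn_integral_cmult)
  also have "\<dots> \<le> ennreal (2 * a\<^sup>2) * sqn h + ennreal (2 * B\<^sup>2) * sqn h"
    by (intro add_mono ah_le mult_left_mono) (auto simp: sqn_def)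
  also have "\<dots> = ennreal (2 * a\<^sup>2 + 2 * B\<^sup>2) * sqn h"
    by (simp add: distrib_right)
  finally show ?thesis .
qed

lemma sqn_add_le:
  assumes "h \<in> borel_measurable P" "k \<in> borel_measurable P"
  shows "sqn (\<lambda>w. h w + k w) \<le> 2 * sqn h + 2 * sqn k"
proof -
  have "(\<integral>\<^sup>+u. ennreal ((h u + k u)\<^sup>2) \<partial>N) \<le>
      2 * (\<integral>\<^sup>+u. ennreal ((h u)\<^sup>2) \<partial>N) + 2 * (\<integral>\<^sup>+u. ennreal ((k u)\<^sup>2) \<partial>N)"
    if [measurable]: "h \<in> borel_measurable N" "k \<in> borel_measurable N" for N
  proof -
    have "ennreal ((h u + k u)\<^sup>2) \<le> 2 * ennreal ((h u)\<^sup>2) + 2 * ennreal ((k u)\<^sup>2)" for u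
    proof -
      have "(h u + k u)\<^sup>2 \<le> 2 * (h u)\<^sup>2 + 2 * (k u)\<^sup>2"
        using sum_squares_bound[of "h u" "k u"] by (simp add: power2_sum)
      then have "ennreal ((h u + k u)\<^sup>2) \<le> ennreal (2 * (h u)\<^sup>2 + 2 * (k u)\<^sup>2)" by (rule ennreal_leI)
      then show ?thesis by (simp add: ennreal_mult)
    qed
    then have "(\<integral>\<^sup>+u. ennreal ((h u + k u)\<^sup>2) \<partial>N) \<le> (\<integral>\<^sup>+u. 2 * ennreal ((h u)\<^sup>2) + 2 * ennreal ((k u)\<^sup>2) \<partial>N)"
      by (intro nn_integral_mono)
    then show ?thesis by (simp add: nn_integral_add nn_integral_cmult)
  qed
  from add_mono[OF this[of P] this[of P2]] assms show ?thesis
    by (simp add: sqn_def measurable_P2_iff distrib_left ac_simps)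
qed

lemma sqn_diff_le:
  assumes "h \<in> borel_measurable P" "k \<in> borel_measurable P"
  shows "sqn (\<lambda>w. h w - k w) \<le> 2 * sqn h + 2 * sqn k"
  using sqn_add_le[OF assms(1), of "\<lambda>w. - k w"] assms(2) by (simp add: sqn_def)

lemma sqn_le_AE:
  assumes k: "k \<in> borel_measurable P"
    and "AE w in P. \<bar>h w\<bar> \<le> c * \<bar>k w\<bar>" "AE w in P2. \<bar>h w\<bar> \<le> c * \<bar>k w\<bar>"
  shows "sqn h \<le> ennreal (c\<^sup>2) * sqn k"
proof -
  have "(\<integral>\<^sup>+u. ennreal ((h u)\<^sup>2) \<partial>N) \<le> ennreal (c\<^sup>2) * (\<integral>\<^sup>+u. ennreal ((k u)\<^sup>2) \<partial>N)"
    if [measurable]: "k \<in> borel_measurable N" and ae: "AE w in N. \<bar>h w\<bar> \<le> c * \<bar>k w\<bar>" for N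
  proof -
    have "AE u in N. ennreal ((h u)\<^sup>2) \<le> ennreal (c\<^sup>2) * ennreal ((k u)\<^sup>2)"
      using ae
    proof eventually_elim
      case (elim u)
      then have "(h u)\<^sup>2 \<le> c\<^sup>2 * (k u)\<^sup>2"
        by (metis abs_ge_zero power2_abs power_mono power_mult_distrib)
      then show ?case by (simp flip: ennreal_mult add: ennreal_leI)
    qed
    then have "(\<integral>\<^sup>+u. ennreal ((h u)\<^sup>2) \<partial>N) \<le> (\<integral>\<^sup>+u. ennreal (c\<^sup>2) * ennreal ((k u)\<^sup>2) \<partial>N)"
      by (rule nn_integral_mono_AE)
    then show ?thesis by (simp add: nn_integral_cmult)
  qed
  from add_mono[OF this[of P] this[of P2]] assms show ?thesis
    by (simp add: sqn_def measurable_P2_iff distrib_left)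
qed

lemma sqn_le:
  assumes "k \<in> borel_measurable P" "\<And>w. w \<in> space P \<Longrightarrow> \<bar>h w\<bar> \<le> c * \<bar>k w\<bar>"
  shows "sqn h \<le> ennreal (c\<^sup>2) * sqn k"
  using assms by (intro sqn_le_AE) (auto simp: space_P2)

lemma sqn_cmult: "h \<in> borel_measurable P \<Longrightarrow> sqn (\<lambda>w. c * h w) \<le> ennreal (c\<^sup>2) * sqn h"
  using sqn_le[of h "\<lambda>w. c * h w" "\<bar>c\<bar>"] by (simp add: abs_mult)

lemma sqn_const: "sqn (\<lambda>w. c) = 2 * ennreal (c\<^sup>2)"
  by (simp add: sqn_def P.emeasure_space_1 P2.emeasure_space_1 mult_2)

lemma square_integrable_P:
  assumes h: "h \<in> borel_measurable P" and fin: "sqn h < \<infinity>"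
  shows "integrable P (\<lambda>w. (h w)\<^sup>2)" "integrable P h" "ennreal ((\<integral>w. h w \<partial>P)\<^sup>2) \<le> sqn h"
proof -
  have "(\<integral>\<^sup>+u. ennreal ((h u)\<^sup>2) \<partial>P) < \<infinity>"
    using fin by (auto simp: sqn_def less_top)
  then show i2: "integrable P (\<lambda>w. (h w)\<^sup>2)"
    using h by (intro integrableI_bounded) auto
  show "integrable P h"
    by (rule P.square_integrable_imp_integrable[OF h i2])
  have "ennreal ((\<integral>w. h w \<partial>P)\<^sup>2) \<le> (\<integral>\<^sup>+w. ennreal ((h w)\<^sup>2) \<partial>P)"
    using P.square_expectation_le[OF h i2] i2 by (simp add: nn_integral_eq_integral ennreal_leI)
  then show "ennreal ((\<integral>w. h w \<partial>P)\<^sup>2) \<le> sqn h"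
    by (simp add: sqn_def add_increasing2)
qed

lemma T_square_integrable:
  assumes "h \<in> borel_measurable P" "sqn h < \<infinity>"
  shows "integrable PVZ (\<lambda>u. (T h u)\<^sup>2)"
proof -
  have "(\<integral>\<^sup>+u. ennreal ((T h u)\<^sup>2) \<partial>PVZ) < \<infinity>"
    using T_bound[OF assms(1)] assms(2) by (auto simp: ennreal_mult_less_top intro: le_less_trans)
  then show ?thesis
    using T_measurable1[OF assms(1)] by (intro integrableI_bounded) auto
qed

text \<open>Finiteness of \<open>sqn\<close> supplies both side conditions of
  \<open>unbiased\<close>: integrability of the image through \<open>T_bound\<close>, and the second
  moment under \<open>P2\<close>.\<close>

lemma T_mean:
  assumes h: "h \<in> borel_measurable P" "sqn h < \<infinity>"
  shows "(\<integral>u. T h u \<partial>PVZ) = (\<integral>w. h w \<partial>P)"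
proof -
  have "integrable PVZ (T h)"
    by (rule PVZ.square_integrable_imp_integrable[OF T_measurable1[OF h(1)] T_square_integrable[OF h]])
  then show ?thesis
    using unbiased[of h] h by (simp add: T_def sqn_def P2_def PV_def measurable_P_iff)
qed

end

section \<open>Sample splitting\<close>

locale split_samples = private_law +
  fixes M :: "'w measure" and S S' S'' :: "nat \<Rightarrow> 'w \<Rightarrow> 'a \<times> 'b"
  assumes M: "prob_space M"
    and sample_law: "\<And>i. distr M PVZ (S i) = PVZ" "\<And>i. distr M PVZ (S' i) = PVZ" "\<And>i. distr M PVZ (S'' i) = PVZ"
    and sample_indep: "prob_space.indep_vars M (\<lambda>_. PVZ) (\<lambda>(j, i). ([S, S', S''] ! j) i) ({..<3} \<times> UNIV)"
begin

sublocale M: prob_space M by (rule M)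

definition Pn where "Pn n = PiM {..<n} (\<lambda>_. PVZ)"

definition U where "U n \<omega> = (sample S' n \<omega>, sample S'' n \<omega>)"

definition all_samples where "all_samples = (\<lambda>(j, i). ([S, S', S''] ! j) i)"

lemma all_samples_simps [simp]:
  "all_samples (0, i) = S i" "all_samples (Suc 0, i) = S' i" "all_samples (2, i) = S'' i"
  by (auto simp: all_samples_def)

lemma samples_meas [measurable]: "S i \<in> M \<rightarrow>\<^sub>M PVZ" "S' i \<in> M \<rightarrow>\<^sub>M PVZ" "S'' i \<in> M \<rightarrow>\<^sub>M PVZ"
proof -
  have *: "all_samples (j, i) \<in> M \<rightarrow>\<^sub>M PVZ" if "j < 3" for j
    using sample_indep that by (auto simp: M.indep_vars_def all_samples_def)
  show "S i \<in> M \<rightarrow>\<^sub>M PVZ" "S' i \<in> M \<rightarrow>\<^sub>M PVZ" "S'' i \<in> M \<rightarrow>\<^sub>M PVZ"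
    using *[of 0] *[of 1] *[of 2] by auto
qed

lemma sample_meas: "sample S n \<in> M \<rightarrow>\<^sub>M Pn n" "sample S' n \<in> M \<rightarrow>\<^sub>M Pn n" "sample S'' n \<in> M \<rightarrow>\<^sub>M Pn n"
  unfolding Pn_def sample_def by (intro measurable_restrict; measurable)+

lemma U_meas: "U n \<in> M \<rightarrow>\<^sub>M Pn n \<Otimes>\<^sub>M Pn n"
  unfolding U_def[abs_def] by (intro measurable_Pair sample_meas)

text \<open>Restricting the doubly indexed family to the singleton blocks {(0, i)} reindexes its
  independence along i.\<close>

lemma indep_S: "M.indep_vars (\<lambda>_. PVZ) S UNIV"
proof -
  have "M.indep_vars (\<lambda>i. PiM {(0, i)} (\<lambda>_. PVZ)) (\<lambda>i \<omega>. restrict (\<lambda>j. all_samples j \<omega>) {(0, i)}) UNIV"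
    by (rule M.indep_vars_restrict[OF sample_indep[folded all_samples_def]]) (auto simp: disjoint_family_on_def)
  from M.indep_vars_compose2[OF this, of "\<lambda>i y. y (0, i)" "\<lambda>_. PVZ"] show ?thesis
    by simp
qed

text \<open>Covers both conditional arguments: the main sample given the two auxiliary ones (j = 0,
  J = {1, 2}), and the third sample given the second (j = 2, J = {1}).\<close>

lemma chebyshev_all:
  fixes G :: "(nat \<times> nat \<Rightarrow> 'a \<times> 'b) \<Rightarrow> 'a \<times> 'b \<Rightarrow> real"
  assumes j: "j < 3" "J \<subseteq> {..<3}" "j \<notin> J"
    and G: "(\<lambda>(s, u). G s u) \<in> borel_measurable (PiM (J \<times> {..<n}) (\<lambda>_. PVZ) \<Otimes>\<^sub>M PVZ)"
    and pos: "\<epsilon> > 0" "\<delta> \<ge> 0"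
  defines "W \<equiv> \<lambda>\<omega>. \<lambda>i\<in>J \<times> {..<n}. all_samples i \<omega>"
  shows "outer_measure_of M {\<omega> \<in> space M. \<epsilon> <
      \<bar>\<Sum>i<n. G (W \<omega>) (all_samples (j, i) \<omega>) - (\<integral>u. G (W \<omega>) u \<partial>PVZ)\<bar>} \<le>
    ennreal (real n * \<delta> / \<epsilon>\<^sup>2) +
    outer_measure_of M {\<omega> \<in> space M. \<not> (\<integral>\<^sup>+u. ennreal ((G (W \<omega>) u)\<^sup>2) \<partial>PVZ) \<le> ennreal \<delta>}"
proof -
  have ind: "M.indep_vars (\<lambda>_. PVZ) all_samples ({j} \<times> {..<n} \<union> J \<times> {..<n})"
    using j by (intro M.indep_vars_subset[OF sample_indep[folded all_samples_def]]) auto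
  have law: "distr M PVZ (all_samples i) = PVZ" if "i \<in> {j} \<times> {..<n}" for i
    using that j sample_law by (auto simp: less_Suc_eq numeral_3_eq_3 all_samples_def)
  have card: "card ({j} \<times> {..<n}) = n" by (simp add: card_cartesian_product)
  have sum: "(\<Sum>i\<in>{j} \<times> {..<n}. F i) = (\<Sum>i<n. F (j, i))" for F :: "nat \<times> nat \<Rightarrow> real"
  proof -
    have "{j} \<times> {..<n} = Pair j ` {..<n}" by auto
    then show ?thesis by (simp add: sum.reindex inj_on_def)
  qed
  show ?thesis
    using M.conditional_chebyshev[OF ind _ _ law PVZ(1) G pos] j(3)
    unfolding card sum W_def by auto
qed

lemma chebyshev_S:
  fixes G :: "(nat \<Rightarrow> 'a \<times> 'b) \<times> (nat \<Rightarrow> 'a \<times> 'b) \<Rightarrow> 'a \<times> 'b \<Rightarrow> real"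
  assumes G: "(\<lambda>(s, u). G s u) \<in> borel_measurable ((Pn n \<Otimes>\<^sub>M Pn n) \<Otimes>\<^sub>M PVZ)"
    and pos: "\<epsilon> > 0" "\<delta> \<ge> 0"
  shows "outer_measure_of M {\<omega> \<in> space M. \<epsilon> < \<bar>\<Sum>i<n. G (U n \<omega>) (S i \<omega>) - (\<integral>u. G (U n \<omega>) u \<partial>PVZ)\<bar>} \<le>
    ennreal (real n * \<delta> / \<epsilon>\<^sup>2) +
    outer_measure_of M {\<omega> \<in> space M. \<not> (\<integral>\<^sup>+u. ennreal ((G (U n \<omega>) u)\<^sup>2) \<partial>PVZ) \<le> ennreal \<delta>}"
proof -
  have j: "(0::nat) < 3" "{1, 2::nat} \<subseteq> {..<3}" "(0::nat) \<notin> {1, 2}" by auto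
  let ?J = "{1, 2} \<times> {..<n}"
  let ?L = "PiM ?J (\<lambda>_. PVZ)"
  define \<pi> where "\<pi> s = (\<lambda>i\<in>{..<n}. s (1::nat, i), \<lambda>i\<in>{..<n}. s (2::nat, i))" for s :: "nat \<times> nat \<Rightarrow> 'a \<times> 'b"
  have "\<pi> \<in> ?L \<rightarrow>\<^sub>M Pn n \<Otimes>\<^sub>M Pn n"
    unfolding \<pi>_def[abs_def] Pn_def
    by (intro measurable_Pair measurable_restrict measurable_component_singleton) auto
  then have "(\<lambda>p. (\<pi> (fst p), snd p)) \<in> ?L \<Otimes>\<^sub>M PVZ \<rightarrow>\<^sub>M (Pn n \<Otimes>\<^sub>M Pn n) \<Otimes>\<^sub>M PVZ"
    by measurable
  from measurable_compose[OF this G]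
  have m: "(\<lambda>(s, u). G (\<pi> s) u) \<in> borel_measurable (?L \<Otimes>\<^sub>M PVZ)"
    by (simp add: case_prod_beta')
  have \<pi>: "\<pi> (\<lambda>i\<in>?J. all_samples i \<omega>) = U n \<omega>" for \<omega>
    by (auto simp: \<pi>_def U_def sample_def fun_eq_iff)
  show ?thesis
    using chebyshev_all[OF _ _ _ m pos, of 0] unfolding \<pi> all_samples_simps by (simp only: j simp_thms)
qed

lemma chebyshev_S'':
  fixes G :: "(nat \<Rightarrow> 'a \<times> 'b) \<Rightarrow> 'a \<times> 'b \<Rightarrow> real"
  assumes G: "(\<lambda>(s, u). G s u) \<in> borel_measurable (Pn n \<Otimes>\<^sub>M PVZ)"
    and pos: "\<epsilon> > 0" "\<delta> \<ge> 0"
  shows "outer_measure_of M {\<omega> \<in> space M. \<epsilon> <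
      \<bar>\<Sum>i<n. G (sample S' n \<omega>) (S'' i \<omega>) - (\<integral>u. G (sample S' n \<omega>) u \<partial>PVZ)\<bar>} \<le>
    ennreal (real n * \<delta> / \<epsilon>\<^sup>2) +
    outer_measure_of M {\<omega> \<in> space M. \<not> (\<integral>\<^sup>+u. ennreal ((G (sample S' n \<omega>) u)\<^sup>2) \<partial>PVZ) \<le> ennreal \<delta>}"
proof -
  have j: "(2::nat) < 3" "{1::nat} \<subseteq> {..<3}" "(2::nat) \<notin> {1}" by auto
  let ?J = "{1} \<times> {..<n}"
  let ?L = "PiM ?J (\<lambda>_. PVZ)"
  define \<pi> where "\<pi> s = (\<lambda>i\<in>{..<n}. s (1::nat, i))" for s :: "nat \<times> nat \<Rightarrow> 'a \<times> 'b"
  have "\<pi> \<in> ?L \<rightarrow>\<^sub>M Pn n"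
    unfolding \<pi>_def[abs_def] Pn_def by (intro measurable_restrict measurable_component_singleton) auto
  then have "(\<lambda>p. (\<pi> (fst p), snd p)) \<in> ?L \<Otimes>\<^sub>M PVZ \<rightarrow>\<^sub>M Pn n \<Otimes>\<^sub>M PVZ"
    by measurable
  from measurable_compose[OF this G]
  have m: "(\<lambda>(s, u). G (\<pi> s) u) \<in> borel_measurable (?L \<Otimes>\<^sub>M PVZ)"
    by (simp add: case_prod_beta')
  have \<pi>: "\<pi> (\<lambda>i\<in>?J. all_samples i \<omega>) = sample S' n \<omega>" for \<omega>
    by (auto simp: \<pi>_def sample_def fun_eq_iff)
  show ?thesis
    using chebyshev_all[OF _ _ _ m pos, of 2] unfolding \<pi> all_samples_simps by (simp only: j simp_thms)
qed

lemma avg_sample: "avg n h (sample X n \<omega>) = (\<Sum>i<n. h (X i \<omega>)) / real n"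
  by (simp add: avg_def sample_def)

lemma sum_centered: "n > 0 \<Longrightarrow> (\<Sum>i<n. h i - c) = real n * ((\<Sum>i<n. h i) / real n - c)" for c :: real
  by (simp add: sum_subtractf field_simps)

text \<open>After scaling by the square root of n, Chebyshev's bound is \<delta> divided by
  \<open>\<epsilon>\<^sup>2\<close>, free of n, so conditional second moments that tend to 0
  suffice.\<close>

lemma empirical_process_tendsto_0:
  assumes G: "\<And>n. (\<lambda>(s, u). G n s u) \<in> borel_measurable ((Pn n \<Otimes>\<^sub>M Pn n) \<Otimes>\<^sub>M PVZ)"
    and small: "((\<lambda>(n, \<omega>). \<integral>\<^sup>+u. ennreal ((G n (U n \<omega>) u)\<^sup>2) \<partial>PVZ) \<longlongrightarrow> 0) (wpa1 M)"
  shows "((\<lambda>(n, \<omega>). sqrt (real n) * (avg n (G n (U n \<omega>)) (sample S n \<omega>) - (\<integral>u. G n (U n \<omega>) u \<partial>PVZ))) \<longlongrightarrow> 0) (wpa1 M)"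
  unfolding tendsto_wpa1_real_iff
proof safe
  fix \<epsilon> :: real assume \<epsilon>: "\<epsilon> > 0"
  let ?E = "\<lambda>n. {\<omega> \<in> space M. \<not> \<bar>case (n, \<omega>) of (n, \<omega>) \<Rightarrow> sqrt (real n) *
      (avg n (G n (U n \<omega>)) (sample S n \<omega>) - (\<integral>u. G n (U n \<omega>) u \<partial>PVZ))\<bar> \<le> \<epsilon>}"
  show "eventually (\<lambda>x. \<bar>case x of (n, \<omega>) \<Rightarrow> sqrt (real n) *
      (avg n (G n (U n \<omega>)) (sample S n \<omega>) - (\<integral>u. G n (U n \<omega>) u \<partial>PVZ))\<bar> \<le> \<epsilon>) (wpa1 M)"
    unfolding eventually_wpa1
  proof (rule order_tendstoI)
    fix b :: ennreal assume b: "0 < b"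
    obtain b' where b': "b' > 0" "ennreal b' < b" using ennreal_dense_above_0[OF b] by blast
    \<comment> \<open>Chosen so that Chebyshev's bound is exactly b' / 2; the other half is spent on
      the event where the conditional moment is large.\<close>
    define \<delta> where "\<delta> = b' / 2 * \<epsilon>\<^sup>2"
    have \<delta>: "\<delta> > 0" using b' \<epsilon> by (simp add: \<delta>_def)
    let ?B = "\<lambda>n. {\<omega> \<in> space M. \<not> (\<integral>\<^sup>+u. ennreal ((G n (U n \<omega>) u)\<^sup>2) \<partial>PVZ) \<le> ennreal \<delta>}"
    have "eventually (\<lambda>(n, \<omega>). (\<integral>\<^sup>+u. ennreal ((G n (U n \<omega>) u)\<^sup>2) \<partial>PVZ) \<le> ennreal \<delta>) (wpa1 M)"
      using order_tendstoD(2)[OF small, of "ennreal \<delta>"] \<delta> by (auto elim!: eventually_mono)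
    from eventually_wpa1_D[OF this] have "(\<lambda>n. outer_measure_of M (?B n)) \<longlonglongrightarrow> 0"
      by simp
    then have "eventually (\<lambda>n. outer_measure_of M (?B n) < ennreal (b' / 2)) sequentially"
      using b' by (intro order_tendstoD(2)) auto
    then show "eventually (\<lambda>n. outer_measure_of M (?E n) < b) sequentially"
      using eventually_gt_at_top[of 0]
    proof eventually_elim
      case (elim n)
      have "?E n \<subseteq> {\<omega> \<in> space M. sqrt (real n) * \<epsilon> < \<bar>\<Sum>i<n. G n (U n \<omega>) (S i \<omega>) - (\<integral>u. G n (U n \<omega>) u \<partial>PVZ)\<bar>}"
      proof (clarsimp simp: not_le avg_sample sum_centered[OF elim(2)] abs_mult)
        fix \<omega> assume lt: "\<epsilon> < sqrt (real n) * \<bar>(\<Sum>i<n. G n (U n \<omega>) (S i \<omega>)) / real n - (\<integral>u. G n (U n \<omega>) u \<partial>PVZ)\<bar>"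
        have "sqrt (real n) * \<epsilon> < sqrt (real n) * (sqrt (real n) * \<bar>(\<Sum>i<n. G n (U n \<omega>) (S i \<omega>)) / real n - (\<integral>u. G n (U n \<omega>) u \<partial>PVZ)\<bar>)"
          using lt elim(2) by (intro mult_strict_left_mono) auto
        then show "sqrt (real n) * \<epsilon> < real n * \<bar>(\<Sum>i<n. G n (U n \<omega>) (S i \<omega>)) / real n - (\<integral>u. G n (U n \<omega>) u \<partial>PVZ)\<bar>"
          by (simp flip: mult.assoc)
      qed
      then have "outer_measure_of M (?E n) \<le> ennreal (real n * \<delta> / (sqrt (real n) * \<epsilon>)\<^sup>2) + outer_measure_of M (?B n)"
        by (rule order_trans[OF outer_measure_of_mono chebyshev_S[OF G[of n]]]) (use elim \<epsilon> \<delta> in simp_all)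
      also have "real n * \<delta> / (sqrt (real n) * \<epsilon>)\<^sup>2 = b' / 2"
        using elim(2) \<epsilon> by (simp add: \<delta>_def power_mult_distrib)
      also have "ennreal (b' / 2) + outer_measure_of M (?B n) < ennreal (b' / 2) + ennreal (b' / 2)"
        using elim by (simp add: ennreal_add_left_cancel_less)
      also have "\<dots> < b"
        using b' by (simp flip: ennreal_plus)
      finally show ?case .
    qed
  qed simp
qed

text \<open>Without the scaling, Chebyshev's bound carries a factor 1 / n, so conditional second
  moments only have to stay bounded.\<close>

lemma weak_law_S'':
  assumes G: "\<And>n. (\<lambda>(s, u). G n s u) \<in> borel_measurable (Pn n \<Otimes>\<^sub>M PVZ)"
    and bdd: "eventually (\<lambda>(n, \<omega>). (\<integral>\<^sup>+u. ennreal ((G n (sample S' n \<omega>) u)\<^sup>2) \<partial>PVZ) \<le> ennreal C) (wpa1 M)"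
  shows "((\<lambda>(n, \<omega>). avg n (G n (sample S' n \<omega>)) (sample S'' n \<omega>) - (\<integral>u. G n (sample S' n \<omega>) u \<partial>PVZ)) \<longlongrightarrow> 0) (wpa1 M)"
  unfolding tendsto_wpa1_real_iff
proof safe
  fix \<epsilon> :: real assume \<epsilon>: "\<epsilon> > 0"
  \<comment> \<open>C is an arbitrary real, whereas Chebyshev's bound takes a nonnegative one;
    \<open>ennreal\<close> does not distinguish the two.\<close>
  define D where "D = max C 0"
  have CD: "ennreal C = ennreal D" by (simp add: D_def ennreal_eq_0_iff max_def ennreal_neg)
  let ?E = "\<lambda>n. {\<omega> \<in> space M. \<not> \<bar>case (n, \<omega>) of (n, \<omega>) \<Rightarrow>
      avg n (G n (sample S' n \<omega>)) (sample S'' n \<omega>) - (\<integral>u. G n (sample S' n \<omega>) u \<partial>PVZ)\<bar> \<le> \<epsilon>}"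
  let ?B = "\<lambda>n. {\<omega> \<in> space M. \<not> (\<integral>\<^sup>+u. ennreal ((G n (sample S' n \<omega>) u)\<^sup>2) \<partial>PVZ) \<le> ennreal D}"
  have B: "(\<lambda>n. outer_measure_of M (?B n)) \<longlonglongrightarrow> 0"
    using eventually_wpa1_D[OF bdd] by (simp add: CD)
  have "(\<lambda>n. D / \<epsilon>\<^sup>2 * (1 / real n)) \<longlonglongrightarrow> D / \<epsilon>\<^sup>2 * 0"
    by (intro tendsto_mult tendsto_const lim_1_over_n)
  then have "(\<lambda>n. ennreal (D / \<epsilon>\<^sup>2 * (1 / real n))) \<longlonglongrightarrow> ennreal (D / \<epsilon>\<^sup>2 * 0)"
    by (rule tendsto_ennrealI)
  then have lim: "(\<lambda>n. ennreal (D / \<epsilon>\<^sup>2 * (1 / real n)) + outer_measure_of M (?B n)) \<longlonglongrightarrow> 0"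
    using tendsto_add[OF _ B] by fastforce
  have "eventually (\<lambda>n. outer_measure_of M (?E n) \<le> ennreal (D / \<epsilon>\<^sup>2 * (1 / real n)) + outer_measure_of M (?B n)) sequentially"
    using eventually_gt_at_top[of 0]
  proof eventually_elim
    case (elim n)
    have "?E n \<subseteq> {\<omega> \<in> space M. real n * \<epsilon> < \<bar>\<Sum>i<n. G n (sample S' n \<omega>) (S'' i \<omega>) - (\<integral>u. G n (sample S' n \<omega>) u \<partial>PVZ)\<bar>}"
      using elim by (auto simp: not_le avg_sample sum_centered[OF elim] abs_mult)
    then have "outer_measure_of M (?E n) \<le> ennreal (real n * D / (real n * \<epsilon>)\<^sup>2) + outer_measure_of M (?B n)"
      by (rule order_trans[OF outer_measure_of_mono chebyshev_S''[OF G[of n]]]) (use elim \<epsilon> in \<open>simp_all add: D_def\<close>)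
    also have "real n * D / (real n * \<epsilon>)\<^sup>2 = D / \<epsilon>\<^sup>2 * (1 / real n)"
      using elim \<epsilon> by (simp add: power2_eq_square field_simps)
    finally show ?case .
  qed
  then show "eventually (\<lambda>x. \<bar>case x of (n, \<omega>) \<Rightarrow>
      avg n (G n (sample S' n \<omega>)) (sample S'' n \<omega>) - (\<integral>u. G n (sample S' n \<omega>) u \<partial>PVZ)\<bar> \<le> \<epsilon>) (wpa1 M)"
    unfolding eventually_wpa1 by (intro tendsto_sandwich[OF _ _ tendsto_const lim]) auto
qed

section \<open>Integrable sections at the sample points\<close>

lemma sqn_measurable:
  assumes D: "(\<lambda>(s, w). D s w) \<in> borel_measurable (A \<Otimes>\<^sub>M P)"
  shows "(\<lambda>s. sqn (D s)) \<in> borel_measurable A"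
proof -
  have *: "(\<lambda>(s, w). ennreal ((D s w)\<^sup>2)) \<in> borel_measurable (A \<Otimes>\<^sub>M P)"
    using D by (simp add: case_prod_beta')
  moreover have "borel_measurable (A \<Otimes>\<^sub>M P2) = borel_measurable (A \<Otimes>\<^sub>M P)"
    by (intro measurable_cong_sets sets_pair_measure_cong refl sets_P2)
  ultimately show ?thesis
    unfolding sqn_def by (intro borel_measurable_add P.borel_measurable_nn_integral P2.borel_measurable_nn_integral) auto
qed

text \<open>A section is integrable iff the integral of its absolute value is finite, and that
  integral depends measurably on the parameter by Tonelli's theorem.\<close>

lemma section_integrable_meas:
  assumes D: "(\<lambda>(s, w). D s w) \<in> borel_measurable (A \<Otimes>\<^sub>M P)"
  shows "{p \<in> space (A \<Otimes>\<^sub>M PVZ). section_integrable (D (fst p)) (fst (snd p))} \<in> sets (A \<Otimes>\<^sub>M PVZ)"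
proof -
  let ?N = "A \<Otimes>\<^sub>M PVZ"
  have "fst \<in> PVZ \<rightarrow>\<^sub>M MV"
    by (subst measurable_cong_sets[OF PVZ(2) refl]) simp
  then have "(\<lambda>p. fst (snd p)) \<in> ?N \<rightarrow>\<^sub>M MV"
    by (rule measurable_compose[OF measurable_snd])
  then have m: "(\<lambda>(p, x). D (fst p) (fst (snd p), x)) \<in> borel_measurable (?N \<Otimes>\<^sub>M Qb)"
    by (intro measurable_section[OF D] measurable_fst)
  then have "(\<lambda>(p, x). ennreal (norm (D (fst p) (fst (snd p), x)))) \<in> borel_measurable (?N \<Otimes>\<^sub>M Qb)"
    by (simp add: case_prod_beta')
  then have "(\<lambda>p. \<integral>\<^sup>+x. ennreal (norm (D (fst p) (fst (snd p), x))) \<partial>Qb) \<in> borel_measurable ?N"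
    by (rule Qb.borel_measurable_nn_integral)
  then have "{p \<in> space ?N. (\<integral>\<^sup>+x. ennreal (norm (D (fst p) (fst (snd p), x))) \<partial>Qb) < \<infinity>} \<in> sets ?N"
    by measurable
  moreover have "section_integrable (D (fst p)) (fst (snd p)) \<longleftrightarrow>
      (\<integral>\<^sup>+x. ennreal (norm (D (fst p) (fst (snd p), x))) \<partial>Qb) < \<infinity>" if "p \<in> space ?N" for p
    using measurable_Pair2[OF m that] by (simp add: section_integrable_def integrable_iff_bounded)
  ultimately show ?thesis by (metis (no_types, lifting) Collect_cong)
qed

text \<open>Bad sections form a null set for each frozen parameter, but the parameter is random.
  Chebyshev's inequality conditionally on it, applied to the indicator of bad points, handles this:
  the conditional second moment is 0, so \<delta> = 0 is allowed, and a sum of indicators not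
  exceeding 1/2 has no summand equal to 1.\<close>

lemma eventually_section_integrable:
  assumes D: "\<And>n. (\<lambda>(s, w). D n s w) \<in> borel_measurable ((Pn n \<Otimes>\<^sub>M Pn n) \<Otimes>\<^sub>M P)"
    and fin: "eventually (\<lambda>(n, \<omega>). sqn (D n (U n \<omega>)) < \<infinity>) (wpa1 M)"
  shows "eventually (\<lambda>(n, \<omega>). \<forall>i<n. section_integrable (D n (U n \<omega>)) (fst (S i \<omega>))) (wpa1 M)"
proof -
  let ?A = "\<lambda>n. Pn n \<Otimes>\<^sub>M Pn n"
  \<comment> \<open>The condition on \<open>sqn\<close> makes G vanish almost everywhere for every
    parameter, also for those with infinite norm; the latter are excluded at the end through
    \<open>fin\<close>.\<close>
  define G where "G n s u = (if sqn (D n s) < \<infinity> \<and> \<not> section_integrable (D n s) (fst u) then 1 else 0 :: real)"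
    for n s and u :: "'a \<times> 'b"
  have "(\<lambda>(s, u). G n s u) \<in> borel_measurable (?A n \<Otimes>\<^sub>M PVZ)" for n
  proof -
    have "{p \<in> space (?A n \<Otimes>\<^sub>M PVZ). sqn (D n (fst p)) < \<infinity>} \<in> sets (?A n \<Otimes>\<^sub>M PVZ)"
      using measurable_compose[OF measurable_fst sqn_measurable[OF D[of n]]] by measurable
    moreover note section_integrable_meas[OF D[of n]]
    ultimately show ?thesis
      unfolding G_def case_prod_beta' by (intro measurable_If measurable_const) (auto intro!: sets.sets_Collect)
  qed
  note cheb = chebyshev_S[OF this, of "1 / 2" 0]
  have G0: "(\<integral>\<^sup>+u. ennreal ((G n s u)\<^sup>2) \<partial>PVZ) = 0 \<and> (\<integral>u. G n s u \<partial>PVZ) = 0" if s: "s \<in> space (?A n)" for n s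
  proof -
    have "D n s \<in> borel_measurable P" using measurable_Pair2[OF D[of n] s] by simp
    then have z: "AE u in PVZ. G n s u = 0"
      using section_integrable_AE[of "D n s"] by (cases "sqn (D n s) < \<infinity>") (auto simp: G_def elim!: eventually_mono)
    then have "AE u in PVZ. ennreal ((G n s u)\<^sup>2) = 0"
      by eventually_elim simp
    moreover have "(\<integral>u. G n s u \<partial>PVZ) = 0"
      by (rule integral_eq_zero_AE[OF z])
    ultimately show ?thesis
      using nn_integral_cong_AE[of "\<lambda>u. ennreal ((G n s u)\<^sup>2)" "\<lambda>_. 0" PVZ] by simp
  qed
  have Usp: "\<omega> \<in> space M \<Longrightarrow> U n \<omega> \<in> space (?A n)" for n \<omega>
    by (rule measurable_space[OF U_meas])
  have "outer_measure_of M {\<omega> \<in> space M. 1 / 2 < \<bar>\<Sum>i<n. G n (U n \<omega>) (S i \<omega>)\<bar>} = 0" for n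
  proof -
    have e1: "{\<omega> \<in> space M. \<not> (\<integral>\<^sup>+u. ennreal ((G n (U n \<omega>) u)\<^sup>2) \<partial>PVZ) \<le> ennreal 0} = {}"
      using G0[OF Usp, THEN conjunct1] by auto
    have e2: "{\<omega> \<in> space M. 1 / 2 < \<bar>\<Sum>i<n. G n (U n \<omega>) (S i \<omega>) - (\<integral>u. G n (U n \<omega>) u \<partial>PVZ)\<bar>} =
        {\<omega> \<in> space M. 1 / 2 < \<bar>\<Sum>i<n. G n (U n \<omega>) (S i \<omega>)\<bar>}"
      using G0[OF Usp, THEN conjunct2] by auto
    show ?thesis using cheb[of n] unfolding e1 e2 by simp
  qed
  then have "eventually (\<lambda>(n, \<omega>). \<not> 1 / 2 < \<bar>\<Sum>i<n. G n (U n \<omega>) (S i \<omega>)\<bar>) (wpa1 M)"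
    by (simp add: eventually_wpa1)
  then show ?thesis
    using fin
  proof eventually_elim
    case (elim x)
    obtain n \<omega> where x: "x = (n, \<omega>)" by (cases x)
    have nonneg: "0 \<le> G n (U n \<omega>) (S i \<omega>)" for i by (simp add: G_def)
    show ?case
      unfolding x case_prod_conv
    proof (intro allI impI, rule ccontr)
      fix i assume i: "i < n" and "\<not> section_integrable (D n (U n \<omega>)) (fst (S i \<omega>))"
      then have "1 = G n (U n \<omega>) (S i \<omega>)" using elim by (simp add: x G_def)
      also have "\<dots> \<le> (\<Sum>i<n. G n (U n \<omega>) (S i \<omega>))"
        by (rule member_le_sum) (use i nonneg in auto)
      finally show False using elim by (simp add: x)
    qed
  qed
qed

text \<open>The initial estimate k is subtracted inside the operator and added outside, so it
  cancels whatever its dependence on the samples, and measurability is all that is asked of it. The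
  function D may have a nonzero mean under P, which is split off as the bias so that only a centred
  average is left to Chebyshev's inequality.\<close>

lemma one_step_expansion:
  fixes h0 :: "'a \<times> 'b \<Rightarrow> real"
  assumes h0: "h0 \<in> borel_measurable P" "sqn h0 < \<infinity>" "(\<integral>w. h0 w \<partial>P) = 0"
    and D: "\<And>n. (\<lambda>(s, w). D n s w) \<in> borel_measurable ((Pn n \<Otimes>\<^sub>M Pn n) \<Otimes>\<^sub>M P)"
    and k: "\<And>n. k n \<in> borel_measurable M"
    and small: "((\<lambda>(n, \<omega>). sqn (D n (U n \<omega>))) \<longlongrightarrow> 0) (wpa1 M)"
    and bias: "((\<lambda>(n, \<omega>). sqrt (real n) * (\<integral>w. D n (U n \<omega>) w \<partial>P)) \<longlongrightarrow> 0) (wpa1 M)"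
  shows "weak_conv_m (\<lambda>n. distr M borel (\<lambda>\<omega>. sqrt (real n) *
      (k n \<omega> + avg n (T (\<lambda>w. D n (U n \<omega>) w + h0 w - k n \<omega>)) (sample S n \<omega>))))
    (centered_normal (\<integral>u. (T h0 u)\<^sup>2 \<partial>PVZ))"
proof (rule M.slutsky)
  have Th0: "T h0 \<in> borel_measurable PVZ" by (rule T_measurable1[OF h0(1)])
  show clt: "weak_conv_m (\<lambda>n. distr M borel (\<lambda>\<omega>. sqrt (real n) * avg n (T h0) (sample S n \<omega>)))
      (centered_normal (\<integral>u. (T h0 u)\<^sup>2 \<partial>PVZ))"
    using T_mean[OF h0(1,2)] h0(3)
    by (intro M.clt_avg[OF indep_S sample_law(1) Th0 T_square_integrable[OF h0(1,2)]]) simp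
  show "real_distribution (centered_normal (\<integral>u. (T h0 u)\<^sup>2 \<partial>PVZ))"
    by (rule real_distribution_centered_normal)
  show "(\<lambda>\<omega>. sqrt (real n) * avg n (T h0) (sample S n \<omega>)) \<in> borel_measurable M" for n
    unfolding avg_sample using Th0 by measurable
  show "(\<lambda>\<omega>. sqrt (real n) * (k n \<omega> + avg n (T (\<lambda>w. D n (U n \<omega>) w + h0 w - k n \<omega>)) (sample S n \<omega>))) \<in> borel_measurable M" for n
  proof -
    \<comment> \<open>Since k depends on \<omega> itself and not only on the auxiliary samples, M is
      the parameter space here.\<close>
    have U': "(\<lambda>p. (U n (fst p), snd p)) \<in> M \<Otimes>\<^sub>M P \<rightarrow>\<^sub>M (Pn n \<Otimes>\<^sub>M Pn n) \<Otimes>\<^sub>M P"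
      using U_meas by measurable
    have "(\<lambda>p. D n (U n (fst p)) (snd p)) \<in> borel_measurable (M \<Otimes>\<^sub>M P)"
      using measurable_compose[OF U' D[of n]] by simp
    then have "(\<lambda>(\<omega>, w). D n (U n \<omega>) w + h0 w - k n \<omega>) \<in> borel_measurable (M \<Otimes>\<^sub>M P)"
      using h0(1) k by (simp add: case_prod_beta')
    from T_measurable[OF this]
    have TH: "(\<lambda>(\<omega>, u). T (\<lambda>w. D n (U n \<omega>) w + h0 w - k n \<omega>) u) \<in> borel_measurable (M \<Otimes>\<^sub>M PVZ)" .
    have "(\<lambda>\<omega>. T (\<lambda>w. D n (U n \<omega>) w + h0 w - k n \<omega>) (S i \<omega>)) \<in> borel_measurable M" for i
    proof -
      have "(\<lambda>\<omega>. (\<omega>, S i \<omega>)) \<in> M \<rightarrow>\<^sub>M M \<Otimes>\<^sub>M PVZ" by measurable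
      from measurable_compose[OF this TH] show ?thesis by simp
    qed
    then show ?thesis unfolding avg_sample using k by measurable
  qed
  have TD: "(\<lambda>(s, u). T (D n s) u) \<in> borel_measurable ((Pn n \<Otimes>\<^sub>M Pn n) \<Otimes>\<^sub>M PVZ)" for n
    by (rule T_measurable[OF D])
  have Dm: "D n (U n \<omega>) \<in> borel_measurable P" if "\<omega> \<in> space M" for n \<omega>
    using measurable_Pair2[OF D[of n] measurable_space[OF U_meas that]] by simp
  define C where "C = 2 * a\<^sup>2 + 2 * B\<^sup>2"
  have T2: "((\<lambda>(n, \<omega>). \<integral>\<^sup>+u. ennreal ((T (D n (U n \<omega>)) u)\<^sup>2) \<partial>PVZ) \<longlongrightarrow> 0) (wpa1 M)"
  proof (rule tendsto_sandwich[OF _ _ tendsto_const])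
    have "((\<lambda>x. ennreal C * (case x of (n, \<omega>) \<Rightarrow> sqn (D n (U n \<omega>)))) \<longlongrightarrow> ennreal C * 0) (wpa1 M)"
      by (intro tendsto_mult_ennreal tendsto_const small) auto
    then show "((\<lambda>(n, \<omega>). ennreal C * sqn (D n (U n \<omega>))) \<longlongrightarrow> 0) (wpa1 M)"
      by (simp add: case_prod_beta')
    show "eventually (\<lambda>x. (case x of (n, \<omega>) \<Rightarrow> \<integral>\<^sup>+u. ennreal ((T (D n (U n \<omega>)) u)\<^sup>2) \<partial>PVZ) \<le>
        (case x of (n, \<omega>) \<Rightarrow> ennreal C * sqn (D n (U n \<omega>)))) (wpa1 M)"
      using eventually_wpa1_space by eventually_elim (auto intro!: T_bound[folded C_def] Dm)
  qed simp
  have fin: "eventually (\<lambda>(n, \<omega>). sqn (D n (U n \<omega>)) < \<infinity>) (wpa1 M)"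
    using order_tendstoD(2)[OF small, of \<infinity>] by (auto elim!: eventually_mono)
  have sech0: "eventually (\<lambda>(n, \<omega>). \<forall>i<n. section_integrable h0 (fst (S i \<omega>))) (wpa1 M)"
  proof (rule eventually_section_integrable)
    show "(\<lambda>(s, w). h0 w) \<in> borel_measurable ((Pn n \<Otimes>\<^sub>M Pn n) \<Otimes>\<^sub>M P)" for n
      unfolding case_prod_beta' by (rule measurable_compose[OF measurable_snd h0(1)])
    show "eventually (\<lambda>(n, \<omega>). sqn h0 < \<infinity>) (wpa1 M)"
      using h0(2) by (intro always_eventually) auto
  qed
  have "((\<lambda>x. (case x of (n, \<omega>) \<Rightarrow> sqrt (real n) * (avg n (T (D n (U n \<omega>))) (sample S n \<omega>) - (\<integral>u. T (D n (U n \<omega>)) u \<partial>PVZ)))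
      + (case x of (n, \<omega>) \<Rightarrow> sqrt (real n) * (\<integral>w. D n (U n \<omega>) w \<partial>P))) \<longlongrightarrow> 0 + 0) (wpa1 M)"
    by (intro tendsto_add empirical_process_tendsto_0[OF TD T2] bias)
  moreover have "eventually (\<lambda>x. (case x of (n, \<omega>) \<Rightarrow> sqrt (real n) * (avg n (T (D n (U n \<omega>))) (sample S n \<omega>) - (\<integral>u. T (D n (U n \<omega>)) u \<partial>PVZ)))
      + (case x of (n, \<omega>) \<Rightarrow> sqrt (real n) * (\<integral>w. D n (U n \<omega>) w \<partial>P)) =
      (case x of (n, \<omega>) \<Rightarrow> sqrt (real n) * (k n \<omega> + avg n (T (\<lambda>w. D n (U n \<omega>) w + h0 w - k n \<omega>)) (sample S n \<omega>)) -
        sqrt (real n) * avg n (T h0) (sample S n \<omega>))) (wpa1 M)"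
    using eventually_wpa1_space fin sech0 eventually_section_integrable[OF D fin]
      eventually_wpa1_sequentially[OF eventually_gt_at_top[of 0], of M]
  proof eventually_elim
    case (elim x)
    obtain n \<omega> where x: "x = (n, \<omega>)" by (cases x)
    note e = elim[unfolded x case_prod_conv]
    \<comment> \<open>Additivity is invoked only at the sample points, whose sections are integrable
      on the present event.\<close>
    have "T (\<lambda>w. D n (U n \<omega>) w + h0 w - k n \<omega>) (S i \<omega>) = T (D n (U n \<omega>)) (S i \<omega>) + T h0 (S i \<omega>) - k n \<omega>"
      if "i < n" for i
    proof -
      have sp: "S i \<omega> \<in> space PVZ" using e(1) samples_meas(1) by (rule measurable_space[rotated])
      have s1: "section_integrable (D n (U n \<omega>)) (fst (S i \<omega>))" "section_integrable h0 (fst (S i \<omega>))"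
        using e that by auto
      then have s2: "section_integrable (\<lambda>w. D n (U n \<omega>) w + h0 w) (fst (S i \<omega>))"
        by (simp add: section_integrable_def)
      have s3: "section_integrable (\<lambda>w. - k n \<omega>) (fst (S i \<omega>))"
        by (simp add: section_integrable_def)
      show ?thesis
        using T_add[OF sp s2 s3] T_add[OF sp s1] by (simp add: T_const)
    qed
    \<comment> \<open>Here n > 0 matters: the average of a constant over an empty sample is
      0.\<close>
    then have avg: "avg n (T (\<lambda>w. D n (U n \<omega>) w + h0 w - k n \<omega>)) (sample S n \<omega>) =
        avg n (T (D n (U n \<omega>))) (sample S n \<omega>) + avg n (T h0) (sample S n \<omega>) - k n \<omega>"
      using e(5) by (simp add: avg_sample sum.distrib sum_subtractf add_divide_distrib diff_divide_distrib)
    show ?case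
      unfolding x case_prod_conv avg T_mean[OF Dm[OF e(1)] e(2)] by (simp add: algebra_simps)
  qed
  ultimately show "((\<lambda>(n, \<omega>). sqrt (real n) * (k n \<omega> + avg n (T (\<lambda>w. D n (U n \<omega>) w + h0 w - k n \<omega>)) (sample S n \<omega>)) -
      sqrt (real n) * avg n (T h0) (sample S n \<omega>)) \<longlongrightarrow> 0) (wpa1 M)"
    using filterlim_cong[OF refl refl] by fastforce
qed

end

section \<open>Estimated nuisance parameters\<close>

lemma square_integrable_product:
  fixes h k :: "'z \<Rightarrow> real"
  assumes "h \<in> borel_measurable R" "k \<in> borel_measurable R"
    "integrable R (\<lambda>w. (h w)\<^sup>2)" "integrable R (\<lambda>w. (k w)\<^sup>2)"
  shows "integrable R (\<lambda>w. h w * k w)"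
proof (rule Bochner_Integration.integrable_bound[of _ "\<lambda>w. (h w)\<^sup>2 + (k w)\<^sup>2"])
  have "\<bar>h w * k w\<bar> \<le> (h w)\<^sup>2 + (k w)\<^sup>2" for w
  proof -
    have "2 * \<bar>h w\<bar> * \<bar>k w\<bar> \<le> \<bar>h w\<bar>\<^sup>2 + \<bar>k w\<bar>\<^sup>2" by (rule sum_squares_bound)
    moreover have "0 \<le> \<bar>h w\<bar> * \<bar>k w\<bar>" by simp
    ultimately show ?thesis unfolding abs_mult power2_abs by linarith
  qed
  then show "AE w in R. norm (h w * k w) \<le> norm ((h w)\<^sup>2 + (k w)\<^sup>2)" by simp
qed (use assms in auto)

text \<open>The parameter \<open>\<mu>\<close> is abstracted to an index \<open>\<theta>\<close> with associated function \<open>ev \<theta>\<close>, and \<open>ic\<close> is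
  the indicator of \<open>V\<^sub>2 = c\<close>.\<close>

locale nuisance_estimates = split_samples +
  fixes \<Theta> :: "'p set" and ev :: "'p \<Rightarrow> 'a \<times> 'b \<Rightarrow> real" and \<Gamma> :: "real set"
    and f f' f'' :: "'a \<times> 'b \<Rightarrow> 'p \<Rightarrow> real \<Rightarrow> real"
    and m g ic r :: "'a \<times> 'b \<Rightarrow> real" and \<theta>0 :: 'p and \<gamma>c pc e :: real
    and rn :: "nat \<Rightarrow> (nat \<Rightarrow> 'a \<times> 'b) \<Rightarrow> 'a \<times> 'b \<Rightarrow> real" and \<theta>n :: "nat \<Rightarrow> (nat \<Rightarrow> 'a \<times> 'b) \<Rightarrow> 'p"
    and \<gamma>n pn :: "nat \<Rightarrow> (nat \<Rightarrow> 'a \<times> 'b) \<Rightarrow> real"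
begin

text \<open>A pair s holds both auxiliary samples: the nuisance values come from
  \<open>fst s\<close>, and the average runs over the independent \<open>snd s\<close>.\<close>

definition en where "en n s = avg n (T (\<lambda>w. f' w (\<theta>n n (fst s)) (\<gamma>n n (fst s)))) (snd s)"

definition h0 where "h0 w = r w * (m w - ev \<theta>0 w) + ic w / pc * (g w - \<gamma>c) * e + f w \<theta>0 \<gamma>c"

definition hn where
  "hn n s w = rn n (fst s) w * (m w - ev (\<theta>n n (fst s)) w)
     + ic w / pn n (fst s) * (g w - \<gamma>n n (fst s)) * en n s + f w (\<theta>n n (fst s)) (\<gamma>n n (fst s))"

abbreviation "S1 x \<equiv> sample S' (fst x) (snd x)"
abbreviation "UU x \<equiv> U (fst x) (snd x)"
abbreviation "th x \<equiv> \<theta>n (fst x) (S1 x)"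
abbreviation "ga x \<equiv> \<gamma>n (fst x) (S1 x)"
abbreviation "pp x \<equiv> pn (fst x) (S1 x)"
abbreviation "rr x \<equiv> rn (fst x) (S1 x)"
abbreviation "ee x \<equiv> en (fst x) (UU x)"
abbreviation "sqrtn x \<equiv> sqrt (real (fst x))"

definition resid where "resid x w = rr x w * (m w - ev (th x) w) - r w * (m w - ev \<theta>0 w)"
definition gpart where "gpart x w = ic w / pp x * (g w - ga x) * ee x - ic w / pc * (g w - \<gamma>c) * e"
definition fpart where "fpart x w = f w (th x) (ga x) - f w \<theta>0 \<gamma>c"

lemma hn_minus_h0: "hn (fst x) (UU x) w - h0 w = resid x w + gpart x w + fpart x w"
  by (simp add: hn_def h0_def resid_def gpart_def fpart_def U_def)

end

text \<open>The alternative in \<open>f'0_sqn\<close> covers a degenerate interval: within a single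
  point every number is a derivative, so f gives no norm bound on f', but the differences
  multiplying \<open>ee\<close> then vanish. The range condition on \<open>ga\<close> is only
  eventual because the ratio defining this estimate is meaningless when the estimated probability is
  0.\<close>

locale consistent_nuisance = nuisance_estimates +
  assumes base_meas: "m \<in> borel_measurable P" "g \<in> borel_measurable P" "ic \<in> borel_measurable P" "r \<in> borel_measurable P"
    and ev_meas: "\<And>\<theta>. \<theta> \<in> \<Theta> \<Longrightarrow> ev \<theta> \<in> borel_measurable P"
    and f_meas: "\<And>\<theta> \<gamma>. \<theta> \<in> \<Theta> \<Longrightarrow> \<gamma> \<in> \<Gamma> \<Longrightarrow> (\<lambda>w. f w \<theta> \<gamma>) \<in> borel_measurable P"
      "\<And>\<theta> \<gamma>. \<theta> \<in> \<Theta> \<Longrightarrow> \<gamma> \<in> \<Gamma> \<Longrightarrow> (\<lambda>w. f' w \<theta> \<gamma>) \<in> borel_measurable P"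
    and ic01: "\<And>w. w \<in> space P \<Longrightarrow> ic w = 0 \<or> ic w = 1"
    and pc: "(\<integral>w. ic w \<partial>P) = pc" "pc > 0"
    and g_mean: "integrable P (\<lambda>w. ic w * g w)" "(\<integral>w. ic w * g w \<partial>P) = pc * \<gamma>c"
    and \<Gamma>: "is_interval \<Gamma>" "\<gamma>c \<in> \<Gamma>" "\<And>w. w \<in> space P \<Longrightarrow> g w \<in> \<Gamma>"
    and \<theta>0: "\<theta>0 \<in> \<Theta>" and \<theta>n: "\<And>n s. s \<in> space (Pn n) \<Longrightarrow> \<theta>n n s \<in> \<Theta>"
    and f_int: "\<And>\<theta> \<gamma>. \<theta> \<in> \<Theta> \<Longrightarrow> \<gamma> \<in> \<Gamma> \<Longrightarrow> integrable P (\<lambda>w. f w \<theta> \<gamma>)"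
    and f_smooth: "\<And>\<theta>. \<theta> \<in> \<Theta> \<Longrightarrow> AE w in P. C2_in_gamma \<Gamma> (f w \<theta>) (f' w \<theta>) (f'' w \<theta>)"
    and f'0_sqn: "sqn (\<lambda>w. f' w \<theta>0 \<gamma>c) < \<infinity> \<or> \<Gamma> = {\<gamma>c}"
    and f'0_int: "integrable P (\<lambda>w. f' w \<theta>0 \<gamma>c)" "(\<integral>w. f' w \<theta>0 \<gamma>c \<partial>P) = e"
    and riesz: "\<And>\<theta>. \<theta> \<in> \<Theta> \<Longrightarrow> (\<integral>w. f w \<theta> \<gamma>c \<partial>P) = (\<integral>w. r w * ev \<theta> w \<partial>P)"
    and ev_sq: "\<And>\<theta>. \<theta> \<in> \<Theta> \<Longrightarrow> integrable P (\<lambda>w. (ev \<theta> w)\<^sup>2)"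
    and r_sq: "integrable P (\<lambda>w. (r w)\<^sup>2)"
    and rn_sq: "\<And>n s. s \<in> space (Pn n) \<Longrightarrow> integrable P (\<lambda>w. (rn n s w)\<^sup>2)"
    and res_sq: "integrable P (\<lambda>w. (m w - ev \<theta>0 w)\<^sup>2)"
    and orth: "(\<integral>w. r w * (m w - ev \<theta>0 w) \<partial>P) = 0"
      "\<And>n s. s \<in> space (Pn n) \<Longrightarrow> (\<integral>w. rn n s w * (m w - ev \<theta>0 w) \<partial>P) = 0"
    and est_meas: "\<And>n. (\<lambda>(s, w). rn n s w) \<in> borel_measurable (Pn n \<Otimes>\<^sub>M P)"
      "\<And>n. (\<lambda>(s, w). ev (\<theta>n n s) w) \<in> borel_measurable (Pn n \<Otimes>\<^sub>M P)"
      "\<And>n. (\<lambda>(s, w). f w (\<theta>n n s) (\<gamma>n n s)) \<in> borel_measurable (Pn n \<Otimes>\<^sub>M P)"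
      "\<And>n. (\<lambda>(s, w). f' w (\<theta>n n s) (\<gamma>n n s)) \<in> borel_measurable (Pn n \<Otimes>\<^sub>M P)"
      "\<And>n. \<gamma>n n \<in> borel_measurable (Pn n)" "\<And>n. pn n \<in> borel_measurable (Pn n)"
    and finite: "sqn h0 < \<infinity>" "eventually (\<lambda>x. sqn (hn (fst x) (UU x)) < \<infinity>) (wpa1 M)"
    and f_consistent: "\<And>\<epsilon>. \<epsilon> > 0 \<Longrightarrow> \<exists>\<delta>>0. \<forall>\<theta>\<in>\<Theta>. \<forall>\<gamma>\<in>\<Gamma>.
      sqn (\<lambda>w. ev \<theta> w - ev \<theta>0 w) \<le> ennreal \<delta> \<longrightarrow> \<bar>\<gamma> - \<gamma>c\<bar> \<le> \<delta> \<longrightarrow>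
      sqn (\<lambda>w. f w \<theta> \<gamma> - f w \<theta>0 \<gamma>c) \<le> ennreal \<epsilon> \<and> sqn (\<lambda>w. f' w \<theta> \<gamma> - f' w \<theta>0 \<gamma>c) \<le> ennreal \<epsilon>"
    and \<gamma>_range: "eventually (\<lambda>x. ga x \<in> \<Gamma>) (wpa1 M)"
    and \<gamma>_consistent: "((\<lambda>x. ga x - \<gamma>c) \<longlongrightarrow> 0) (wpa1 M)"
    and p_consistent: "((\<lambda>x. pp x - pc) \<longlongrightarrow> 0) (wpa1 M)"
    and \<theta>_consistent: "((\<lambda>x. sqn (\<lambda>w. ev (th x) w - ev \<theta>0 w)) \<longlongrightarrow> 0) (wpa1 M)"
    and resid_consistent: "((\<lambda>x. sqn (resid x)) \<longlongrightarrow> 0) (wpa1 M)"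
    and product_rate: "((\<lambda>x. sqrtn x * (\<integral>w. (ev (th x) w - ev \<theta>0 w) * (rr x w - r w) \<partial>P)) \<longlongrightarrow> 0) (wpa1 M)"
    and \<gamma>_rate: "O_P M (\<lambda>n \<omega>. ennreal \<bar>sqrtn (n, \<omega>) * (ga (n, \<omega>) - \<gamma>c)\<bar>)"
begin

lemma S1_space: "snd x \<in> space M \<Longrightarrow> S1 x \<in> space (Pn (fst x))"
  by (rule measurable_space[OF sample_meas(2)])

lemma th_in: "snd x \<in> space M \<Longrightarrow> th x \<in> \<Theta>"
  by (rule \<theta>n[OF S1_space])

lemma rr_meas: "snd x \<in> space M \<Longrightarrow> rr x \<in> borel_measurable P"
  using measurable_Pair2[OF est_meas(1) S1_space] by simp

lemma resid_meas: "snd x \<in> space M \<Longrightarrow> resid x \<in> borel_measurable P"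
  unfolding resid_def[abs_def]
  by (intro borel_measurable_diff borel_measurable_times rr_meas base_meas ev_meas th_in \<theta>0)

lemma gpart_meas: "gpart x \<in> borel_measurable P"
  unfolding gpart_def[abs_def] using base_meas by measurable

lemma fpart_meas: "snd x \<in> space M \<Longrightarrow> ga x \<in> \<Gamma> \<Longrightarrow> fpart x \<in> borel_measurable P"
  unfolding fpart_def[abs_def] by (intro borel_measurable_diff f_meas th_in \<theta>0 \<Gamma>(2))

lemma eventually_in_M: "eventually (\<lambda>x. snd x \<in> space M) (wpa1 M)"
  using eventually_wpa1_space by (rule eventually_mono) auto

lemma eventually_near:
  assumes "\<delta> > 0"
  shows "eventually (\<lambda>x. sqn (\<lambda>w. ev (th x) w - ev \<theta>0 w) \<le> ennreal \<delta> \<and> \<bar>ga x - \<gamma>c\<bar> \<le> \<delta> \<and> ga x \<in> \<Gamma> \<and> snd x \<in> space M) (wpa1 M)"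
proof -
  have "eventually (\<lambda>x. sqn (\<lambda>w. ev (th x) w - ev \<theta>0 w) < ennreal \<delta>) (wpa1 M)"
    using assms by (intro order_tendstoD(2)[OF \<theta>_consistent]) simp
  moreover have "eventually (\<lambda>x. \<bar>ga x - \<gamma>c\<bar> \<le> \<delta>) (wpa1 M)"
    using \<gamma>_consistent assms by (simp add: tendsto_wpa1_real_iff)
  ultimately show ?thesis
    using \<gamma>_range eventually_in_M by eventually_elim auto
qed

section \<open>Consistency of the three parts of the score\<close>

lemma fpart_tendsto: "((\<lambda>x. sqn (fpart x)) \<longlongrightarrow> 0) (wpa1 M)"
proof (rule tendsto_wpa1_ennrealI)
  fix \<epsilon> :: real assume "\<epsilon> > 0"
  from f_consistent[OF this] obtain \<delta> where \<delta>: "\<delta> > 0"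
    "\<And>\<theta> \<gamma>. \<theta> \<in> \<Theta> \<Longrightarrow> \<gamma> \<in> \<Gamma> \<Longrightarrow> sqn (\<lambda>w. ev \<theta> w - ev \<theta>0 w) \<le> ennreal \<delta> \<Longrightarrow> \<bar>\<gamma> - \<gamma>c\<bar> \<le> \<delta> \<Longrightarrow>
      sqn (\<lambda>w. f w \<theta> \<gamma> - f w \<theta>0 \<gamma>c) \<le> ennreal \<epsilon>" by blast
  show "eventually (\<lambda>x. sqn (fpart x) \<le> ennreal \<epsilon>) (wpa1 M)"
    using eventually_near[OF \<delta>(1)] by eventually_elim (use \<delta>(2) th_in in \<open>auto simp: fpart_def[abs_def]\<close>)
qed

lemma f'_tendsto: "((\<lambda>x. sqn (\<lambda>w. f' w (th x) (ga x) - f' w \<theta>0 \<gamma>c)) \<longlongrightarrow> 0) (wpa1 M)"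
proof (rule tendsto_wpa1_ennrealI)
  fix \<epsilon> :: real assume "\<epsilon> > 0"
  from f_consistent[OF this] obtain \<delta> where \<delta>: "\<delta> > 0"
    "\<And>\<theta> \<gamma>. \<theta> \<in> \<Theta> \<Longrightarrow> \<gamma> \<in> \<Gamma> \<Longrightarrow> sqn (\<lambda>w. ev \<theta> w - ev \<theta>0 w) \<le> ennreal \<delta> \<Longrightarrow> \<bar>\<gamma> - \<gamma>c\<bar> \<le> \<delta> \<Longrightarrow>
      sqn (\<lambda>w. f' w \<theta> \<gamma> - f' w \<theta>0 \<gamma>c) \<le> ennreal \<epsilon>" by blast
  show "eventually (\<lambda>x. sqn (\<lambda>w. f' w (th x) (ga x) - f' w \<theta>0 \<gamma>c) \<le> ennreal \<epsilon>) (wpa1 M)"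
    using eventually_near[OF \<delta>(1)] by eventually_elim (use \<delta>(2) th_in in auto)
qed

lemma pp_pos: "eventually (\<lambda>x. pp x > 0) (wpa1 M)"
proof -
  have "((\<lambda>x. pp x - pc + pc) \<longlongrightarrow> 0 + pc) (wpa1 M)"
    by (intro tendsto_add p_consistent tendsto_const)
  from order_tendstoD(1)[OF this, of 0] pc(2) show ?thesis by simp
qed

lemma pp_tendsto: "(pp \<longlongrightarrow> pc) (wpa1 M)"
  using p_consistent by (simp add: LIM_zero_iff)

lemma ga_tendsto: "(ga \<longlongrightarrow> \<gamma>c) (wpa1 M)"
  using \<gamma>_consistent by (simp add: LIM_zero_iff)

text \<open>The error splits into the fluctuation of the third sample given the second, handled by
  the weak law, and the mean of f' at the estimates minus its mean at the truth, whose square is at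
  most \<open>sqn\<close> of the difference. \<open>T_mean\<close> passes from \<open>PVZ\<close> to
  P.\<close>

lemma ee_tendsto:
  assumes fin: "sqn (\<lambda>w. f' w \<theta>0 \<gamma>c) < \<infinity>"
  shows "(ee \<longlongrightarrow> e) (wpa1 M)"
proof -
  define F where "F x w = f' w (th x) (ga x)" for x w
  define F0 where "F0 w = f' w \<theta>0 \<gamma>c" for w
  have F0: "F0 \<in> borel_measurable P" "sqn F0 < \<infinity>"
    using f_meas(2)[OF \<theta>0 \<Gamma>(2)] fin by (auto simp: F0_def[abs_def])
  obtain K where K: "sqn F0 = ennreal K" "K \<ge> 0" using F0(2) by (cases "sqn F0") auto
  have Fm: "F x \<in> borel_measurable P" if "snd x \<in> space M" "ga x \<in> \<Gamma>" for x
    using f_meas(2)[OF th_in[OF that(1)] that(2)] by (simp add: F_def[abs_def])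
  have diff: "((\<lambda>x. sqn (\<lambda>w. F x w - F0 w)) \<longlongrightarrow> 0) (wpa1 M)"
    using f'_tendsto by (simp add: F_def F0_def)
  define C where "C = 2 * a\<^sup>2 + 2 * B\<^sup>2"
  have C0: "C \<ge> 0" by (simp add: C_def)
  \<comment> \<open>The bound 2 + 2 * K is that of \<open>sqn_add_le\<close> for a deviation of size
    at most 1 from F0, where K is the value at F0.\<close>
  have near: "eventually (\<lambda>x. sqn (F x) \<le> ennreal (2 + 2 * K) \<and> F x \<in> borel_measurable P \<and>
      sqn (\<lambda>w. F x w - F0 w) < \<infinity>) (wpa1 M)"
  proof -
    have "eventually (\<lambda>x. sqn (\<lambda>w. F x w - F0 w) < 1) (wpa1 M)"
      by (intro order_tendstoD(2)[OF diff]) simp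
    then show ?thesis
      using eventually_in_M \<gamma>_range
    proof eventually_elim
      case (elim x)
      have "sqn (F x) = sqn (\<lambda>w. (F x w - F0 w) + F0 w)" by simp
      also have "\<dots> \<le> 2 * sqn (\<lambda>w. F x w - F0 w) + 2 * sqn F0"
        using Fm elim F0 by (intro sqn_add_le) auto
      also have "\<dots> \<le> 2 * 1 + 2 * ennreal K"
        using elim K by (intro add_mono mult_left_mono) auto
      also have "\<dots> = ennreal (2 + 2 * K)"
        using K by (simp add: ennreal_mult)
      finally show ?case using Fm elim by (auto simp: less_top intro: less_trans)
    qed
  qed
  have "((\<lambda>(n, \<omega>). avg n (T (F (n, \<omega>))) (sample S'' n \<omega>) - (\<integral>u. T (F (n, \<omega>)) u \<partial>PVZ)) \<longlongrightarrow> 0) (wpa1 M)"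
    unfolding F_def fst_conv snd_conv
  proof (rule weak_law_S''[where G = "\<lambda>n s. T (\<lambda>w. f' w (\<theta>n n s) (\<gamma>n n s))" and C = "C * (2 + 2 * K)"])
    show "(\<lambda>(s, u). T (\<lambda>w. f' w (\<theta>n n s) (\<gamma>n n s)) u) \<in> borel_measurable (Pn n \<Otimes>\<^sub>M PVZ)" for n
      by (rule T_measurable[OF est_meas(4)])
    show "eventually (\<lambda>(n, \<omega>). (\<integral>\<^sup>+u. ennreal ((T (\<lambda>w. f' w (\<theta>n n (sample S' n \<omega>)) (\<gamma>n n (sample S' n \<omega>))) u)\<^sup>2) \<partial>PVZ)
        \<le> ennreal (C * (2 + 2 * K))) (wpa1 M)"
      using near
    proof eventually_elim
      case (elim x)
      have "(\<integral>\<^sup>+u. ennreal ((T (F x) u)\<^sup>2) \<partial>PVZ) \<le> ennreal C * sqn (F x)"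
        using T_bound elim by (simp only: C_def)
      also have "\<dots> \<le> ennreal C * ennreal (2 + 2 * K)"
        using elim by (intro mult_left_mono) auto
      also have "\<dots> = ennreal (C * (2 + 2 * K))"
        using K C0 by (simp only: ennreal_mult)
      finally show ?case by (simp add: case_prod_beta' F_def[abs_def])
    qed
  qed
  moreover have "((\<lambda>x. \<integral>w. F x w - F0 w \<partial>P) \<longlongrightarrow> 0) (wpa1 M)"
    unfolding tendsto_wpa1_real_iff
  proof safe
    fix \<epsilon> :: real assume \<epsilon>: "\<epsilon> > 0"
    then have "eventually (\<lambda>x. sqn (\<lambda>w. F x w - F0 w) < ennreal (\<epsilon>\<^sup>2)) (wpa1 M)"
      by (intro order_tendstoD(2)[OF diff]) simp
    then show "eventually (\<lambda>x. \<bar>\<integral>w. F x w - F0 w \<partial>P\<bar> \<le> \<epsilon>) (wpa1 M)"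
      using near
    proof eventually_elim
      case (elim x)
      have "ennreal ((\<integral>w. F x w - F0 w \<partial>P)\<^sup>2) \<le> sqn (\<lambda>w. F x w - F0 w)"
        using elim F0 by (intro square_integrable_P(3)) auto
      also have "\<dots> \<le> ennreal (\<epsilon>\<^sup>2)" using elim by simp
      finally have "(\<integral>w. F x w - F0 w \<partial>P)\<^sup>2 \<le> \<epsilon>\<^sup>2" by (simp add: ennreal_le_iff)
      then show ?case using \<epsilon> abs_le_square_iff[of "\<integral>w. F x w - F0 w \<partial>P" \<epsilon>] by simp
    qed
  qed
  ultimately have "((\<lambda>x. (case x of (n, \<omega>) \<Rightarrow> avg n (T (F (n, \<omega>))) (sample S'' n \<omega>) - (\<integral>u. T (F (n, \<omega>)) u \<partial>PVZ)) +
      (\<integral>w. F x w - F0 w \<partial>P)) \<longlongrightarrow> 0 + 0) (wpa1 M)"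
    by (rule tendsto_add)
  moreover have "eventually (\<lambda>x. (case x of (n, \<omega>) \<Rightarrow> avg n (T (F (n, \<omega>))) (sample S'' n \<omega>) - (\<integral>u. T (F (n, \<omega>)) u \<partial>PVZ)) +
      (\<integral>w. F x w - F0 w \<partial>P) = ee x - e) (wpa1 M)"
    using near
  proof eventually_elim
    case (elim x)
    then have fin: "sqn (F x) < \<infinity>" "F x \<in> borel_measurable P" by (auto intro: le_less_trans)
    have "(\<integral>w. F x w - F0 w \<partial>P) = (\<integral>w. F x w \<partial>P) - e"
      using square_integrable_P(2)[OF fin(2,1)] f'0_int by (simp add: F0_def)
    then show ?case
      using T_mean[OF fin(2,1)] by (simp add: case_prod_beta' en_def U_def F_def[abs_def])
  qed
  ultimately have "((\<lambda>x. ee x - e) \<longlongrightarrow> 0) (wpa1 M)"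
    by (simp add: tendsto_cong)
  then show ?thesis by (simp add: LIM_zero_iff)
qed

text \<open>The range of g and, eventually, the estimate of \<open>\<gamma>c\<close> lie in
  \<Gamma>. If \<Gamma> is a single point, both equal \<open>\<gamma>c\<close> and all differences
  are 0, so convergence of \<open>ee\<close> does not enter.\<close>

lemma gpart_degenerate:
  assumes "\<Gamma> = {\<gamma>c}"
  shows "eventually (\<lambda>x. ga x = \<gamma>c \<and> (\<forall>w\<in>space P. gpart x w = 0)) (wpa1 M)"
  using \<gamma>_range by eventually_elim (use assms \<Gamma>(3) in \<open>auto simp: gpart_def\<close>)

lemma sqn_zero: "(\<And>w. w \<in> space P \<Longrightarrow> h w = 0) \<Longrightarrow> sqn h = 0"
  using sqn_le[of "\<lambda>_. 0" h 0] by simp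

text \<open>The function \<open>1{V\<^sub>2 = c}(g - \<gamma>\<^sub>c)\<close> need not have a finite norm under the second law. If it has
  not, finiteness of the norms of the score and of its estimate forces its coefficient in the
  difference to vanish.\<close>

lemma gpart_tendsto: "((\<lambda>x. sqn (gpart x)) \<longlongrightarrow> 0) (wpa1 M)"
proof (cases "sqn (\<lambda>w. f' w \<theta>0 \<gamma>c) < \<infinity>")
  case False
  then have "\<Gamma> = {\<gamma>c}" using f'0_sqn by auto
  from gpart_degenerate[OF this] have "eventually (\<lambda>x. sqn (gpart x) = 0) (wpa1 M)"
    by eventually_elim (auto intro!: sqn_zero)
  then show ?thesis by (rule tendsto_eventually)
next
  case True
  \<comment> \<open>For positive \<open>pp x\<close>, \<open>gpart x\<close> is a combination of the
    fixed functions \<open>k\<close> and \<open>ic\<close> with random scalar coefficients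
    \<open>A x\<close> and \<open>b x\<close>, both tending to 0. As \<open>ic\<close> is bounded,
    only \<open>k\<close> can cause trouble.\<close>
  define A where "A x = ee x / pp x - e / pc" for x
  define b where "b x = (\<gamma>c - ga x) * ee x / pp x" for x
  define k where "k w = ic w * (g w - \<gamma>c)" for w
  have km: "k \<in> borel_measurable P" and icm: "ic \<in> borel_measurable P"
    using base_meas by (auto simp: k_def[abs_def])
  have A: "(A \<longlongrightarrow> e / pc - e / pc) (wpa1 M)"
    unfolding A_def[abs_def] using pc(2) by (intro tendsto_diff tendsto_divide ee_tendsto[OF True] pp_tendsto tendsto_const) auto
  have b: "(b \<longlongrightarrow> (\<gamma>c - \<gamma>c) * e / pc) (wpa1 M)"
    unfolding b_def[abs_def] using pc(2)
    by (intro tendsto_divide tendsto_mult tendsto_diff ee_tendsto[OF True] pp_tendsto ga_tendsto tendsto_const) auto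
  have gp: "gpart x w = A x * k w + b x * ic w" if "pp x > 0" for x w
    using that pc(2) by (simp add: gpart_def A_def b_def k_def field_simps)
  \<comment> \<open>The default 0 is sound because \<open>A x\<close> is shown below to vanish
    whenever \<open>sqn k\<close> is infinite.\<close>
  define K where "K = (if sqn k < \<infinity> then enn2real (sqn k) else 0)"
  have ic_le: "sqn (\<lambda>w. b x * ic w) \<le> 2 * ennreal ((b x)\<^sup>2)" for x
  proof -
    have "sqn (\<lambda>w. b x * ic w) \<le> ennreal (1\<^sup>2) * sqn (\<lambda>w. b x)"
    proof (rule sqn_le)
      fix w assume "w \<in> space P"
      from ic01[OF this] show "\<bar>b x * ic w\<bar> \<le> 1 * \<bar>b x\<bar>" by auto
    qed simp
    then show ?thesis by (simp add: sqn_const)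
  qed
  have resid_fin: "eventually (\<lambda>x. sqn (resid x) < \<infinity>) (wpa1 M)" "eventually (\<lambda>x. sqn (fpart x) < \<infinity>) (wpa1 M)"
    by (rule order_tendstoD(2)[OF resid_consistent], simp) (rule order_tendstoD(2)[OF fpart_tendsto], simp)
  have "eventually (\<lambda>x. sqn (gpart x) \<le> 2 * (ennreal ((A x)\<^sup>2) * ennreal K) + 4 * ennreal ((b x)\<^sup>2)) (wpa1 M)"
    using pp_pos resid_fin finite(2) eventually_in_M \<gamma>_range
  proof eventually_elim
    case (elim x)
    have Akm: "(\<lambda>w. A x * k w) \<in> borel_measurable P" and bm: "(\<lambda>w. b x * ic w) \<in> borel_measurable P"
      using km icm by auto
    have rm: "resid x \<in> borel_measurable P" and fm: "fpart x \<in> borel_measurable P"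
      using resid_meas fpart_meas elim by auto
    have Ak: "sqn (\<lambda>w. A x * k w) \<le> ennreal ((A x)\<^sup>2) * ennreal K"
    proof (cases "sqn k < \<infinity>")
      case True
      then show ?thesis using sqn_cmult[OF km, of "A x"] by (auto simp: K_def less_top)
    next
      case False
      have fin2: "sqn (\<lambda>w. h w + l w) < \<infinity>" "sqn (\<lambda>w. h w - l w) < \<infinity>"
        if "h \<in> borel_measurable P" "l \<in> borel_measurable P" "sqn h < \<infinity>" "sqn l < \<infinity>" for h l
      proof -
        have "2 * sqn h + 2 * sqn l < \<infinity>" using that by (simp add: ennreal_mult_less_top)
        then show "sqn (\<lambda>w. h w + l w) < \<infinity>" "sqn (\<lambda>w. h w - l w) < \<infinity>"
          using sqn_add_le[OF that(1,2)] sqn_diff_le[OF that(1,2)] by (auto intro: le_less_trans)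
      qed
      have h0m: "h0 \<in> borel_measurable P"
        unfolding h0_def[abs_def] using base_meas ev_meas[OF \<theta>0] f_meas(1)[OF \<theta>0 \<Gamma>(2)] by measurable
      have hn_eq: "hn (fst x) (UU x) = (\<lambda>w. h0 w + (resid x w + gpart x w + fpart x w))"
        using hn_minus_h0[of x] by (auto simp: fun_eq_iff algebra_simps)
      have hnm: "hn (fst x) (UU x) \<in> borel_measurable P"
        unfolding hn_eq using h0m rm fm gpart_meas by measurable
      \<comment> \<open>Removing from the score difference every part of finite norm leaves
        \<open>A x * k\<close>. As \<open>k\<close> has infinite norm, the scalar must be 0.\<close>
      have "sqn (\<lambda>w. (((hn (fst x) (UU x) w - h0 w) - resid x w) - fpart x w) - b x * ic w) < \<infinity>"
        using elim finite(1) hnm h0m rm fm bm le_less_trans[OF ic_le, of x \<infinity>]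
        by (intro fin2 borel_measurable_diff) (auto simp: ennreal_mult_less_top)
      moreover have "(\<lambda>w. (((hn (fst x) (UU x) w - h0 w) - resid x w) - fpart x w) - b x * ic w) = (\<lambda>w. A x * k w)"
        unfolding hn_minus_h0 using gp[of x] elim by (auto simp: fun_eq_iff)
      ultimately have fin: "sqn (\<lambda>w. A x * k w) < \<infinity>" by simp
      have "A x = 0"
      proof (rule ccontr)
        assume nz: "A x \<noteq> 0"
        then have "sqn k = sqn (\<lambda>w. 1 / A x * (A x * k w))" by simp
        also have "\<dots> < \<infinity>"
          using sqn_cmult[OF Akm, of "1 / A x"] fin by (auto intro: le_less_trans simp: ennreal_mult_less_top)
        finally show False using False by simp
      qed
      then show ?thesis by (simp add: sqn_zero)
    qed
    have "gpart x = (\<lambda>w. A x * k w + b x * ic w)" using gp elim by (auto simp: fun_eq_iff)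
    then have "sqn (gpart x) \<le> 2 * sqn (\<lambda>w. A x * k w) + 2 * sqn (\<lambda>w. b x * ic w)"
      using sqn_add_le[OF Akm bm] by simp
    also have "\<dots> \<le> 2 * (ennreal ((A x)\<^sup>2) * ennreal K) + 2 * (2 * ennreal ((b x)\<^sup>2))"
      by (intro add_mono mult_left_mono Ak ic_le) auto
    finally show ?case by (simp flip: mult.assoc)
  qed
  then have le: "eventually (\<lambda>x. sqn (gpart x) \<le> ennreal (2 * ((A x)\<^sup>2 * K) + 4 * (b x)\<^sup>2)) (wpa1 M)"
    by eventually_elim (simp add: K_def ennreal_mult)
  have "((\<lambda>x. ennreal (2 * ((A x)\<^sup>2 * K) + 4 * (b x)\<^sup>2)) \<longlongrightarrow> ennreal (2 * ((e / pc - e / pc)\<^sup>2 * K) + 4 * ((\<gamma>c - \<gamma>c) * e / pc)\<^sup>2)) (wpa1 M)"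
    by (intro tendsto_ennrealI tendsto_add tendsto_mult tendsto_power A b tendsto_const)
  then have lim: "((\<lambda>x. ennreal (2 * ((A x)\<^sup>2 * K) + 4 * (b x)\<^sup>2)) \<longlongrightarrow> 0) (wpa1 M)" by simp
  show ?thesis
    by (rule tendsto_sandwich[OF _ le tendsto_const lim]) simp
qed

lemma hn_diff_eq: "(\<lambda>w. hn (fst x) (UU x) w - h0 w) = (\<lambda>w. (resid x w + gpart x w) + fpart x w)"
  by (simp add: hn_minus_h0)

lemma score_consistent: "((\<lambda>x. sqn (\<lambda>w. hn (fst x) (UU x) w - h0 w)) \<longlongrightarrow> 0) (wpa1 M)"
proof (rule tendsto_sandwich[OF _ _ tendsto_const])
  show "eventually (\<lambda>x. sqn (\<lambda>w. hn (fst x) (UU x) w - h0 w) \<le>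
      2 * (2 * sqn (resid x) + 2 * sqn (gpart x)) + 2 * sqn (fpart x)) (wpa1 M)"
    using eventually_in_M \<gamma>_range
  proof eventually_elim
    case (elim x)
    have "sqn (\<lambda>w. (resid x w + gpart x w) + fpart x w) \<le> 2 * sqn (\<lambda>w. resid x w + gpart x w) + 2 * sqn (fpart x)"
      using elim by (intro sqn_add_le borel_measurable_add resid_meas gpart_meas fpart_meas)
    also have "\<dots> \<le> 2 * (2 * sqn (resid x) + 2 * sqn (gpart x)) + 2 * sqn (fpart x)"
      using elim by (intro add_right_mono mult_left_mono sqn_add_le resid_meas gpart_meas) auto
    finally show ?case unfolding hn_diff_eq .
  qed
  have "((\<lambda>x. 2 * (2 * sqn (resid x) + 2 * sqn (gpart x)) + 2 * sqn (fpart x)) \<longlongrightarrow> 2 * (2 * 0 + 2 * 0) + 2 * 0) (wpa1 M)"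
    by (intro tendsto_add tendsto_mult_ennreal tendsto_const resid_consistent gpart_tendsto fpart_tendsto) auto
  then show "((\<lambda>x. 2 * (2 * sqn (resid x) + 2 * sqn (gpart x)) + 2 * sqn (fpart x)) \<longlongrightarrow> 0) (wpa1 M)"
    by simp
qed simp

section \<open>The bias of the estimated score\<close>

lemma ic_integrable: "integrable P ic"
proof (rule P.integrable_const_bound[where B = 1])
  show "AE w in P. norm (ic w) \<le> 1" using ic01 by (intro AE_I2) (metis abs_one abs_zero real_norm_def zero_le_one order_refl)
qed (rule base_meas(3))

text \<open>The slope is taken at \<open>\<theta>0\<close> and not at \<theta>: consistency controls
  f' in both parameters jointly, and the mean slope is then exactly e instead of a random quantity.
  The bound is linear in the increment of \<gamma> with an arbitrarily small factor.\<close>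

lemma first_order_remainder:
  assumes \<delta>: "\<And>s. s \<in> \<Gamma> \<Longrightarrow> \<bar>s - \<gamma>c\<bar> \<le> \<delta> \<Longrightarrow> sqn (\<lambda>w. f' w \<theta> s - f' w \<theta>0 \<gamma>c) \<le> ennreal (\<epsilon>\<^sup>2)"
    and \<gamma>: "\<gamma> \<in> \<Gamma>" "\<bar>\<gamma> - \<gamma>c\<bar> \<le> \<delta>" and \<theta>: "\<theta> \<in> \<Theta>" and \<epsilon>: "\<epsilon> \<ge> 0"
  shows "\<bar>(\<integral>w. f w \<theta> \<gamma> \<partial>P) - (\<integral>w. f w \<theta> \<gamma>c \<partial>P) - (\<gamma> - \<gamma>c) * e\<bar> \<le> \<bar>\<gamma> - \<gamma>c\<bar> * \<epsilon>"
proof -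
  let ?X = "\<lambda>w. f w \<theta> \<gamma> - f w \<theta> \<gamma>c - (\<gamma> - \<gamma>c) * f' w \<theta>0 \<gamma>c"
  have seg: "s \<in> \<Gamma> \<and> \<bar>s - \<gamma>c\<bar> \<le> \<delta>" if "s \<in> closed_segment \<gamma>c \<gamma>" for s
    by (rule closed_segment_near[OF \<Gamma>(1,2) \<gamma>(1) \<gamma>(2) that])
  have "(\<integral>\<^sup>+w. ennreal ((?X w)\<^sup>2) \<partial>P) \<le> ennreal ((\<gamma> - \<gamma>c)\<^sup>2) * ennreal (\<epsilon>\<^sup>2)"
  proof (rule nn_integral_first_order_remainder_le[OF \<Gamma>(1,2) \<gamma>(1) f_smooth[OF \<theta>]])
    fix s assume s: "s \<in> closed_segment \<gamma>c \<gamma>"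
    have "(\<integral>\<^sup>+w. ennreal ((f' w \<theta> s - f' w \<theta>0 \<gamma>c)\<^sup>2) \<partial>P) \<le> sqn (\<lambda>w. f' w \<theta> s - f' w \<theta>0 \<gamma>c)"
      by (simp add: sqn_def)
    also have "\<dots> \<le> ennreal (\<epsilon>\<^sup>2)" using \<delta> seg[OF s] by blast
    finally show "(\<integral>\<^sup>+w. ennreal ((f' w \<theta> s - f' w \<theta>0 \<gamma>c)\<^sup>2) \<partial>P) \<le> ennreal (\<epsilon>\<^sup>2)" .
  qed (use f_meas \<theta> \<theta>0 \<Gamma> in auto)
  also have "\<dots> = ennreal ((\<gamma> - \<gamma>c)\<^sup>2 * \<epsilon>\<^sup>2)" by (simp add: ennreal_mult)
  finally have le: "(\<integral>\<^sup>+w. ennreal ((?X w)\<^sup>2) \<partial>P) \<le> ennreal ((\<gamma> - \<gamma>c)\<^sup>2 * \<epsilon>\<^sup>2)" .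
  have Xi: "integrable P ?X"
    using f_int[OF \<theta>] \<gamma>(1) \<Gamma>(2) f'0_int(1) by simp
  then have Xm: "?X \<in> borel_measurable P" by auto
  have i2: "integrable P (\<lambda>w. (?X w)\<^sup>2)"
    using Xm le by (intro integrableI_bounded) (auto intro: le_less_trans)
  have "(\<integral>w. ?X w \<partial>P)\<^sup>2 \<le> (\<integral>w. (?X w)\<^sup>2 \<partial>P)"
    by (rule P.square_expectation_le[OF Xm i2])
  also have "\<dots> \<le> (\<gamma> - \<gamma>c)\<^sup>2 * \<epsilon>\<^sup>2"
    using le i2 by (simp add: nn_integral_eq_integral ennreal_le_iff)
  also have "\<dots> = (\<bar>\<gamma> - \<gamma>c\<bar> * \<epsilon>)\<^sup>2" by (simp add: power_mult_distrib)
  finally have "\<bar>\<integral>w. ?X w \<partial>P\<bar> \<le> \<bar>\<gamma> - \<gamma>c\<bar> * \<epsilon>"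
    using \<epsilon> abs_le_square_iff[of "\<integral>w. ?X w \<partial>P" "\<bar>\<gamma> - \<gamma>c\<bar> * \<epsilon>"] by simp
  moreover have "(\<integral>w. ?X w \<partial>P) = (\<integral>w. f w \<theta> \<gamma> \<partial>P) - (\<integral>w. f w \<theta> \<gamma>c \<partial>P) - (\<gamma> - \<gamma>c) * e"
    using f_int[OF \<theta>] \<gamma>(1) \<Gamma>(2) f'0_int by simp
  ultimately show ?thesis by simp
qed

text \<open>The difference quotient of P f in \<gamma> minus the slope that \<open>gpart\<close>
  subtracts; times \<open>ga x - \<gamma>c\<close> it is what the bias retains of \<gamma>. The
  value 0 at \<open>ga x = \<gamma>c\<close> is harmless in that product and also gives convergence
  for a one-point \<Gamma>, where \<open>ee\<close> is uncontrolled.\<close>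

definition curvature where
  "curvature x = (if ga x = \<gamma>c then 0
    else ((\<integral>w. f w (th x) (ga x) \<partial>P) - (\<integral>w. f w (th x) \<gamma>c \<partial>P)) / (ga x - \<gamma>c) - pc * ee x / pp x)"

text \<open>The constant e lies between the two terms: the difference quotient is near e by
  \<open>first_order_remainder\<close>, and \<open>pc * ee x / pp x\<close> is near e by
  consistency.\<close>

lemma curvature_tendsto: "(curvature \<longlongrightarrow> 0) (wpa1 M)"
proof (cases "sqn (\<lambda>w. f' w \<theta>0 \<gamma>c) < \<infinity>")
  case False
  then have "\<Gamma> = {\<gamma>c}" using f'0_sqn by auto
  from gpart_degenerate[OF this] have "eventually (\<lambda>x. curvature x = 0) (wpa1 M)"
    by eventually_elim (simp add: curvature_def)
  then show ?thesis by (rule tendsto_eventually)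
next
  case True
  have ep: "((\<lambda>x. e - pc * ee x / pp x) \<longlongrightarrow> e - pc * e / pc) (wpa1 M)"
    using pc(2) by (intro tendsto_diff tendsto_divide tendsto_mult ee_tendsto[OF True] pp_tendsto tendsto_const) auto
  have ep': "((\<lambda>x. e - pc * ee x / pp x) \<longlongrightarrow> 0) (wpa1 M)" using ep pc(2) by simp
  show ?thesis
    unfolding tendsto_wpa1_real_iff
  proof safe
    fix \<eta> :: real assume \<eta>: "\<eta> > 0"
    \<comment> \<open>Squared because \<open>sqn\<close> is a squared norm, while the remainder
      bound is linear in \<epsilon>.\<close>
    from f_consistent[of "(\<eta> / 2)\<^sup>2"] \<eta> obtain \<delta> where \<delta>: "\<delta> > 0"
      "\<And>\<theta> \<gamma>. \<theta> \<in> \<Theta> \<Longrightarrow> \<gamma> \<in> \<Gamma> \<Longrightarrow> sqn (\<lambda>w. ev \<theta> w - ev \<theta>0 w) \<le> ennreal \<delta> \<Longrightarrow> \<bar>\<gamma> - \<gamma>c\<bar> \<le> \<delta> \<Longrightarrow>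
        sqn (\<lambda>w. f' w \<theta> \<gamma> - f' w \<theta>0 \<gamma>c) \<le> ennreal ((\<eta> / 2)\<^sup>2)" by fastforce
    have "eventually (\<lambda>x. \<bar>e - pc * ee x / pp x\<bar> \<le> \<eta> / 2) (wpa1 M)"
      using ep'[unfolded tendsto_wpa1_real_iff, rule_format, of "\<eta> / 2"] \<eta> by simp
    then show "eventually (\<lambda>x. \<bar>curvature x\<bar> \<le> \<eta>) (wpa1 M)"
      using eventually_near[OF \<delta>(1)]
    proof eventually_elim
      case (elim x)
      have tri: "\<bar>p - q\<bar> \<le> \<eta>" if "\<bar>p - s\<bar> \<le> \<eta> / 2" "\<bar>s - q\<bar> \<le> \<eta> / 2" for p q s :: real
        using that by linarith
      show ?case
      proof (cases "ga x = \<gamma>c")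
        case False
        let ?A = "(\<integral>w. f w (th x) (ga x) \<partial>P) - (\<integral>w. f w (th x) \<gamma>c \<partial>P)"
        have t: "th x \<in> \<Theta>" using th_in elim by auto
        have "\<bar>?A - (ga x - \<gamma>c) * e\<bar> \<le> \<bar>ga x - \<gamma>c\<bar> * (\<eta> / 2)"
          by (rule first_order_remainder[where \<delta> = \<delta>]) (use elim \<eta> t \<delta>(2) in auto)
        moreover have "?A - (ga x - \<gamma>c) * e = (ga x - \<gamma>c) * (?A / (ga x - \<gamma>c) - e)"
          using False by (simp add: field_simps)
        ultimately have "\<bar>?A / (ga x - \<gamma>c) - e\<bar> \<le> \<eta> / 2"
          using False by (simp add: abs_mult)
        then show ?thesis
          using tri[OF _ elim(1)] False by (simp add: curvature_def)
      qed (use \<eta> in \<open>simp add: curvature_def\<close>)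
    qed
  qed
qed

text \<open>An exact identity, not an expansion. Centring leaves of \<open>resid\<close> minus the
  mean of rr * d, where d is the error of \<open>ev\<close>; the Riesz representation at
  \<open>\<gamma>c\<close> extracts the mean of r * d from \<open>fpart\<close>; what
  \<open>fpart\<close> retains is the increment in \<gamma>, which joins \<open>gpart\<close> in
  \<open>curvature\<close>.\<close>

lemma score_bias:
  assumes x: "snd x \<in> space M" and ga: "ga x \<in> \<Gamma>" and pp: "pp x > 0"
  shows "(\<integral>w. hn (fst x) (UU x) w - h0 w \<partial>P) =
    (ga x - \<gamma>c) * curvature x - (\<integral>w. (ev (th x) w - ev \<theta>0 w) * (rr x w - r w) \<partial>P)"
proof -
  note t = th_in[OF x]
  define d where "d w = ev (th x) w - ev \<theta>0 w" for w
  have dm: "d \<in> borel_measurable P"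
    using ev_meas[OF t] ev_meas[OF \<theta>0] by (auto simp: d_def[abs_def])
  have rrm: "rr x \<in> borel_measurable P" by (rule rr_meas[OF x])
  have resm: "(\<lambda>w. m w - ev \<theta>0 w) \<in> borel_measurable P"
    using base_meas ev_meas[OF \<theta>0] by auto
  have d2: "integrable P (\<lambda>w. (d w)\<^sup>2)"
    using ev_sq[OF t] ev_sq[OF \<theta>0] square_integrable_product[OF ev_meas[OF t] ev_meas[OF \<theta>0]]
    by (simp add: d_def power2_diff mult.assoc)
  have i1: "integrable P (\<lambda>w. rr x w * (m w - ev \<theta>0 w))"
    and i2: "integrable P (\<lambda>w. rr x w * d w)"
    and i3: "integrable P (\<lambda>w. r w * (m w - ev \<theta>0 w))"
    and i4: "integrable P (\<lambda>w. r w * d w)"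
    and i5: "integrable P (\<lambda>w. r w * ev (th x) w)" and i6: "integrable P (\<lambda>w. r w * ev \<theta>0 w)"
    using square_integrable_product rrm resm dm base_meas(4) rn_sq[OF S1_space[OF x]] res_sq d2 r_sq
      ev_meas[OF t] ev_meas[OF \<theta>0] ev_sq[OF t] ev_sq[OF \<theta>0] by blast+
  have o1: "(\<integral>w. rr x w * (m w - ev \<theta>0 w) \<partial>P) = 0" by (rule orth(2)[OF S1_space[OF x]])
  \<comment> \<open>Replacing the estimated residual by the true one minus d isolates terms that are
    centred given (V1, X).\<close>
  have res_eq: "resid x w = rr x w * (m w - ev \<theta>0 w) - rr x w * d w - r w * (m w - ev \<theta>0 w)" for w
    by (simp add: resid_def d_def algebra_simps)
  have res: "integrable P (resid x)" "(\<integral>w. resid x w \<partial>P) = - (\<integral>w. rr x w * d w \<partial>P)"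
    unfolding res_eq[abs_def] using i1 i2 i3 o1 orth(1) by auto
  have gp_eq: "gpart x w = (ee x / pp x - e / pc) * (ic w * g w) + (\<gamma>c * e / pc - ga x * ee x / pp x) * ic w" for w
    using pp pc(2) by (simp add: gpart_def field_simps)
  have gp: "integrable P (gpart x)" "(\<integral>w. gpart x w \<partial>P) = (\<gamma>c - ga x) * (pc * ee x / pp x)"
  proof -
    show "integrable P (gpart x)"
      unfolding gp_eq[abs_def] using g_mean(1) ic_integrable by auto
    have "(\<integral>w. gpart x w \<partial>P) = (ee x / pp x - e / pc) * (pc * \<gamma>c) + (\<gamma>c * e / pc - ga x * ee x / pp x) * pc"
      unfolding gp_eq using g_mean ic_integrable pc(1) by simp
    also have "\<dots> = (\<gamma>c - ga x) * (pc * ee x / pp x)"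
      using pp pc(2) by (simp add: field_simps)
    finally show "(\<integral>w. gpart x w \<partial>P) = (\<gamma>c - ga x) * (pc * ee x / pp x)" .
  qed
  have fp: "integrable P (fpart x)" "(\<integral>w. fpart x w \<partial>P) =
      ((\<integral>w. f w (th x) (ga x) \<partial>P) - (\<integral>w. f w (th x) \<gamma>c \<partial>P)) + (\<integral>w. r w * d w \<partial>P)"
  proof -
    show "integrable P (fpart x)"
      unfolding fpart_def[abs_def] using f_int[OF t ga] f_int[OF \<theta>0 \<Gamma>(2)] by auto
    \<comment> \<open>The representation is used at both \<open>th x\<close> and
      \<open>\<theta>0\<close>, always at the true \<open>\<gamma>c\<close>, where it is
      available.\<close>
    have "(\<integral>w. r w * d w \<partial>P) = (\<integral>w. r w * ev (th x) w - r w * ev \<theta>0 w \<partial>P)"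
      by (simp add: d_def right_diff_distrib)
    also have "\<dots> = (\<integral>w. f w (th x) \<gamma>c \<partial>P) - (\<integral>w. f w \<theta>0 \<gamma>c \<partial>P)"
      using i5 i6 riesz[OF t] riesz[OF \<theta>0] by simp
    finally show "(\<integral>w. fpart x w \<partial>P) =
      ((\<integral>w. f w (th x) (ga x) \<partial>P) - (\<integral>w. f w (th x) \<gamma>c \<partial>P)) + (\<integral>w. r w * d w \<partial>P)"
      unfolding fpart_def using f_int[OF t ga] f_int[OF \<theta>0 \<Gamma>(2)] by simp
  qed
  have "(\<integral>w. hn (fst x) (UU x) w - h0 w \<partial>P) = (\<integral>w. resid x w \<partial>P) + (\<integral>w. gpart x w \<partial>P) + (\<integral>w. fpart x w \<partial>P)"
    unfolding hn_minus_h0 using res(1) gp(1) fp(1) by simp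
  moreover have "(\<integral>w. d w * (rr x w - r w) \<partial>P) = (\<integral>w. rr x w * d w \<partial>P) - (\<integral>w. r w * d w \<partial>P)"
    using i2 i4 by (simp add: algebra_simps)
  moreover have "(ga x - \<gamma>c) * curvature x =
      ((\<integral>w. f w (th x) (ga x) \<partial>P) - (\<integral>w. f w (th x) \<gamma>c \<partial>P)) + (\<gamma>c - ga x) * (pc * ee x / pp x)"
  proof -
    have "y * (A / y - q) = A + z * q" if "y \<noteq> 0" "z = - y" for y z A q :: real
      using that by (simp add: right_diff_distrib)
    note aux = this[of "ga x - \<gamma>c" "\<gamma>c - ga x"]
    show ?thesis
    proof (cases "ga x = \<gamma>c")
      case False
      with aux show ?thesis
        unfolding curvature_def by (simp only: if_False) simp
    qed (simp add: curvature_def)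
  qed
  ultimately show ?thesis
    unfolding res gp fp d_def[symmetric] by linarith
qed

lemma bias_tendsto: "((\<lambda>x. sqrtn x * (\<integral>w. hn (fst x) (UU x) w - h0 w \<partial>P)) \<longlongrightarrow> 0) (wpa1 M)"
proof -
  have "((\<lambda>x. sqrtn x * (ga x - \<gamma>c) * curvature x - sqrtn x * (\<integral>w. (ev (th x) w - ev \<theta>0 w) * (rr x w - r w) \<partial>P)) \<longlongrightarrow> 0 - 0) (wpa1 M)"
    using O_P_mult_tendsto_0_real[OF \<gamma>_rate curvature_tendsto]
    by (intro tendsto_diff product_rate) (simp add: mult.assoc)
  moreover have "eventually (\<lambda>x. sqrtn x * (ga x - \<gamma>c) * curvature x - sqrtn x * (\<integral>w. (ev (th x) w - ev \<theta>0 w) * (rr x w - r w) \<partial>P) =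
      sqrtn x * (\<integral>w. hn (fst x) (UU x) w - h0 w \<partial>P)) (wpa1 M)"
    using eventually_in_M \<gamma>_range pp_pos
  proof eventually_elim
    case (elim x)
    have "s * d * c - s * i = s * (d * c - i)" for s d c i :: real by (simp add: algebra_simps)
    then show ?case using score_bias[OF elim] by (simp only:)
  qed
  ultimately show ?thesis by (simp add: tendsto_cong)
qed

section \<open>Measurability, centring and the limit law\<close>

lemma hn_measurable: "(\<lambda>(s, w). hn n s w) \<in> borel_measurable ((Pn n \<Otimes>\<^sub>M Pn n) \<Otimes>\<^sub>M P)"
proof -
  let ?N = "(Pn n \<Otimes>\<^sub>M Pn n) \<Otimes>\<^sub>M P"
  have pr: "(\<lambda>p. (fst (fst p), snd p)) \<in> ?N \<rightarrow>\<^sub>M Pn n \<Otimes>\<^sub>M P" by measurable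
  have p1: "(\<lambda>p. fst (fst p)) \<in> ?N \<rightarrow>\<^sub>M Pn n" by measurable
  note c = measurable_compose[OF pr est_meas(1)[of n]] measurable_compose[OF pr est_meas(2)[of n]]
    measurable_compose[OF pr est_meas(3)[of n]]
  have bm: "(\<lambda>p. h (snd p)) \<in> borel_measurable ?N" if "h \<in> borel_measurable P" for h :: "'a \<times> 'b \<Rightarrow> real"
    by (rule measurable_compose[OF measurable_snd that])
  have en: "en n \<in> borel_measurable (Pn n \<Otimes>\<^sub>M Pn n)"
  proof -
    have TG: "(\<lambda>(s, u). T (\<lambda>w. f' w (\<theta>n n s) (\<gamma>n n s)) u) \<in> borel_measurable (Pn n \<Otimes>\<^sub>M PVZ)"
      by (rule T_measurable[OF est_meas(4)])
    have "(\<lambda>p. T (\<lambda>w. f' w (\<theta>n n (fst p)) (\<gamma>n n (fst p))) (snd p i)) \<in> borel_measurable (Pn n \<Otimes>\<^sub>M Pn n)"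
      if i: "i < n" for i
    proof -
      have "(\<lambda>s. s i) \<in> Pn n \<rightarrow>\<^sub>M PVZ"
        unfolding Pn_def using i by (intro measurable_component_singleton) auto
      then have "(\<lambda>p. (fst p, snd p i)) \<in> Pn n \<Otimes>\<^sub>M Pn n \<rightarrow>\<^sub>M Pn n \<Otimes>\<^sub>M PVZ"
        by (intro measurable_Pair measurable_fst measurable_compose[OF measurable_snd])
      from measurable_compose[OF this TG] show ?thesis by simp
    qed
    then show ?thesis
      unfolding en_def[abs_def] avg_def by (intro borel_measurable_times borel_measurable_sum) auto
  qed
  have eng: "(\<lambda>p. en n (fst p)) \<in> borel_measurable ?N"
    by (rule measurable_compose[OF measurable_fst en])
  have "(\<lambda>p. hn n (fst p) (snd p)) \<in> borel_measurable ?N"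
    unfolding hn_def
    using c bm[OF base_meas(1)] bm[OF base_meas(2)] bm[OF base_meas(3)] eng
      measurable_compose[OF p1 est_meas(5)[of n]] measurable_compose[OF p1 est_meas(6)[of n]]
    by (intro borel_measurable_add borel_measurable_times borel_measurable_diff borel_measurable_divide) auto
  then show ?thesis by (simp add: case_prod_beta')
qed

lemma h0_meas: "h0 \<in> borel_measurable P"
  unfolding h0_def[abs_def] using base_meas ev_meas[OF \<theta>0] f_meas(1)[OF \<theta>0 \<Gamma>(2)] by measurable

lemma h0_mean: "(\<integral>w. h0 w \<partial>P) = (\<integral>w. f w \<theta>0 \<gamma>c \<partial>P)"
proof -
  have resm: "(\<lambda>w. m w - ev \<theta>0 w) \<in> borel_measurable P"
    using base_meas ev_meas[OF \<theta>0] by auto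
  have i3: "integrable P (\<lambda>w. r w * (m w - ev \<theta>0 w))"
    by (rule square_integrable_product[OF base_meas(4) resm r_sq res_sq])
  have eq: "h0 w = r w * (m w - ev \<theta>0 w) + (e / pc * (ic w * g w) - \<gamma>c * e / pc * ic w) + f w \<theta>0 \<gamma>c" for w
    using pc(2) by (simp add: h0_def field_simps)
  show ?thesis
    unfolding eq using i3 orth(1) ic_integrable g_mean pc f_int[OF \<theta>0 \<Gamma>(2)] by simp
qed

theorem one_step_asymptotic_normality:
  assumes k: "\<And>n. k n \<in> borel_measurable M"
  defines "\<chi>P \<equiv> \<integral>w. f w \<theta>0 \<gamma>c \<partial>P"
  shows "weak_conv_m (\<lambda>n. distr M borel (\<lambda>\<omega>. sqrt (real n) *
      (k n \<omega> + avg n (T (\<lambda>w. hn n (U n \<omega>) w - k n \<omega>)) (sample S n \<omega>) - \<chi>P)))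
    (centered_normal (\<integral>u. (T (\<lambda>w. h0 w - \<chi>P) u)\<^sup>2 \<partial>PVZ))"
proof -
  let ?h = "\<lambda>w. h0 w - \<chi>P"
  let ?D = "\<lambda>n s w. hn n s w - h0 w"
  have h: "?h \<in> borel_measurable P" using h0_meas by simp
  have hfin: "sqn ?h < \<infinity>"
    using sqn_diff_le[OF h0_meas, of "\<lambda>_. \<chi>P"] finite(1)
    by (auto intro: le_less_trans simp: sqn_const ennreal_mult_less_top)
  have hmean: "(\<integral>w. ?h w \<partial>P) = 0"
    using square_integrable_P(2)[OF h0_meas finite(1)] by (simp add: h0_mean \<chi>P_def P.prob_space)
  have D: "(\<lambda>(s, w). ?D n s w) \<in> borel_measurable ((Pn n \<Otimes>\<^sub>M Pn n) \<Otimes>\<^sub>M P)" for n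
    using hn_measurable[of n] measurable_compose[OF measurable_snd h0_meas]
    unfolding case_prod_beta' by (rule borel_measurable_diff)
  \<comment> \<open>The expansion wants a function of mean 0, so the target value is subtracted from
    both \<open>h0\<close> and \<open>k\<close>; the argument of \<open>T\<close> is unchanged by
    this.\<close>
  have k': "(\<lambda>\<omega>. k n \<omega> - \<chi>P) \<in> borel_measurable M" for n using k by simp
  have "weak_conv_m (\<lambda>n. distr M borel (\<lambda>\<omega>. sqrt (real n) *
      ((k n \<omega> - \<chi>P) + avg n (T (\<lambda>w. ?D n (U n \<omega>) w + ?h w - (k n \<omega> - \<chi>P))) (sample S n \<omega>))))
    (centered_normal (\<integral>u. (T ?h u)\<^sup>2 \<partial>PVZ))"
    using score_consistent bias_tendsto
    by (intro one_step_expansion[OF h hfin hmean D k']) (simp_all add: case_prod_beta')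
  then show ?thesis by (simp add: algebra_simps)
qed

end

section \<open>The mechanism classes\<close>

lemma law_VZ_kernel:
  assumes P: "sets P = sets (MV \<Otimes>\<^sub>M MX)" and Q: "Q \<in> MX \<rightarrow>\<^sub>M prob_algebra MZ"
  shows "(\<lambda>(v, x). distr (Q x) (MV \<Otimes>\<^sub>M MZ) (Pair v)) \<in> P \<rightarrow>\<^sub>M subprob_algebra (MV \<Otimes>\<^sub>M MZ)"
  unfolding case_prod_beta
proof (rule measurable_distr2[where M = "MZ"])
  show "(\<lambda>(w, z). (fst w, z)) \<in> P \<Otimes>\<^sub>M MZ \<rightarrow>\<^sub>M MV \<Otimes>\<^sub>M MZ"
    by (subst measurable_cong_sets[OF sets_pair_measure_cong[OF P refl] refl]) measurable
  show "(\<lambda>w. Q (snd w)) \<in> P \<rightarrow>\<^sub>M subprob_algebra MZ"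
    by (subst measurable_cong_sets[OF P refl])
      (rule measurable_compose[OF measurable_snd measurable_prob_algebraD[OF Q]])
qed

context
  fixes MV :: "'v measure" and MX :: "'a measure" and MZ :: "'z measure" and P :: "('v \<times> 'a) measure"
    and Q :: "'a \<Rightarrow> 'z measure"
  assumes P: "prob_space P" "sets P = sets (MV \<Otimes>\<^sub>M MX)" and Q: "Q \<in> MX \<rightarrow>\<^sub>M prob_algebra MZ"
begin

lemma space_PX: "space P = space MV \<times> space MX"
  using sets_eq_imp_space_eq[OF P(2)] by (simp add: space_pair_measure)

lemma sets_law_VZ: "sets (law_VZ MV MZ Q P) = sets (MV \<Otimes>\<^sub>M MZ)"
  unfolding law_VZ_def
  by (rule sets_bind[OF sets_kernel[OF law_VZ_kernel[OF P(2) Q]]]) (use prob_space.not_empty[OF P(1)] in auto)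

lemma sets_Q: "x \<in> space MX \<Longrightarrow> sets (Q x) = sets MZ"
  using measurable_space[OF Q] by (simp add: space_prob_algebra)

lemma prob_Q: "x \<in> space MX \<Longrightarrow> prob_space (Q x)"
  using measurable_space[OF Q] by (simp add: space_prob_algebra)

lemma Pair_measurable_Q: "v \<in> space MV \<Longrightarrow> x \<in> space MX \<Longrightarrow> Pair v \<in> Q x \<rightarrow>\<^sub>M MV \<Otimes>\<^sub>M MZ"
  by (simp add: measurable_cong_sets[OF sets_Q refl])

lemma nn_integral_law_VZ:
  assumes k: "k \<in> borel_measurable (MV \<Otimes>\<^sub>M MZ)"
  shows "(\<integral>\<^sup>+u. k u \<partial>law_VZ MV MZ Q P) = (\<integral>\<^sup>+(v, x). \<integral>\<^sup>+z. k (v, z) \<partial>Q x \<partial>P)"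
proof -
  have "(\<integral>\<^sup>+u. k u \<partial>law_VZ MV MZ Q P) = (\<integral>\<^sup>+w. \<integral>\<^sup>+u. k u \<partial>(case w of (v, x) \<Rightarrow> distr (Q x) (MV \<Otimes>\<^sub>M MZ) (Pair v)) \<partial>P)"
    unfolding law_VZ_def by (rule nn_integral_bind[OF k law_VZ_kernel[OF P(2) Q]])
  also have "\<dots> = (\<integral>\<^sup>+(v, x). \<integral>\<^sup>+z. k (v, z) \<partial>Q x \<partial>P)"
  proof (rule nn_integral_cong, clarsimp)
    fix v x assume "(v, x) \<in> space P"
    then have v: "v \<in> space MV" and x: "x \<in> space MX" by (auto simp: space_PX)
    note Pair_measurable_Q[OF v x]
    then show "(\<integral>\<^sup>+u. k u \<partial>distr (Q x) (MV \<Otimes>\<^sub>M MZ) (Pair v)) = (\<integral>\<^sup>+z. k (v, z) \<partial>Q x)"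
      by (rule nn_integral_distr) (simp add: k)
  qed
  finally show ?thesis .
qed

lemma measurable_inner:
  assumes k: "k \<in> borel_measurable (MV \<Otimes>\<^sub>M MZ)"
  shows "(\<lambda>(v, x). \<integral>\<^sup>+z. k (v, z) \<partial>Q x) \<in> borel_measurable P"
proof -
  have "(\<lambda>w. \<integral>\<^sup>+u. k u \<partial>(case w of (v, x) \<Rightarrow> distr (Q x) (MV \<Otimes>\<^sub>M MZ) (Pair v))) \<in> borel_measurable P"
    by (rule measurable_compose[OF law_VZ_kernel[OF P(2) Q] nn_integral_measurable_subprob_algebra[OF k]])
  moreover have "(\<integral>\<^sup>+u. k u \<partial>(case w of (v, x) \<Rightarrow> distr (Q x) (MV \<Otimes>\<^sub>M MZ) (Pair v))) = (case w of (v, x) \<Rightarrow> \<integral>\<^sup>+z. k (v, z) \<partial>Q x)"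
    if "w \<in> space P" for w
  proof -
    obtain v x where w: "w = (v, x)" by (cases w)
    then have v: "v \<in> space MV" and x: "x \<in> space MX" using that by (auto simp: space_PX)
    note Pair_measurable_Q[OF v x]
    then show ?thesis unfolding w by (simp add: nn_integral_distr k)
  qed
  ultimately show ?thesis by (simp cong: measurable_cong)
qed

lemma prob_space_law_VZ: "prob_space (law_VZ MV MZ Q P)"
proof
  have "emeasure (law_VZ MV MZ Q P) (space (law_VZ MV MZ Q P)) = (\<integral>\<^sup>+u. 1 \<partial>law_VZ MV MZ Q P)"
    by simp
  also have "\<dots> = (\<integral>\<^sup>+(v, x). \<integral>\<^sup>+z. 1 \<partial>Q x \<partial>P)"
    by (rule nn_integral_law_VZ) simp
  also have "\<dots> = (\<integral>\<^sup>+w. 1 \<partial>P)"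
    by (rule nn_integral_cong) (auto simp: space_PX prob_space.emeasure_space_1[OF prob_Q])
  finally show "emeasure (law_VZ MV MZ Q P) (space (law_VZ MV MZ Q P)) = 1"
    by (simp add: prob_space.emeasure_space_1[OF P(1)])
qed

lemma fst_meas_P: "fst \<in> P \<rightarrow>\<^sub>M MV"
  by (subst measurable_cong_sets[OF P(2) refl]) simp

lemma fst_meas_law: "fst \<in> law_VZ MV MZ Q P \<rightarrow>\<^sub>M MV"
  by (subst measurable_cong_sets[OF sets_law_VZ refl]) simp

lemma distr_fst_law_VZ: "distr (law_VZ MV MZ Q P) MV fst = distr P MV fst"
proof (rule measure_eqI)
  fix A assume "A \<in> sets (distr (law_VZ MV MZ Q P) MV fst)"
  then have A: "A \<in> sets MV" by simp
  have "emeasure (distr (law_VZ MV MZ Q P) MV fst) A = (\<integral>\<^sup>+u. indicator A (fst u) \<partial>law_VZ MV MZ Q P)"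
    using nn_integral_distr[OF fst_meas_law, of "indicator A"] A by simp
  also have "\<dots> = (\<integral>\<^sup>+(v, x). \<integral>\<^sup>+z. indicator A (fst (v, z)) \<partial>Q x \<partial>P)"
    using A by (intro nn_integral_law_VZ measurable_compose[OF measurable_fst]) simp
  also have "\<dots> = (\<integral>\<^sup>+w. indicator A (fst w) \<partial>P)"
    by (rule nn_integral_cong) (auto simp: space_PX prob_space.emeasure_space_1[OF prob_Q])
  also have "\<dots> = emeasure (distr P MV fst) A"
    using nn_integral_distr[OF fst_meas_P, of "indicator A"] A by simp
  finally show "emeasure (distr (law_VZ MV MZ Q P) MV fst) A = emeasure (distr P MV fst) A" .
qed simp

lemma Q_op_measurable:
  assumes km: "k \<in> borel_measurable (MV \<Otimes>\<^sub>M MZ)"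
  shows "Q_op Q k \<in> borel_measurable P"
proof -
  have "(\<lambda>w. \<integral>u. k u \<partial>(case w of (v, x) \<Rightarrow> distr (Q x) (MV \<Otimes>\<^sub>M MZ) (Pair v))) \<in> borel_measurable P"
    by (rule measurable_compose[OF law_VZ_kernel[OF P(2) Q] integral_measurable_subprob_algebra[OF km]])
  moreover have "(\<integral>u. k u \<partial>(case w of (v, x) \<Rightarrow> distr (Q x) (MV \<Otimes>\<^sub>M MZ) (Pair v))) = Q_op Q k w"
    if "w \<in> space P" for w
  proof -
    obtain v x where w: "w = (v, x)" by (cases w)
    then have v: "v \<in> space MV" and x: "x \<in> space MX" using that by (auto simp: space_PX)
    note Pair_measurable_Q[OF v x]
    then show ?thesis unfolding w by (simp add: integral_distr km Q_op_def)
  qed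
  ultimately show ?thesis by (simp cong: measurable_cong)
qed

text \<open>Positive and negative parts are iterated as extended-real integrals. Their finiteness
  makes both inner integrals finite for almost every w, and there \<open>Q_op\<close> is the
  difference of the two.\<close>

lemma integral_law_VZ:
  assumes k: "integrable (law_VZ MV MZ Q P) k"
  shows "(\<integral>u. k u \<partial>law_VZ MV MZ Q P) = (\<integral>w. Q_op Q k w \<partial>P)"
proof -
  have km: "k \<in> borel_measurable (MV \<Otimes>\<^sub>M MZ)"
    using borel_measurable_integrable[OF k] measurable_cong_sets[OF sets_law_VZ refl] by auto
  define p n where "p = (\<lambda>(v, x). \<integral>\<^sup>+z. ennreal (k (v, z)) \<partial>Q x)" and "n = (\<lambda>(v, x). \<integral>\<^sup>+z. ennreal (- k (v, z)) \<partial>Q x)"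
  have kp: "(\<lambda>u. ennreal (k u)) \<in> borel_measurable (MV \<Otimes>\<^sub>M MZ)" "(\<lambda>u. ennreal (- k u)) \<in> borel_measurable (MV \<Otimes>\<^sub>M MZ)"
    using km by auto
  have pm: "p \<in> borel_measurable P" "n \<in> borel_measurable P"
    unfolding p_def n_def by (rule measurable_inner, rule kp)+
  have pos: "(\<integral>\<^sup>+u. ennreal (k u) \<partial>law_VZ MV MZ Q P) = (\<integral>\<^sup>+w. p w \<partial>P)"
    and neg: "(\<integral>\<^sup>+u. ennreal (- k u) \<partial>law_VZ MV MZ Q P) = (\<integral>\<^sup>+w. n w \<partial>P)"
    unfolding p_def n_def by (rule nn_integral_law_VZ, rule kp)+
  have fin: "(\<integral>\<^sup>+w. p w \<partial>P) < \<infinity>" "(\<integral>\<^sup>+w. n w \<partial>P) < \<infinity>"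
    using k unfolding pos[symmetric] neg[symmetric] by (auto simp: real_integrable_def less_top)
  have ae: "AE w in P. p w \<noteq> \<infinity>" "AE w in P. n w \<noteq> \<infinity>"
    using nn_integral_PInf_AE[OF pm(1)] nn_integral_PInf_AE[OF pm(2)] fin by auto
  have ip: "integrable P (\<lambda>w. enn2real (p w))" "integrable P (\<lambda>w. enn2real (n w))"
    and ep: "(\<integral>w. enn2real (p w) \<partial>P) = enn2real (\<integral>\<^sup>+w. p w \<partial>P)" "(\<integral>w. enn2real (n w) \<partial>P) = enn2real (\<integral>\<^sup>+w. n w \<partial>P)"
  proof -
    have e: "(\<integral>\<^sup>+w. ennreal (enn2real (p w)) \<partial>P) = (\<integral>\<^sup>+w. p w \<partial>P)" "(\<integral>\<^sup>+w. ennreal (enn2real (n w)) \<partial>P) = (\<integral>\<^sup>+w. n w \<partial>P)"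
      by (rule nn_integral_cong_AE, rule eventually_mono[OF ae(1)], simp add: less_top,
          rule nn_integral_cong_AE, rule eventually_mono[OF ae(2)], simp add: less_top)
    show "integrable P (\<lambda>w. enn2real (p w))" "integrable P (\<lambda>w. enn2real (n w))"
      using pm e fin by (auto intro!: integrableI_nonneg)
    show "(\<integral>w. enn2real (p w) \<partial>P) = enn2real (\<integral>\<^sup>+w. p w \<partial>P)" "(\<integral>w. enn2real (n w) \<partial>P) = enn2real (\<integral>\<^sup>+w. n w \<partial>P)"
      using pm e by (auto simp: integral_eq_nn_integral)
  qed
  have "(\<integral>u. k u \<partial>law_VZ MV MZ Q P) = (\<integral>w. enn2real (p w) - enn2real (n w) \<partial>P)"
    unfolding real_lebesgue_integral_def[OF k] pos neg using ip ep by simp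
  also have "\<dots> = (\<integral>w. Q_op Q k w \<partial>P)"
  proof (rule integral_cong_AE)
    show "AE w in P. enn2real (p w) - enn2real (n w) = Q_op Q k w"
      using ae AE_space
    proof eventually_elim
      case (elim w)
      obtain v x where w: "w = (v, x)" by (cases w)
      then have v: "v \<in> space MV" and x: "x \<in> space MX" using elim by (auto simp: space_PX)
      have "(\<lambda>z. k (v, z)) \<in> borel_measurable (Q x)"
        unfolding measurable_cong_sets[OF sets_Q[OF x] refl] by (rule measurable_Pair2[OF km v])
      then have "integrable (Q x) (\<lambda>z. k (v, z))"
        using elim by (auto simp: real_integrable_def p_def n_def w)
      from real_lebesgue_integral_def[OF this] show ?case
        by (simp add: w p_def n_def Q_op_def)
    qed
    show "Q_op Q k \<in> borel_measurable P" by (rule Q_op_measurable[OF km])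
  qed (use pm in measurable)
  finally show ?thesis .
qed

end

text \<open>\<open>dominated\<close> holds because the weights \<alpha> and 1 - \<alpha> are at most
  1. For \<open>unbiased\<close>, a finite second moment under the product law makes the sections
  integrable under \<open>Qbar\<close> for almost every v, and there \<open>inv_delta\<close> is a
  genuine right inverse of \<open>Q_op\<close>.\<close>

lemma private_law_delta:
  assumes P: "prob_space P" "sets P = sets (MV \<Otimes>\<^sub>M MX)" and D: "mech_delta MX MZ Q \<alpha> Qbar"
  shows "private_law MV MX MZ P (law_VZ MV MZ Q P) Qbar (1 / \<alpha>) ((1 - \<alpha>) / \<alpha>) (\<lambda>_ _. - ((1 - \<alpha>) / \<alpha>))"
proof -
  have Q: "Q \<in> MX \<rightarrow>\<^sub>M prob_algebra MZ" and SZ: "sets MZ = sets MX" and al: "0 < \<alpha>" "\<alpha> < 1"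
    and Pb: "prob_space Qbar" and Sb: "sets Qbar = sets MX"
    using D by (auto simp: mech_delta_def)
  interpret P: prob_space P by (rule P)
  interpret Qb: prob_space Qbar by (rule Pb)
  interpret PV: prob_space "distr P MV fst" by (rule P.prob_space_distr[OF fst_meas_P[OF P Q]])
  interpret pair_sigma_finite "distr P MV fst" Qbar ..
  let ?Z = "law_VZ MV MZ Q P"
  interpret Z: prob_space ?Z by (rule prob_space_law_VZ[OF P Q])
  have sp: "space P = space MV \<times> space MX" by (rule space_PX[OF P Q])
  have s2: "sets (distr P MV fst \<Otimes>\<^sub>M Qbar) = sets (MV \<Otimes>\<^sub>M MX)"
    by (intro sets_pair_measure_cong) (auto simp: Sb)
  have sZ: "sets (MV \<Otimes>\<^sub>M MZ) = sets (MV \<Otimes>\<^sub>M MX)"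
    by (intro sets_pair_measure_cong) (auto simp: SZ)
  note m2 = measurable_cong_sets[OF s2 refl] and mZ = measurable_cong_sets[OF sZ refl]
  show ?thesis
  proof unfold_locales
    show "sets P = sets (MV \<Otimes>\<^sub>M MX)" "sets Qbar = sets MX" by fact+
    show "sets ?Z = sets (MV \<Otimes>\<^sub>M MZ)" by (rule sets_law_VZ[OF P Q])
    show "1 / \<alpha> = 0 \<or> sets MZ = sets MX" using SZ by simp
    show "(\<lambda>(z, x). - ((1 - \<alpha>) / \<alpha>)) \<in> borel_measurable (MZ \<Otimes>\<^sub>M MX)" by simp
    show "\<bar>- ((1 - \<alpha>) / \<alpha>)\<bar> \<le> (1 - \<alpha>) / \<alpha>" using al by simp
    show "1 / \<alpha> + (\<integral>x. - ((1 - \<alpha>) / \<alpha>) \<partial>Qbar) = 1"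
      using al by (simp add: Qb.prob_space diff_divide_distrib)
    show "distr ?Z MV fst = distr P MV fst" by (rule distr_fst_law_VZ[OF P Q])
    show "(\<integral>\<^sup>+u. h u \<partial>?Z) \<le> (\<integral>\<^sup>+u. h u \<partial>P) + (\<integral>\<^sup>+u. h u \<partial>(distr P MV fst \<Otimes>\<^sub>M Qbar))"
      if h: "h \<in> borel_measurable (MV \<Otimes>\<^sub>M MX)" for h :: "_ \<Rightarrow> ennreal"
    proof -
      have hP: "h \<in> borel_measurable P" using h measurable_cong_sets[OF P(2) refl] by auto
      have h2: "h \<in> borel_measurable (distr P MV fst \<Otimes>\<^sub>M Qbar)" using h unfolding m2 .
      have sec: "(\<lambda>v. \<integral>\<^sup>+z. h (v, z) \<partial>Qbar) \<in> borel_measurable (distr P MV fst)"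
        by (rule Qb.borel_measurable_nn_integral_fst[OF h2])
      then have sec': "(\<lambda>w. \<integral>\<^sup>+z. h (fst w, z) \<partial>Qbar) \<in> borel_measurable P"
        by (intro measurable_compose[OF fst_meas_P[OF P Q]]) simp
      have "(\<integral>\<^sup>+u. h u \<partial>?Z) = (\<integral>\<^sup>+(v, x). \<integral>\<^sup>+z. h (v, z) \<partial>Q x \<partial>P)"
        by (rule nn_integral_law_VZ[OF P Q]) (use h in \<open>simp add: mZ\<close>)
      also have "\<dots> = (\<integral>\<^sup>+w. ennreal \<alpha> * h w + ennreal (1 - \<alpha>) * (\<integral>\<^sup>+z. h (fst w, z) \<partial>Qbar) \<partial>P)"
        by (rule nn_integral_cong) (auto simp: sp intro!: nn_integral_mech_delta[OF D] measurable_Pair2[OF h])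
      also have "\<dots> \<le> (\<integral>\<^sup>+w. h w + (\<integral>\<^sup>+z. h (fst w, z) \<partial>Qbar) \<partial>P)"
      proof (intro nn_integral_mono add_mono)
        have "c * y \<le> y" if "c \<le> 1" for c y :: ennreal
          using mult_right_mono[OF that, of y] by simp
        then show "ennreal \<alpha> * h w \<le> h w" "ennreal (1 - \<alpha>) * (\<integral>\<^sup>+z. h (fst w, z) \<partial>Qbar) \<le> (\<integral>\<^sup>+z. h (fst w, z) \<partial>Qbar)" for w
          using al by auto
      qed
      also have "\<dots> = (\<integral>\<^sup>+u. h u \<partial>P) + (\<integral>\<^sup>+w. \<integral>\<^sup>+z. h (fst w, z) \<partial>Qbar \<partial>P)"
        by (rule nn_integral_add[OF hP sec'])
      also have "(\<integral>\<^sup>+w. \<integral>\<^sup>+z. h (fst w, z) \<partial>Qbar \<partial>P) = (\<integral>\<^sup>+v. \<integral>\<^sup>+z. h (v, z) \<partial>Qbar \<partial>distr P MV fst)"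
        using sec by (intro nn_integral_distr[OF fst_meas_P[OF P Q], symmetric]) simp
      also have "\<dots> = (\<integral>\<^sup>+u. h u \<partial>(distr P MV fst \<Otimes>\<^sub>M Qbar))"
        by (rule Qb.nn_integral_fst[OF h2])
      finally show ?thesis .
    qed
    show "(\<integral>u. 1 / \<alpha> * h u + (\<integral>x. - ((1 - \<alpha>) / \<alpha>) * h (fst u, x) \<partial>Qbar) \<partial>?Z) = (\<integral>u. h u \<partial>P)"
      if h: "h \<in> borel_measurable (MV \<Otimes>\<^sub>M MX)"
        and int: "integrable ?Z (\<lambda>u. 1 / \<alpha> * h u + (\<integral>x. - ((1 - \<alpha>) / \<alpha>) * h (fst u, x) \<partial>Qbar))"
        and fin: "(\<integral>\<^sup>+u. ennreal ((h u)\<^sup>2) \<partial>(distr P MV fst \<Otimes>\<^sub>M Qbar)) < \<infinity>" for h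
    proof -
      have eq: "(\<lambda>u. 1 / \<alpha> * h u + (\<integral>x. - ((1 - \<alpha>) / \<alpha>) * h (fst u, x) \<partial>Qbar)) = inv_delta \<alpha> Qbar h"
        by (auto simp: inv_delta_def fun_eq_iff)
      have h2: "h \<in> borel_measurable (distr P MV fst \<Otimes>\<^sub>M Qbar)" using h unfolding m2 .
      have hP: "h \<in> borel_measurable P" using h measurable_cong_sets[OF P(2) refl] by auto
      have sm: "(\<lambda>u. ennreal ((h u)\<^sup>2)) \<in> borel_measurable (distr P MV fst \<Otimes>\<^sub>M Qbar)" using h2 by measurable
      have "AE v in distr P MV fst. (\<integral>\<^sup>+z. ennreal ((h (v, z))\<^sup>2) \<partial>Qbar) \<noteq> \<infinity>"
        using fin unfolding Qb.nn_integral_fst[OF sm, symmetric]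
        by (intro nn_integral_PInf_AE Qb.borel_measurable_nn_integral_fst[OF sm]) auto
      then have "AE w in P. (\<integral>\<^sup>+z. ennreal ((h (fst w, z))\<^sup>2) \<partial>Qbar) \<noteq> \<infinity>"
        by (rule AE_distrD[OF fst_meas_P[OF P Q]])
      then have ae: "AE w in P. Q_op Q (inv_delta \<alpha> Qbar h) w = h w"
        using AE_space
      proof eventually_elim
        case (elim w)
        obtain v x where w: "w = (v, x)" by (cases w)
        then have v: "v \<in> space MV" and x: "x \<in> space MX" using elim by (auto simp: sp)
        have m: "(\<lambda>z. h (v, z)) \<in> borel_measurable Qbar"
          unfolding measurable_cong_sets[OF Sb refl] by (rule measurable_Pair2[OF h v])
        have "integrable Qbar (\<lambda>z. (h (v, z))\<^sup>2)"
          using elim m by (intro integrableI_bounded) (auto simp: w less_top)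
        then have "integrable Qbar (\<lambda>z. h (v, z))"
          by (rule Qb.square_integrable_imp_integrable[OF m])
        from Q_op_inv_delta[OF D x this] show ?case by (simp add: w)
      qed
      show ?thesis
        unfolding eq integral_law_VZ[OF P Q int[unfolded eq]]
      proof (rule integral_cong_AE[OF _ hP ae])
        have "inv_delta \<alpha> Qbar h \<in> borel_measurable (MV \<Otimes>\<^sub>M MZ)"
          using borel_measurable_integrable[OF int[unfolded eq]] measurable_cong_sets[OF sets_law_VZ[OF P Q] refl] by auto
        then show "Q_op Q (inv_delta \<alpha> Qbar h) \<in> borel_measurable P" by (rule Q_op_measurable[OF P Q])
      qed
    qed
  qed
qed

lemma inv_delta_eq:
  "inv_delta \<alpha> Qb h = (\<lambda>u. 1 / \<alpha> * h u + (\<integral>x. - ((1 - \<alpha>) / \<alpha>) * h (fst u, x) \<partial>Qb))"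
  by (auto simp: inv_delta_def fun_eq_iff)

text \<open>The entries of the inverse transposed matrix; the factor CARD('j) undoes the averaging
  by the uniform measure.\<close>

definition kernel_J :: "('a \<Rightarrow> 'z measure) \<Rightarrow> ('j::finite \<Rightarrow> 'a) \<Rightarrow> ('j \<Rightarrow> 'z) \<Rightarrow> 'z \<Rightarrow> 'a \<Rightarrow> real" where
  "kernel_J Q xs zs z x = real CARD('j) * matrix_inv (transpose (mech_matrix Q xs zs)) $ inv zs z $ inv xs x"

lemma integral_kernel_J:
  fixes xs zs :: "'j::finite \<Rightarrow> 'a"
  assumes xs: "bij_betw xs UNIV X"
  shows "(\<integral>x. kernel_J Q xs zs z x * k x \<partial>uniform_count_measure X) =
    (matrix_inv (transpose (mech_matrix Q xs zs)) *v (\<chi> j. k (xs j))) $ inv zs z"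
proof -
  have X: "finite X" "card X = CARD('j)" and inj: "inj xs"
    using xs bij_betw_finite[OF xs] bij_betw_same_card[OF xs] by (auto simp: bij_betw_def)
  have "(\<integral>x. kernel_J Q xs zs z x * k x \<partial>uniform_count_measure X) =
      (\<Sum>x\<in>X. kernel_J Q xs zs z x * k x) / real CARD('j)"
    by (simp add: integral_uniform_count_measure X)
  also have "(\<Sum>x\<in>X. kernel_J Q xs zs z x * k x) = (\<Sum>j\<in>UNIV. kernel_J Q xs zs z (xs j) * k (xs j))"
    by (rule sum.reindex_bij_betw[OF xs, symmetric])
  finally show ?thesis
    by (simp add: kernel_J_def inv_f_f[OF inj] matrix_vector_mult_def sum_divide_distrib)
qed

lemma inv_J_eq:
  assumes xs: "bij_betw xs UNIV X"
  shows "inv_J Q xs zs h = (\<lambda>u. 0 * h u + (\<integral>x. kernel_J Q xs zs (snd u) x * h (fst u, x) \<partial>uniform_count_measure X))"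
  by (auto simp: inv_J_def fun_eq_iff integral_kernel_J[OF xs])

text \<open>With a = 0 the clause \<open>dominated\<close> is void, and \<open>unbiased\<close>
  follows from \<open>Q_op_inv_J\<close>, valid for every h because integrals over the finite space
  are sums.\<close>

lemma private_law_J:
  fixes xs zs :: "'j::finite \<Rightarrow> 'a"
  assumes P: "prob_space P" "sets P = sets (MV \<Otimes>\<^sub>M MX)" and J: "mech_J MV MX MZ P Q xs zs"
  shows "\<exists>B. private_law MV MX MZ P (law_VZ MV MZ Q P) (uniform_count_measure (space MX)) 0 B (kernel_J Q xs zs)"
proof -
  have Q: "Q \<in> MX \<rightarrow>\<^sub>M prob_algebra MZ" and SZ: "sets MZ = Pow (space MZ)" and SX: "sets MX = Pow (space MX)"
    and xs: "bij_betw xs UNIV (space MX)" and zs: "bij_betw zs UNIV (space MZ)"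
    and inv: "invertible (mech_matrix Q xs zs)"
    using J by (auto simp: mech_J_def)
  have finX: "finite (space MX)" "finite (space MZ)" "space MX \<noteq> {}"
    using bij_betw_finite[OF xs] bij_betw_finite[OF zs] xs by (auto simp: bij_betw_def)
  let ?Z = "law_VZ MV MZ Q P"
  define A where "A = transpose (mech_matrix Q xs zs)"
  \<comment> \<open>The sum of all absolute entries bounds each of them, also at arguments outside
    the finite spaces, where \<open>inv\<close> still returns some index.\<close>
  define B where "B = (\<Sum>i\<in>UNIV. \<Sum>k\<in>UNIV. \<bar>real CARD('j) * matrix_inv A $ i $ k\<bar>)"
  interpret P: prob_space P by (rule P)
  interpret Z: prob_space ?Z by (rule prob_space_law_VZ[OF P Q])
  interpret Qb: prob_space "uniform_count_measure (space MX)"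
    by (rule prob_space_uniform_count_measure) (use finX in auto)
  have AA: "matrix_inv A ** A = mat 1"
    using transpose_invertible[OF inv] unfolding A_def invertible_def matrix_inv_def
    by (metis (mono_tags, lifting) someI_ex)
  \<comment> \<open>Row k of the transposed matrix lists the point probabilities of
    \<open>Q (xs k)\<close>. That A, and hence its inverse, fixes the constant vector gives
    \<open>\<kappa>_const\<close>.\<close>
  have A1: "A *v (\<chi> j. 1) = (\<chi> j. 1)"
  proof -
    have "(\<Sum>j\<in>UNIV. measure (Q (xs k)) {zs j}) = 1" for k
    proof -
      have x: "xs k \<in> space MX" using xs by (auto simp: bij_betw_def)
      have sQ: "sets (Q (xs k)) = Pow (space MZ)" and spQ: "space (Q (xs k)) = space MZ"
        using sets_Q[OF P Q x] SZ sets_eq_imp_space_eq[OF sets_Q[OF P Q x]] by auto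
      interpret Qx: prob_space "Q (xs k)" by (rule prob_Q[OF P Q x])
      have "(\<Sum>j\<in>UNIV. measure (Q (xs k)) {zs j}) = (\<Sum>z\<in>space MZ. measure (Q (xs k)) {z})"
        by (rule sum.reindex_bij_betw[OF zs])
      also have "\<dots> = measure (Q (xs k)) (space MZ)"
        by (rule Qx.finite_measure_eq_sum_singleton[symmetric]) (use finX sQ in auto)
      finally show ?thesis using Qx.prob_space by (simp add: spQ)
    qed
    then show ?thesis
      by (simp add: A_def matrix_vector_mult_def transpose_def mech_matrix_def vec_eq_iff)
  qed
  have inv1: "matrix_inv A *v (\<chi> j. 1) = (\<chi> j. 1)"
    using AA A1 by (metis matrix_vector_mul_assoc matrix_vector_mul_lid)
  have "private_law MV MX MZ P ?Z (uniform_count_measure (space MX)) 0 B (kernel_J Q xs zs)"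
  proof unfold_locales
    show "sets P = sets (MV \<Otimes>\<^sub>M MX)" by fact
    show "sets ?Z = sets (MV \<Otimes>\<^sub>M MZ)" by (rule sets_law_VZ[OF P Q])
    show "sets (uniform_count_measure (space MX)) = sets MX" by (simp add: SX sets_uniform_count_measure)
    show "(\<lambda>(z, x). kernel_J Q xs zs z x) \<in> borel_measurable (MZ \<Otimes>\<^sub>M MX)"
    proof -
      have "sets (MZ \<Otimes>\<^sub>M MX) = sets (count_space (space MZ) \<Otimes>\<^sub>M count_space (space MX))"
        by (intro sets_pair_measure_cong) (simp_all add: SZ SX)
      also have "\<dots> = sets (count_space (space MZ \<times> space MX))"
        by (subst pair_measure_count_space) (use finX in simp_all)
      finally have eq: "sets (MZ \<Otimes>\<^sub>M MX) = sets (count_space (space MZ \<times> space MX))" .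
      show ?thesis unfolding measurable_cong_sets[OF eq refl] by simp
    qed
    show "\<bar>kernel_J Q xs zs z x\<bar> \<le> B" for z x
    proof -
      have "\<bar>kernel_J Q xs zs z x\<bar> \<le> (\<Sum>k\<in>UNIV. \<bar>real CARD('j) * matrix_inv A $ inv zs z $ k\<bar>)"
        unfolding kernel_J_def A_def[symmetric]
        by (rule member_le_sum[where f = "\<lambda>k. \<bar>real CARD('j) * matrix_inv A $ inv zs z $ k\<bar>"]) auto
      also have "\<dots> \<le> B"
        unfolding B_def
        by (rule member_le_sum[where f = "\<lambda>i. \<Sum>k\<in>UNIV. \<bar>real CARD('j) * matrix_inv A $ i $ k\<bar>"]) (auto intro: sum_nonneg)
      finally show ?thesis .
    qed
    show "0 + (\<integral>x. kernel_J Q xs zs z x \<partial>uniform_count_measure (space MX)) = 1" for z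
      using integral_kernel_J[OF xs, of Q zs z "\<lambda>_. 1"] inv1 by (simp add: A_def)
    show "distr ?Z MV fst = distr P MV fst" by (rule distr_fst_law_VZ[OF P Q])
    show "(\<integral>u. 0 * h u + (\<integral>x. kernel_J Q xs zs (snd u) x * h (fst u, x) \<partial>uniform_count_measure (space MX)) \<partial>?Z) = (\<integral>u. h u \<partial>P)"
      if "integrable ?Z (\<lambda>u. 0 * h u + (\<integral>x. kernel_J Q xs zs (snd u) x * h (fst u, x) \<partial>uniform_count_measure (space MX)))" for h
      using that unfolding inv_J_eq[OF xs, symmetric]
      by (subst integral_law_VZ[OF P Q])
        (auto intro!: Bochner_Integration.integral_cong simp: space_PX[OF P Q] Q_op_inv_J[OF J])
  qed auto
  then show ?thesis by blast
qed

section \<open>Comparison of norms\<close>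

lemma nn_integral_le_L2_norm:
  "(\<integral>\<^sup>+w. ennreal ((h w)\<^sup>2) \<partial>R) \<le> (L2_norm R h)\<^sup>2"
proof (cases "h \<in> L2 R")
  case True
  then have "(\<integral>\<^sup>+w. ennreal ((h w)\<^sup>2) \<partial>R) = ennreal (\<integral>w. (h w)\<^sup>2 \<partial>R)"
    by (intro nn_integral_eq_integral) (auto simp: L2_def)
  also have "\<dots> = (L2_norm R h)\<^sup>2"
    using True by (simp add: L2_norm_def ennreal_power)
  finally show ?thesis by simp
qed (simp add: L2_norm_def power2_eq_square ennreal_top_mult)

lemma (in prob_space) nn_integral_le_sup_norm:
  "(\<integral>\<^sup>+w. ennreal ((h w)\<^sup>2) \<partial>M) \<le> (sup_norm (space M) h)\<^sup>2"
proof -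
  have "(\<integral>\<^sup>+w. ennreal ((h w)\<^sup>2) \<partial>M) \<le> (\<integral>\<^sup>+w. (sup_norm (space M) h)\<^sup>2 \<partial>M)"
  proof (rule nn_integral_mono)
    fix w assume "w \<in> space M"
    then have "ennreal \<bar>h w\<bar> \<le> sup_norm (space M) h"
      unfolding sup_norm_def by (rule SUP_upper)
    then have "(ennreal \<bar>h w\<bar>)\<^sup>2 \<le> (sup_norm (space M) h)\<^sup>2" by (rule power_mono) simp
    then show "ennreal ((h w)\<^sup>2) \<le> (sup_norm (space M) h)\<^sup>2" by (simp add: ennreal_power)
  qed
  then show ?thesis by (simp add: emeasure_space_1)
qed

lemma sup_norm_bound: "w \<in> S \<Longrightarrow> sup_norm S h \<le> ennreal c \<Longrightarrow> 0 \<le> c \<Longrightarrow> \<bar>h w\<bar> \<le> c"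
  using order_trans[OF SUP_upper[of w S "\<lambda>w. ennreal \<bar>h w\<bar>"], of "ennreal c"] unfolding sup_norm_def
  by (simp add: ennreal_le_iff)

context private_law
begin

lemma AE_finite_support:
  assumes A: "finite A" "\<And>v. v \<in> A \<Longrightarrow> {v} \<in> sets MV" "measure P (A \<times> space MX) = 1"
  shows "AE w in P. w \<in> A \<times> space MX" "AE w in P2. w \<in> A \<times> space MX"
proof -
  have Am: "A \<in> sets MV"
  proof -
    have "(\<Union>v\<in>A. {v}) \<in> sets MV" using A(1,2) by (intro sets.finite_UN) auto
    then show ?thesis by simp
  qed
  then have AX: "A \<times> space MX \<in> sets P" by (simp add: P(2))
  show "AE w in P. w \<in> A \<times> space MX"
    using P.AE_in_set_eq_1[OF AX] A(3) by simp
  have "emeasure P2 (A \<times> space MX) = emeasure PV A * emeasure Qb (space MX)"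
    unfolding P2_def using Am by (intro Qb.emeasure_pair_measure_Times) (auto simp: sets_PV Qb(2))
  also have "emeasure PV A = emeasure P (A \<times> space MX)"
    unfolding PV_def using Am sets.sets_into_space[OF Am]
    by (subst emeasure_distr[OF fst_meas]) (auto intro!: arg_cong[where f = "emeasure P"] simp: space_P)
  also have "emeasure Qb (space MX) = 1"
    using Qb.emeasure_space_1 sets_eq_imp_space_eq[OF Qb(2)] by simp
  finally have eq: "emeasure P2 (A \<times> space MX) = emeasure P (A \<times> space MX)" by simp
  have "measure P2 (A \<times> space MX) = measure P (A \<times> space MX)"
    by (simp only: measure_def eq)
  then have "measure P2 (A \<times> space MX) = 1" using A(3) by simp
  moreover have "A \<times> space MX \<in> sets P2" using AX by (simp add: sets_P2)
  ultimately show "AE w in P2. w \<in> A \<times> space MX"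
    using P2.AE_in_set_eq_1 by simp
qed

text \<open>Both laws give full mass to one finite set, on which any function is bounded; hence the
  claim for arbitrary \<open>k\<close>.\<close>

lemma sqn_finite_support:
  assumes A: "finite A" "\<And>v. v \<in> A \<Longrightarrow> {v} \<in> sets MV" "measure P (A \<times> space MX) = 1"
    and X: "finite (space MX)"
  shows "sqn k < \<infinity>"
proof -
  let ?F = "A \<times> space MX"
  define c where "c = (\<Sum>w\<in>?F. (k w)\<^sup>2)"
  have le: "ennreal ((k w)\<^sup>2) \<le> ennreal c" if "w \<in> ?F" for w
    unfolding c_def by (intro ennreal_leI member_le_sum[OF that]) (use A(1) X in auto)
  have ae: "AE w in P. w \<in> ?F" "AE w in P2. w \<in> ?F"
    by (rule AE_finite_support[OF A]; assumption)+
  have "AE w in P. ennreal ((k w)\<^sup>2) \<le> ennreal c"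
    using ae(1) by eventually_elim (rule le)
  then have "(\<integral>\<^sup>+w. ennreal ((k w)\<^sup>2) \<partial>P) \<le> (\<integral>\<^sup>+w. ennreal c \<partial>P)"
    by (rule nn_integral_mono_AE)
  moreover have "AE w in P2. ennreal ((k w)\<^sup>2) \<le> ennreal c"
    using ae(2) by eventually_elim (rule le)
  then have "(\<integral>\<^sup>+w. ennreal ((k w)\<^sup>2) \<partial>P2) \<le> (\<integral>\<^sup>+w. ennreal c \<partial>P2)"
    by (rule nn_integral_mono_AE)
  ultimately show ?thesis
    unfolding sqn_def by (auto simp: P.emeasure_space_1 P2.emeasure_space_1 intro: le_less_trans)
qed

text \<open>\<open>P2\<close> spreads the mass of the row over v across all x. It is dominated by P
  once no point of a charged row is null, which is what \<open>positive_density\<close> says;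
  finiteness of the support turns this into a single constant.\<close>

lemma P2_dominated:
  assumes A: "finite A" "\<And>v. v \<in> A \<Longrightarrow> {v} \<in> sets MV" "measure P (A \<times> space MX) = 1" "A \<subseteq> space MV"
    and X: "finite (space MX)" "sets MX = Pow (space MX)"
    and pos: "positive_density MV MX P"
  shows "\<exists>C::real. C \<ge> 0 \<and> (\<forall>k\<in>borel_measurable P. (\<integral>\<^sup>+w. k w \<partial>P2) \<le> ennreal C * (\<integral>\<^sup>+w. k w \<partial>P))"
proof -
  let ?F = "A \<times> space MX"
  have ae: "AE w in P. w \<in> ?F"
    by (rule AE_finite_support(1)[OF A(1-3)]; assumption)
  have single: "{w} \<in> sets P" if "w \<in> ?F" for w
  proof -
    have "{fst w} \<times> {snd w} \<in> sets (MV \<Otimes>\<^sub>M MX)"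
      by (rule pair_measureI) (use that A(2) X(2) in auto)
    moreover have "{fst w} \<times> {snd w} = {w}" by (cases w) auto
    ultimately show ?thesis by (simp add: P(2))
  qed
  have row: "{v} \<times> space MX \<in> sets P" if "v \<in> A" for v using A(2)[OF that] by (simp add: P(2))
  \<comment> \<open>At a null point the constant 0 serves: by positivity of the density the whole
    row is null.\<close>
  have "\<exists>C\<ge>0. measure P ({fst w} \<times> space MX) \<le> C * measure P {w}" if w: "w \<in> ?F" for w
  proof (cases "measure P {w} > 0")
    case True
    then show ?thesis
      by (intro exI[of _ "measure P ({fst w} \<times> space MX) / measure P {w}"]) simp
  next
    case False
    have "measure P {(fst w, x)} = 0" if "x \<in> space MX" for x
    proof (rule ccontr)
      assume "measure P {(fst w, x)} \<noteq> 0"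
      then have "measure P {(fst w, x)} > 0" by (simp add: zero_less_measure_iff)
      then have "measure P {(fst w, snd w)} > 0"
        using pos that w A(4) unfolding positive_density_def by (auto simp: subset_iff)
      then show False using False by simp
    qed
    moreover have "measure P ({fst w} \<times> space MX) = (\<Sum>x\<in>space MX. measure P {(fst w, x)})"
    proof -
      have "measure P ({fst w} \<times> space MX) = (\<Sum>u\<in>{fst w} \<times> space MX. measure P {u})"
        by (rule P.finite_measure_eq_sum_singleton) (use X w in \<open>auto intro!: single\<close>)
      also have "\<dots> = (\<Sum>x\<in>space MX. measure P {(fst w, x)})"
      proof -
        have "{fst w} \<times> space MX = Pair (fst w) ` space MX" by auto
        then show ?thesis by (simp add: sum.reindex inj_on_def)
      qed
      finally show ?thesis .
    qed
    ultimately show ?thesis by (intro exI[of _ 0]) simp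
  qed
  then obtain c where c: "\<And>w. w \<in> ?F \<Longrightarrow> 0 \<le> c w \<and> measure P ({fst w} \<times> space MX) \<le> c w * measure P {w}"
    by metis
  define C where "C = sum c ?F"
  have fF: "finite ?F" using A(1) X(1) by simp
  have C: "C \<ge> 0" "\<And>w. w \<in> ?F \<Longrightarrow> measure P ({fst w} \<times> space MX) \<le> C * measure P {w}"
  proof -
    show "C \<ge> 0" unfolding C_def by (intro sum_nonneg) (use c in blast)
    fix w assume w: "w \<in> ?F"
    have "c w \<le> C" unfolding C_def by (rule member_le_sum[OF w _ fF]) (use c in blast)
    then have "c w * measure P {w} \<le> C * measure P {w}" by (rule mult_right_mono) simp
    then show "measure P ({fst w} \<times> space MX) \<le> C * measure P {w}" using c[OF w] by simp
  qed
  have "(\<integral>\<^sup>+w. k w \<partial>P2) \<le> ennreal C * (\<integral>\<^sup>+w. k w \<partial>P)" if k: "k \<in> borel_measurable P" for k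
  proof -
    have k2: "k \<in> borel_measurable (PV \<Otimes>\<^sub>M Qb)"
      using k unfolding measurable_P2_iff[symmetric] P2_def .
    have sec: "(\<lambda>v. \<integral>\<^sup>+x. k (v, x) \<partial>Qb) \<in> borel_measurable PV"
      by (rule Qb.borel_measurable_nn_integral_fst[OF k2])
    have spQ: "space Qb = space MX" by (rule sets_eq_imp_space_eq[OF Qb(2)])
    have "(\<integral>\<^sup>+w. k w \<partial>P2) = (\<integral>\<^sup>+v. \<integral>\<^sup>+x. k (v, x) \<partial>Qb \<partial>PV)"
      unfolding P2_def by (rule Qb.nn_integral_fst[OF k2, symmetric])
    also have "\<dots> = (\<integral>\<^sup>+w. \<integral>\<^sup>+x. k (fst w, x) \<partial>Qb \<partial>P)"
      unfolding PV_def by (rule nn_integral_distr[OF fst_meas]) (use sec in \<open>simp add: PV_def\<close>)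
    also have "\<dots> \<le> (\<integral>\<^sup>+w. (\<Sum>u\<in>?F. k u * indicator ({fst u} \<times> space MX) w) \<partial>P)"
    proof (rule nn_integral_mono_AE, rule eventually_mono[OF ae])
      fix w assume w: "w \<in> ?F"
      \<comment> \<open>Each value is at most the sum over its row, and \<open>Qb\<close> is a
        probability measure; this rough bound avoids the weights of \<open>Qb\<close>.\<close>
      have "(\<integral>\<^sup>+x. k (fst w, x) \<partial>Qb) \<le> (\<integral>\<^sup>+x. (\<Sum>x\<in>space MX. k (fst w, x)) \<partial>Qb)"
        by (intro nn_integral_mono member_le_sum[where f = "\<lambda>x. k (fst w, x)"]) (auto simp: spQ X)
      also have "\<dots> = (\<Sum>x\<in>space MX. k (fst w, x))" by (simp add: Qb.emeasure_space_1)
      also have "\<dots> = (\<Sum>u\<in>{fst w} \<times> space MX. k u * indicator ({fst u} \<times> space MX) w)"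
      proof -
        have "{fst w} \<times> space MX = Pair (fst w) ` space MX" by auto
        then show ?thesis using w by (auto simp: sum.reindex inj_on_def intro!: sum.cong)
      qed
      also have "\<dots> \<le> (\<Sum>u\<in>?F. k u * indicator ({fst u} \<times> space MX) w)"
        by (rule sum_mono2) (use fF w in auto)
      finally show "(\<integral>\<^sup>+x. k (fst w, x) \<partial>Qb) \<le> (\<Sum>u\<in>?F. k u * indicator ({fst u} \<times> space MX) w)" .
    qed
    also have "\<dots> = (\<Sum>u\<in>?F. k u * emeasure P ({fst u} \<times> space MX))"
      by (subst nn_integral_sum) (use k row in \<open>auto intro!: sum.cong nn_integral_cmult_indicator\<close>)
    also have "\<dots> \<le> (\<Sum>u\<in>?F. ennreal C * (k u * emeasure P {u}))"
    proof (rule sum_mono)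
      fix u assume u: "u \<in> ?F"
      have "emeasure P ({fst u} \<times> space MX) \<le> ennreal C * emeasure P {u}"
        using C(2)[OF u] C(1) by (simp add: P.emeasure_eq_measure ennreal_leI flip: ennreal_mult)
      then have "k u * emeasure P ({fst u} \<times> space MX) \<le> k u * (ennreal C * emeasure P {u})"
        by (rule mult_left_mono) simp
      then show "k u * emeasure P ({fst u} \<times> space MX) \<le> ennreal C * (k u * emeasure P {u})"
        by (simp add: mult_ac)
    qed
    also have "\<dots> = ennreal C * (\<integral>\<^sup>+w. (\<Sum>u\<in>?F. k u * indicator {u} w) \<partial>P)"
      by (subst nn_integral_sum)
        (use single in \<open>auto simp: sum_distrib_left intro!: sum.cong nn_integral_cmult_indicator[symmetric]\<close>)
    also have "\<dots> \<le> ennreal C * (\<integral>\<^sup>+w. k w \<partial>P)"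
    proof (intro mult_left_mono nn_integral_mono)
      fix w
      have "(\<Sum>u\<in>?F. k u * indicator {u} w) = (\<Sum>u\<in>?F. if u = w then k w else 0)"
        by (rule sum.cong) (auto split: split_indicator)
      also have "\<dots> \<le> k w" using fF by (simp add: sum.delta)
      finally show "(\<Sum>u\<in>?F. k u * indicator {u} w) \<le> k w" .
    qed simp
    finally show ?thesis .
  qed
  then show ?thesis using C(1) by blast
qed

text \<open>The derivative at \<open>\<gamma>\<^sub>c\<close> differs little from its average over a small segment, and that average is
  a difference quotient of \<open>f\<close>. This gives square integrability of \<open>\<partial>\<^sub>\<gamma> f\<close> under the second law, where
  no integrability is assumed. It needs \<open>\<Gamma>\<close> to be nondegenerate.\<close>

lemma derivative_sqn_finite:
  assumes \<Gamma>: "is_interval \<Gamma>" "\<gamma>c \<in> \<Gamma>" "\<Gamma> \<noteq> {\<gamma>c}"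
    and smooth: "AE w in P. C2_in_gamma \<Gamma> (F w) (F' w) (F'' w)" "AE w in P2. C2_in_gamma \<Gamma> (F w) (F' w) (F'' w)"
    and meas: "\<And>s. s \<in> \<Gamma> \<Longrightarrow> (\<lambda>w. F w s) \<in> borel_measurable P" "\<And>s. s \<in> \<Gamma> \<Longrightarrow> (\<lambda>w. F' w s) \<in> borel_measurable P"
    and \<delta>: "\<delta> > 0" "\<And>s. s \<in> \<Gamma> \<Longrightarrow> \<bar>s - \<gamma>c\<bar> \<le> \<delta> \<Longrightarrow>
      sqn (\<lambda>w. F w s - F w \<gamma>c) \<le> 1 \<and> sqn (\<lambda>w. F' w s - F' w \<gamma>c) \<le> 1"
  shows "sqn (\<lambda>w. F' w \<gamma>c) < \<infinity>"
proof -
  obtain \<gamma>1 where \<gamma>1: "\<gamma>1 \<in> \<Gamma>" "\<gamma>1 \<noteq> \<gamma>c" using \<Gamma> by blast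
  \<comment> \<open>The point \<gamma> below thus lies on the segment from \<open>\<gamma>c\<close>
    to \<open>\<gamma>1\<close>, differs from \<open>\<gamma>c\<close>, and stays within \<delta> of
    it.\<close>
  define t where "t = min 1 (\<delta> / \<bar>\<gamma>1 - \<gamma>c\<bar>)"
  define \<gamma> where "\<gamma> = \<gamma>c + t * (\<gamma>1 - \<gamma>c)"
  have t: "0 < t" "t \<le> 1" "t * \<bar>\<gamma>1 - \<gamma>c\<bar> \<le> \<delta>"
    using \<gamma>1 \<delta>(1) by (auto simp: t_def min_def field_simps)
  have sub: "closed_segment \<gamma>c \<gamma>1 \<subseteq> \<Gamma>"
    using \<Gamma> \<gamma>1 by (simp add: closed_segment_subset is_interval_convex)
  have "\<gamma> \<in> closed_segment \<gamma>c \<gamma>1"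
    unfolding in_segment \<gamma>_def using t by (intro exI[of _ t]) (auto simp: algebra_simps)
  then have \<gamma>\<Gamma>: "\<gamma> \<in> \<Gamma>" using sub by blast
  have \<gamma>: "\<gamma> \<noteq> \<gamma>c" "\<bar>\<gamma> - \<gamma>c\<bar> \<le> \<delta>" using t \<gamma>1 by (auto simp: \<gamma>_def abs_mult)
  have seg: "s \<in> \<Gamma> \<and> \<bar>s - \<gamma>c\<bar> \<le> \<delta>" if "s \<in> closed_segment \<gamma>c \<gamma>" for s
    by (rule closed_segment_near[OF \<Gamma>(1,2) \<gamma>\<Gamma> \<gamma>(2) that])
  let ?k = "\<lambda>w. F' w \<gamma>c"
  let ?X = "\<lambda>w. F w \<gamma> - F w \<gamma>c - (\<gamma> - \<gamma>c) * ?k w"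
  have le: "(\<integral>\<^sup>+w. ennreal ((?X w)\<^sup>2) \<partial>R) \<le> ennreal ((\<gamma> - \<gamma>c)\<^sup>2) * 1"
    if sm: "AE w in R. C2_in_gamma \<Gamma> (F w) (F' w) (F'' w)" and mR: "(borel_measurable R :: ('v \<times> 'a \<Rightarrow> real) set) = borel_measurable P"
      and sq: "\<And>h. (\<integral>\<^sup>+w. ennreal ((h w)\<^sup>2) \<partial>R) \<le> sqn h" for R
    by (rule nn_integral_first_order_remainder_le[OF \<Gamma>(1,2) \<gamma>\<Gamma> sm])
      (use meas \<Gamma>(2) seg \<delta>(2) in \<open>auto simp: mR intro: order_trans[OF sq]\<close>)
  have "(\<integral>\<^sup>+w. ennreal ((?X w)\<^sup>2) \<partial>P) \<le> ennreal ((\<gamma> - \<gamma>c)\<^sup>2) * 1"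
    by (rule le[OF smooth(1)]) (simp_all add: sqn_def)
  moreover have "(\<integral>\<^sup>+w. ennreal ((?X w)\<^sup>2) \<partial>P2) \<le> ennreal ((\<gamma> - \<gamma>c)\<^sup>2) * 1"
    by (rule le[OF smooth(2)]) (simp_all add: sqn_def measurable_P2_iff)
  ultimately have X: "sqn ?X < \<infinity>"
    unfolding sqn_def[of ?X] by (auto intro: le_less_trans)
  have Xm: "?X \<in> borel_measurable P" and Dm: "(\<lambda>w. F w \<gamma> - F w \<gamma>c) \<in> borel_measurable P"
    using meas \<Gamma>(2) \<gamma>\<Gamma> by auto
  have "sqn (\<lambda>w. F w \<gamma> - F w \<gamma>c) < \<infinity>"
    using \<delta>(2)[OF \<gamma>\<Gamma> \<gamma>(2)] by (auto intro: le_less_trans)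
  then have "2 * sqn (\<lambda>w. F w \<gamma> - F w \<gamma>c) + 2 * sqn ?X < \<infinity>"
    using X by (simp add: ennreal_mult_less_top)
  then have fin: "sqn (\<lambda>w. (F w \<gamma> - F w \<gamma>c) - ?X w) < \<infinity>"
    using sqn_diff_le[OF Dm Xm] by (rule le_less_trans[rotated])
  \<comment> \<open>The derivative is the difference quotient minus the scaled remainder, and both
    have finite \<open>sqn\<close>.\<close>
  have "?k = (\<lambda>w. 1 / (\<gamma> - \<gamma>c) * ((F w \<gamma> - F w \<gamma>c) - ?X w))"
    using \<gamma>(1) by (auto simp: fun_eq_iff)
  then have "sqn ?k \<le> ennreal ((1 / (\<gamma> - \<gamma>c))\<^sup>2) * sqn (\<lambda>w. (F w \<gamma> - F w \<gamma>c) - ?X w)"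
    using sqn_cmult[OF borel_measurable_diff[OF Dm Xm], of "1 / (\<gamma> - \<gamma>c)"] by simp
  also have "\<dots> < \<infinity>" using fin by (simp add: ennreal_mult_less_top)
  finally show ?thesis .
qed

lemma sqn_mult_sup_le:
  assumes h: "h \<in> borel_measurable P"
    and s: "\<And>w. w \<in> space P \<Longrightarrow> ennreal \<bar>k w\<bar> \<le> s"
  shows "sqn (\<lambda>w. h w * k w) \<le> s\<^sup>2 * sqn h"
proof -
  have "(\<integral>\<^sup>+w. ennreal ((h w * k w)\<^sup>2) \<partial>R) \<le> s\<^sup>2 * (\<integral>\<^sup>+w. ennreal ((h w)\<^sup>2) \<partial>R)"
    if R: "h \<in> borel_measurable R" "space R = space P" for R
  proof -
    have "(\<integral>\<^sup>+w. ennreal ((h w * k w)\<^sup>2) \<partial>R) \<le> (\<integral>\<^sup>+w. s\<^sup>2 * ennreal ((h w)\<^sup>2) \<partial>R)"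
    proof (rule nn_integral_mono)
      fix w assume "w \<in> space R"
      then have "(ennreal \<bar>k w\<bar>)\<^sup>2 \<le> s\<^sup>2" using s R(2) by (intro power_mono) auto
      then have "ennreal ((h w)\<^sup>2) * ennreal ((k w)\<^sup>2) \<le> ennreal ((h w)\<^sup>2) * s\<^sup>2"
        by (intro mult_left_mono) (simp_all add: ennreal_power)
      then show "ennreal ((h w * k w)\<^sup>2) \<le> s\<^sup>2 * ennreal ((h w)\<^sup>2)"
        by (simp add: power_mult_distrib ennreal_mult mult.commute)
    qed
    then show ?thesis using R by (simp add: nn_integral_cmult)
  qed
  from add_mono[OF this[of P] this[of P2]] h show ?thesis
    by (simp add: sqn_def measurable_P2_iff space_P2 distrib_left)
qed

end

section \<open>Conditional means and functions of the coordinates\<close>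

text \<open>The defining property of conditional expectation for a factor that is a function of T.
  Integrability is required of the product only, so h itself may fail to be integrable.\<close>

lemma cond_mean_integral:
  assumes P: "prob_space P" and T: "T \<in> P \<rightarrow>\<^sub>M N" and cm: "cond_mean P T N h \<phi>"
    and h: "h \<in> borel_measurable P" and k: "k \<in> borel_measurable N"
    and int: "integrable P (\<lambda>w. k (T w) * h w)"
  shows "(\<integral>w. k (T w) * \<phi> (T w) \<partial>P) = (\<integral>w. k (T w) * h w \<partial>P)"
proof -
  interpret P: prob_space P by (rule P)
  define F where "F = vimage_algebra (space P) T N"
  have sub: "subalgebra P F"
    using T unfolding subalgebra_def F_def by (simp add: measurable_iff_sets)
  interpret F: finite_measure_subalgebra P F
    by unfold_locales (rule sub)
  have TF: "T \<in> F \<rightarrow>\<^sub>M N"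
    unfolding F_def by (rule measurable_vimage_algebra1) (use measurable_space[OF T] in auto)
  have kF: "(\<lambda>w. k (T w)) \<in> borel_measurable F"
    by (rule measurable_compose[OF TF k])
  have \<phi>: "\<phi> \<in> borel_measurable N" and ae: "AE w in P. real_cond_exp P F h w = \<phi> (T w)"
    using cm by (auto simp: cond_mean_def F_def)
  have "(\<integral>w. k (T w) * \<phi> (T w) \<partial>P) = (\<integral>w. k (T w) * real_cond_exp P F h w \<partial>P)"
  proof (rule integral_cong_AE)
    have kP: "(\<lambda>w. k (T w)) \<in> borel_measurable P" by (rule measurable_compose[OF T k])
    show "(\<lambda>w. k (T w) * \<phi> (T w)) \<in> borel_measurable P"
      using kP measurable_compose[OF T \<phi>] by simp
    show "(\<lambda>w. k (T w) * real_cond_exp P F h w) \<in> borel_measurable P" using kP by simp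
    show "AE w in P. k (T w) * \<phi> (T w) = k (T w) * real_cond_exp P F h w"
      using ae by eventually_elim simp
  qed
  also have "\<dots> = (\<integral>w. k (T w) * h w \<partial>P)"
    by (rule F.real_cond_exp_intg(2)[OF int kF h])
  finally show ?thesis .
qed

lemma L2_norm_le:
  assumes "h \<in> borel_measurable R" "(\<integral>\<^sup>+w. ennreal ((h w)\<^sup>2) \<partial>R) \<le> ennreal (c\<^sup>2)" "c \<ge> 0"
  shows "L2_norm R h \<le> ennreal c"
proof -
  have i: "integrable R (\<lambda>w. (h w)\<^sup>2)"
    using assms by (intro integrableI_bounded) (auto intro: le_less_trans)
  have "(\<integral>w. (h w)\<^sup>2 \<partial>R) \<le> c\<^sup>2"
    using assms(2) i by (simp add: nn_integral_eq_integral ennreal_le_iff)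
  then have "sqrt (\<integral>w. (h w)\<^sup>2 \<partial>R) \<le> c"
    using assms(3) real_le_lsqrt by auto
  then show ?thesis
    using i assms(1) by (simp add: L2_norm_def L2_def ennreal_leI)
qed

lemma measurable_V1X:
  assumes "K1 \<subseteq> K" "sets P = sets (PiM K N \<Otimes>\<^sub>M MX)"
  shows "V1X K1 \<in> P \<rightarrow>\<^sub>M PiM K1 N \<Otimes>\<^sub>M MX"
proof -
  have "(\<lambda>w. (restrict (fst w) K1, snd w)) \<in> PiM K N \<Otimes>\<^sub>M MX \<rightarrow>\<^sub>M PiM K1 N \<Otimes>\<^sub>M MX"
    by (intro measurable_Pair measurable_compose[OF measurable_fst measurable_restrict_subset[OF assms(1)]] measurable_snd)
  then show ?thesis
    unfolding measurable_cong_sets[OF assms(2) refl] by (simp add: V1X_def case_prod_beta')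
qed

lemma measurable_V2:
  assumes "K2 \<subseteq> K" "sets P = sets (PiM K N \<Otimes>\<^sub>M MX)"
  shows "V2 K2 \<in> P \<rightarrow>\<^sub>M PiM K2 N"
proof -
  have "(\<lambda>w. restrict (fst w) K2) \<in> PiM K N \<Otimes>\<^sub>M MX \<rightarrow>\<^sub>M PiM K2 N"
    by (rule measurable_compose[OF measurable_fst measurable_restrict_subset[OF assms(1)]])
  then show ?thesis
    unfolding measurable_cong_sets[OF assms(2) refl] by (simp add: V2_def case_prod_beta')
qed

lemma L2_composition:
  assumes T: "T \<in> P \<rightarrow>\<^sub>M N" and h: "h \<in> L2 (distr P N T)"
  shows "(\<lambda>w. h (T w)) \<in> borel_measurable P" "integrable P (\<lambda>w. (h (T w))\<^sup>2)"
proof -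
  have hm: "h \<in> borel_measurable N" and i: "integrable (distr P N T) (\<lambda>w. (h w)\<^sup>2)"
    using h by (auto simp: L2_def)
  show "(\<lambda>w. h (T w)) \<in> borel_measurable P" by (rule measurable_compose[OF T hm])
  show "integrable P (\<lambda>w. (h (T w))\<^sup>2)"
    using i hm by (subst (asm) integrable_distr_eq[OF T]) auto
qed

lemma (in prob_space) bounded_diff_square_integrable:
  fixes h k :: "'a \<Rightarrow> real"
  assumes "h \<in> borel_measurable M" "k \<in> borel_measurable M" "\<And>w. w \<in> space M \<Longrightarrow> \<bar>h w - k w\<bar> \<le> c"
    "integrable M (\<lambda>w. (k w)\<^sup>2)"
  shows "integrable M (\<lambda>w. (h w)\<^sup>2)"
proof (rule Bochner_Integration.integrable_bound[of _ "\<lambda>w. 2 * c\<^sup>2 + 2 * (k w)\<^sup>2"])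
  show "AE w in M. norm ((h w)\<^sup>2) \<le> norm (2 * c\<^sup>2 + 2 * (k w)\<^sup>2)"
  proof (rule AE_I2)
    fix w assume "w \<in> space M"
    then have "\<bar>h w - k w\<bar>\<^sup>2 \<le> c\<^sup>2" using assms(3) by (intro power_mono) auto
    moreover have "(h w)\<^sup>2 \<le> 2 * (h w - k w)\<^sup>2 + 2 * (k w)\<^sup>2"
      using sum_squares_bound[of "h w - k w" "k w"] by (simp add: power2_eq_square algebra_simps)
    ultimately show "norm ((h w)\<^sup>2) \<le> norm (2 * c\<^sup>2 + 2 * (k w)\<^sup>2)" by simp
  qed
qed (use assms in auto)

lemma square_integrable_diff:
  fixes h k :: "'a \<Rightarrow> real"
  assumes "h \<in> borel_measurable M" "k \<in> borel_measurable M"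
    "integrable M (\<lambda>w. (h w)\<^sup>2)" "integrable M (\<lambda>w. (k w)\<^sup>2)"
  shows "integrable M (\<lambda>w. (h w - k w)\<^sup>2)"
proof (rule Bochner_Integration.integrable_bound[of _ "\<lambda>w. 2 * (h w)\<^sup>2 + 2 * (k w)\<^sup>2"])
  have "(h w - k w)\<^sup>2 \<le> 2 * (h w)\<^sup>2 + 2 * (k w)\<^sup>2" for w
    using sum_squares_bound[of "h w" "- k w"] by (simp add: power2_diff)
  then show "AE w in M. norm ((h w - k w)\<^sup>2) \<le> norm (2 * (h w)\<^sup>2 + 2 * (k w)\<^sup>2)" by simp
qed (use assms in auto)

context private_law
begin

section \<open>From the chosen norm to \<open>sqn\<close>\<close>

lemma sqn_tendsto_0_norm:
  assumes N: "C \<ge> 0" "\<And>h. h \<in> borel_measurable P \<Longrightarrow> sqn h \<le> ennreal C * (nrm h)\<^sup>2"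
    and Y: "o_P M (\<lambda>n \<omega>. nrm (H (n, \<omega>)))"
    and m: "eventually (\<lambda>x. H x \<in> borel_measurable P) (wpa1 M)"
  shows "((\<lambda>x. sqn (H x)) \<longlongrightarrow> 0) (wpa1 M)"
proof (rule tendsto_wpa1_ennrealI)
  fix \<epsilon> :: real assume \<epsilon>: "\<epsilon> > 0"
  \<comment> \<open>The denominator is C + 1 because C may be 0.\<close>
  define \<eta> where "\<eta> = sqrt (\<epsilon> / (C + 1))"
  have \<eta>: "\<eta> > 0" "C * \<eta>\<^sup>2 \<le> \<epsilon>" using \<epsilon> N(1) by (auto simp: \<eta>_def field_simps)
  show "eventually (\<lambda>x. sqn (H x) \<le> ennreal \<epsilon>) (wpa1 M)"
    using o_P_eventually_le[OF Y \<eta>(1)] m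
  proof eventually_elim
    case (elim x)
    have "sqn (H x) \<le> ennreal C * (nrm (H x))\<^sup>2" using N(2) elim by blast
    also have "\<dots> \<le> ennreal C * (ennreal \<eta>)\<^sup>2"
      using elim by (intro mult_left_mono power_mono) auto
    also have "\<dots> = ennreal (C * \<eta>\<^sup>2)"
      using N(1) \<eta>(1) by (simp add: ennreal_power ennreal_mult)
    also have "\<dots> \<le> ennreal \<epsilon>" using \<eta>(2) by (rule ennreal_leI)
    finally show ?case .
  qed
qed

text \<open>The difference equals (rr - r) times the estimated residual plus r times the error of
  \<mu>. Under the first alternative both residual factors are uniformly controlled and r has finite
  norm. Under the second, the estimated residual is bounded in probability, and boundedness of r
  compensates for an error of \<mu> that is small only in norm.\<close>

lemma residual_product_tendsto_0:
  fixes r m \<mu> :: "'v \<times> 'a \<Rightarrow> real" and rr \<mu>\<mu> :: "nat \<times> 'w \<Rightarrow> 'v \<times> 'a \<Rightarrow> real"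
  assumes r: "r \<in> borel_measurable P" "sqn r < \<infinity>" and m: "m \<in> borel_measurable P" "\<mu> \<in> borel_measurable P"
    and est: "eventually (\<lambda>x. rr x \<in> borel_measurable P \<and> \<mu>\<mu> x \<in> borel_measurable P) (wpa1 M)"
    and rc: "((\<lambda>x. sqn (\<lambda>w. rr x w - r w)) \<longlongrightarrow> 0) (wpa1 M)"
    and alt: "sup_norm (space P) (\<lambda>w. m w - \<mu> w) < \<infinity> \<and> o_P M (\<lambda>n \<omega>. sup_norm (space P) (\<lambda>w. \<mu> w - \<mu>\<mu> (n, \<omega>) w)) \<or>
      O_P M (\<lambda>n \<omega>. sup_norm (space P) (\<lambda>w. m w - \<mu>\<mu> (n, \<omega>) w)) \<and> ((\<lambda>x. sqn (\<lambda>w. \<mu> w - \<mu>\<mu> x w)) \<longlongrightarrow> 0) (wpa1 M) \<and>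
        (\<exists>R. (AE w in P. \<bar>r w\<bar> \<le> R) \<and> (AE w in P2. \<bar>r w\<bar> \<le> R))"
  shows "((\<lambda>x. sqn (\<lambda>w. rr x w * (m w - \<mu>\<mu> x w) - r w * (m w - \<mu> w))) \<longlongrightarrow> 0) (wpa1 M)"
proof -
  have upper: "ennreal \<bar>h w\<bar> \<le> sup_norm (space P) h" if "w \<in> space P" for h w
    unfolding sup_norm_def using that by (rule SUP_upper)
  have eq: "(\<lambda>w. rr x w * (m w - \<mu>\<mu> x w) - r w * (m w - \<mu> w)) =
      (\<lambda>w. (rr x w - r w) * (m w - \<mu>\<mu> x w) + r w * (\<mu> w - \<mu>\<mu> x w))" for x
    by (auto simp: fun_eq_iff algebra_simps)
  have main: "((\<lambda>x. sqn (\<lambda>w. (rr x w - r w) * (m w - \<mu>\<mu> x w))) \<longlongrightarrow> 0) (wpa1 M) \<and>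
      ((\<lambda>x. sqn (\<lambda>w. r w * (\<mu> w - \<mu>\<mu> x w))) \<longlongrightarrow> 0) (wpa1 M)"
    using alt
  proof (elim disjE conjE exE)
    assume fin: "sup_norm (space P) (\<lambda>w. m w - \<mu> w) < \<infinity>"
      and o: "o_P M (\<lambda>n \<omega>. sup_norm (space P) (\<lambda>w. \<mu> w - \<mu>\<mu> (n, \<omega>) w))"
    obtain b where b: "b \<ge> 0" "sup_norm (space P) (\<lambda>w. m w - \<mu> w) = ennreal b"
      using fin by (cases "sup_norm (space P) (\<lambda>w. m w - \<mu> w)") auto
    have lim: "((\<lambda>x. sup_norm (space P) (\<lambda>w. \<mu> w - \<mu>\<mu> x w)) \<longlongrightarrow> 0) (wpa1 M)"
      using o by (simp add: o_P_iff_tendsto case_prod_beta')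
    show ?thesis
    proof
      have "eventually (\<lambda>x. sup_norm (space P) (\<lambda>w. \<mu> w - \<mu>\<mu> x w) \<le> ennreal 1) (wpa1 M)"
        using o_P_eventually_le[OF o, of 1] by simp
      \<comment> \<open>The bound b + 1 adds b for the true residual and 1 for the error of \<mu>,
        which is eventually at most 1.\<close>
      then have le: "eventually (\<lambda>x. sqn (\<lambda>w. (rr x w - r w) * (m w - \<mu>\<mu> x w)) \<le> (ennreal (b + 1))\<^sup>2 * sqn (\<lambda>w. rr x w - r w)) (wpa1 M)"
        using est
      proof eventually_elim
        case (elim x)
        show ?case
        proof (rule sqn_mult_sup_le)
          show "(\<lambda>w. rr x w - r w) \<in> borel_measurable P"
            using elim(2) r(1) by (blast intro: borel_measurable_diff)
          fix w assume w: "w \<in> space P"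
          have "\<bar>m w - \<mu> w\<bar> \<le> b" by (rule sup_norm_bound[OF w]) (use b in auto)
          moreover have "\<bar>\<mu> w - \<mu>\<mu> x w\<bar> \<le> 1" by (rule sup_norm_bound[OF w]) (use elim in auto)
          ultimately show "ennreal \<bar>m w - \<mu>\<mu> x w\<bar> \<le> ennreal (b + 1)" by (intro ennreal_leI) linarith
        qed
      qed
      have "((\<lambda>x. (ennreal (b + 1))\<^sup>2 * sqn (\<lambda>w. rr x w - r w)) \<longlongrightarrow> (ennreal (b + 1))\<^sup>2 * 0) (wpa1 M)"
        by (intro tendsto_mult_ennreal tendsto_const rc) (auto simp: power2_eq_square ennreal_mult_eq_top_iff)
      then have lim': "((\<lambda>x. (ennreal (b + 1))\<^sup>2 * sqn (\<lambda>w. rr x w - r w)) \<longlongrightarrow> 0) (wpa1 M)" by simp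
      show "((\<lambda>x. sqn (\<lambda>w. (rr x w - r w) * (m w - \<mu>\<mu> x w))) \<longlongrightarrow> 0) (wpa1 M)"
        by (rule tendsto_sandwich[OF _ le tendsto_const lim']) simp
      obtain c where c: "sqn r = ennreal c" "c \<ge> 0" using r(2) by (cases "sqn r") auto
      show "((\<lambda>x. sqn (\<lambda>w. r w * (\<mu> w - \<mu>\<mu> x w))) \<longlongrightarrow> 0) (wpa1 M)"
      proof (rule tendsto_wpa1_ennrealI)
        fix \<epsilon> :: real assume \<epsilon>: "\<epsilon> > 0"
        define \<eta> where "\<eta> = sqrt (\<epsilon> / (c + 1))"
        have \<eta>: "\<eta> > 0" "\<eta>\<^sup>2 * c \<le> \<epsilon>" using \<epsilon> c(2) by (auto simp: \<eta>_def field_simps)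
        show "eventually (\<lambda>x. sqn (\<lambda>w. r w * (\<mu> w - \<mu>\<mu> x w)) \<le> ennreal \<epsilon>) (wpa1 M)"
          using o_P_eventually_le[OF o \<eta>(1)]
        proof eventually_elim
          case (elim x)
          have "sqn (\<lambda>w. r w * (\<mu> w - \<mu>\<mu> x w)) \<le> (ennreal \<eta>)\<^sup>2 * sqn r"
          proof (rule sqn_mult_sup_le[OF r(1)])
            fix w assume w: "w \<in> space P"
            show "ennreal \<bar>\<mu> w - \<mu>\<mu> x w\<bar> \<le> ennreal \<eta>"
              using upper[OF w, of "\<lambda>w. \<mu> w - \<mu>\<mu> x w"] elim by simp
          qed
          also have "\<dots> = ennreal (\<eta>\<^sup>2 * c)" using c \<eta>(1) by (simp add: ennreal_power ennreal_mult)
          also have "\<dots> \<le> ennreal \<epsilon>" using \<eta>(2) by (rule ennreal_leI)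
          finally show ?case .
        qed
      qed
    qed
  next
    fix R
    assume O: "O_P M (\<lambda>n \<omega>. sup_norm (space P) (\<lambda>w. m w - \<mu>\<mu> (n, \<omega>) w))"
      and lim: "((\<lambda>x. sqn (\<lambda>w. \<mu> w - \<mu>\<mu> x w)) \<longlongrightarrow> 0) (wpa1 M)"
      and R: "AE w in P. \<bar>r w\<bar> \<le> R" "AE w in P2. \<bar>r w\<bar> \<le> R"
    show ?thesis
    proof
      show "((\<lambda>x. sqn (\<lambda>w. (rr x w - r w) * (m w - \<mu>\<mu> x w))) \<longlongrightarrow> 0) (wpa1 M)"
      proof (rule O_P_mult_tendsto_0[OF O rc, where h = "\<lambda>y. y\<^sup>2"])
        show "eventually (\<lambda>(n, \<omega>). sqn (\<lambda>w. (rr (n, \<omega>) w - r w) * (m w - \<mu>\<mu> (n, \<omega>) w)) \<le>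
            (sup_norm (space P) (\<lambda>w. m w - \<mu>\<mu> (n, \<omega>) w))\<^sup>2 * sqn (\<lambda>w. rr (n, \<omega>) w - r w)) (wpa1 M)"
          using est
        proof eventually_elim
          case (elim x)
          have "sqn (\<lambda>w. (rr x w - r w) * (m w - \<mu>\<mu> x w)) \<le>
              (sup_norm (space P) (\<lambda>w. m w - \<mu>\<mu> x w))\<^sup>2 * sqn (\<lambda>w. rr x w - r w)"
          proof (rule sqn_mult_sup_le)
            show "(\<lambda>w. rr x w - r w) \<in> borel_measurable P"
              using elim r(1) by (blast intro: borel_measurable_diff)
          qed (rule upper)
          then show ?case by (simp add: case_prod_beta')
        qed
        show "mono (\<lambda>y::ennreal. y\<^sup>2)" by (intro monoI power_mono) auto
        show "(ennreal C)\<^sup>2 < \<infinity>" for C by (cases "C \<ge> 0") (auto simp: ennreal_power ennreal_neg)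
      qed
      have le: "eventually (\<lambda>x. sqn (\<lambda>w. r w * (\<mu> w - \<mu>\<mu> x w)) \<le> ennreal (R\<^sup>2) * sqn (\<lambda>w. \<mu> w - \<mu>\<mu> x w)) (wpa1 M)"
        using est
      proof eventually_elim
        case (elim x)
        show ?case
        proof (rule sqn_le_AE)
          show "(\<lambda>w. \<mu> w - \<mu>\<mu> x w) \<in> borel_measurable P"
            using elim m(2) by (blast intro: borel_measurable_diff)
          show "AE w in P. \<bar>r w * (\<mu> w - \<mu>\<mu> x w)\<bar> \<le> R * \<bar>\<mu> w - \<mu>\<mu> x w\<bar>"
            using R(1) by eventually_elim (simp add: abs_mult mult_right_mono)
          show "AE w in P2. \<bar>r w * (\<mu> w - \<mu>\<mu> x w)\<bar> \<le> R * \<bar>\<mu> w - \<mu>\<mu> x w\<bar>"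
            using R(2) by eventually_elim (simp add: abs_mult mult_right_mono)
        qed
      qed
      have "((\<lambda>x. ennreal (R\<^sup>2) * sqn (\<lambda>w. \<mu> w - \<mu>\<mu> x w)) \<longlongrightarrow> ennreal (R\<^sup>2) * 0) (wpa1 M)"
        by (intro tendsto_mult_ennreal tendsto_const lim) auto
      then have lim': "((\<lambda>x. ennreal (R\<^sup>2) * sqn (\<lambda>w. \<mu> w - \<mu>\<mu> x w)) \<longlongrightarrow> 0) (wpa1 M)" by simp
      show "((\<lambda>x. sqn (\<lambda>w. r w * (\<mu> w - \<mu>\<mu> x w))) \<longlongrightarrow> 0) (wpa1 M)"
        by (rule tendsto_sandwich[OF _ le tendsto_const lim']) simp
    qed
  qed
  have le: "eventually (\<lambda>x. sqn (\<lambda>w. rr x w * (m w - \<mu>\<mu> x w) - r w * (m w - \<mu> w)) \<le>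
      2 * sqn (\<lambda>w. (rr x w - r w) * (m w - \<mu>\<mu> x w)) + 2 * sqn (\<lambda>w. r w * (\<mu> w - \<mu>\<mu> x w))) (wpa1 M)"
    using est
  proof eventually_elim
    case (elim x)
    have "(\<lambda>w. rr x w - r w) \<in> borel_measurable P" "(\<lambda>w. m w - \<mu>\<mu> x w) \<in> borel_measurable P"
      "(\<lambda>w. \<mu> w - \<mu>\<mu> x w) \<in> borel_measurable P"
      using elim r(1) m by (blast intro: borel_measurable_diff)+
    then show ?case
      unfolding eq using r(1) by (intro sqn_add_le borel_measurable_times)
  qed
  have "((\<lambda>x. 2 * sqn (\<lambda>w. (rr x w - r w) * (m w - \<mu>\<mu> x w)) + 2 * sqn (\<lambda>w. r w * (\<mu> w - \<mu>\<mu> x w))) \<longlongrightarrow> 2 * 0 + 2 * 0) (wpa1 M)"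
    by (intro tendsto_add tendsto_mult_ennreal tendsto_const) (use main in auto)
  then have lim: "((\<lambda>x. 2 * sqn (\<lambda>w. (rr x w - r w) * (m w - \<mu>\<mu> x w)) + 2 * sqn (\<lambda>w. r w * (\<mu> w - \<mu>\<mu> x w))) \<longlongrightarrow> 0) (wpa1 M)"
    by simp
  show ?thesis by (rule tendsto_sandwich[OF _ le tendsto_const lim]) simp
qed

lemma sqn_le_sup_norm: "sqn h \<le> ennreal 2 * (sup_norm (space P) h)\<^sup>2"
  using add_mono[OF P.nn_integral_le_sup_norm[of h] P2.nn_integral_le_sup_norm[of h]]
  by (simp add: sqn_def space_P2 mult_2)

lemma sqn_le_L_norm: "sqn h \<le> ennreal 1 * (L_norm [P, P2] h)\<^sup>2"
proof -
  have "sqn h \<le> (L2_norm P h)\<^sup>2 + (L2_norm P2 h)\<^sup>2"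
    unfolding sqn_def by (intro add_mono nn_integral_le_L2_norm)
  also have "\<dots> \<le> (L2_norm P h + L2_norm P2 h)\<^sup>2"
    by (simp add: power2_sum)
  finally show ?thesis by (simp add: L_norm_def)
qed

lemma sqn_le_L_norm_dominated:
  assumes C: "C \<ge> 0" "\<And>k. k \<in> borel_measurable P \<Longrightarrow> (\<integral>\<^sup>+w. k w \<partial>P2) \<le> ennreal C * (\<integral>\<^sup>+w. k w \<partial>P)"
    and h: "h \<in> borel_measurable P"
  shows "sqn h \<le> ennreal (1 + C) * (L_norm [P] h)\<^sup>2"
proof -
  have "sqn h \<le> (\<integral>\<^sup>+w. ennreal ((h w)\<^sup>2) \<partial>P) + ennreal C * (\<integral>\<^sup>+w. ennreal ((h w)\<^sup>2) \<partial>P)"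
    unfolding sqn_def using sq_meas[OF h] by (intro add_left_mono C(2))
  also have "\<dots> = ennreal (1 + C) * (\<integral>\<^sup>+w. ennreal ((h w)\<^sup>2) \<partial>P)"
    using C(1) by (simp add: distrib_right)
  also have "\<dots> \<le> ennreal (1 + C) * (L2_norm P h)\<^sup>2"
    by (intro mult_left_mono nn_integral_le_L2_norm) simp
  finally show ?thesis by (simp add: L_norm_def)
qed

lemma sup_norm_AE_bound:
  assumes "sup_norm (space P) h < \<infinity>"
  shows "\<exists>R. (AE w in P. \<bar>h w\<bar> \<le> R) \<and> (AE w in P2. \<bar>h w\<bar> \<le> R)"
proof -
  obtain b where b: "b \<ge> 0" "sup_norm (space P) h = ennreal b"
    using assms by (cases "sup_norm (space P) h") auto
  have "\<bar>h w\<bar> \<le> b" if "w \<in> space P" for w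
    by (rule sup_norm_bound[OF that]) (use b in auto)
  then show ?thesis by (intro exI[of _ b]) (auto simp: space_P2)
qed

lemma AE_P2_dominated:
  assumes C: "\<And>k. k \<in> borel_measurable P \<Longrightarrow> (\<integral>\<^sup>+w. k w \<partial>P2) \<le> ennreal C * (\<integral>\<^sup>+w. k w \<partial>P)"
    and ae: "AE w in P. A w"
  shows "AE w in P2. A w"
proof -
  obtain E where E: "{w \<in> space P. \<not> A w} \<subseteq> E" "E \<in> sets P" "emeasure P E = 0"
    using ae by (rule AE_E)
  have "emeasure P2 E \<le> ennreal C * emeasure P E"
    using C[of "indicator E"] E(2) by (simp add: sets_P2)
  then have "emeasure P2 E = 0" using E(3) by simp
  then show ?thesis
    using E by (intro AE_I[of _ _ E]) (auto simp: space_P2 sets_P2)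
qed

end

section \<open>Both mechanism classes under both choices of norm\<close>

theorem corollary1:
  fixes K K1 K2 :: "'k set" and N :: "'k \<Rightarrow> 'c measure" and MX MZ :: "'a measure"
    and P :: "(('k \<Rightarrow> 'c) \<times> 'a) measure"
    and m g :: "('k \<Rightarrow> 'c) \<times> 'a \<Rightarrow> real" and c :: "'k \<Rightarrow> 'c" and \<Gamma> :: "real set"
    and f f' f'' :: "('k \<Rightarrow> 'c) \<times> 'a \<Rightarrow> (('k \<Rightarrow> 'c) \<times> 'a \<Rightarrow> real) \<Rightarrow> real \<Rightarrow> real"
    and \<mu>X r :: "('k \<Rightarrow> 'c) \<times> 'a \<Rightarrow> real" and \<gamma>V :: "('k \<Rightarrow> 'c) \<Rightarrow> real"
    and Q :: "'a \<Rightarrow> 'a measure" and Qinv :: "(('k \<Rightarrow> 'c) \<times> 'a \<Rightarrow> real) \<Rightarrow> ('k \<Rightarrow> 'c) \<times> 'a \<Rightarrow> real"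
    and xs zs :: "'j::finite \<Rightarrow> 'a" and \<alpha> :: real and Qbar :: "'a measure"
    and Ps :: "(('k \<Rightarrow> 'c) \<times> 'a) measure list"
    and nrm :: "(('k \<Rightarrow> 'c) \<times> 'a \<Rightarrow> real) \<Rightarrow> ennreal" and r_bounded :: bool
    and M :: "'w measure" and S S' S'' :: "nat \<Rightarrow> 'w \<Rightarrow> ('k \<Rightarrow> 'c) \<times> 'a"
    and r_est \<mu>_est :: "nat \<Rightarrow> (nat \<Rightarrow> ('k \<Rightarrow> 'c) \<times> 'a) \<Rightarrow> ('k \<Rightarrow> 'c) \<times> 'a \<Rightarrow> real"
    and \<psi>0 :: "nat \<Rightarrow> 'w \<Rightarrow> real"
  defines "MV \<equiv> PiM K N"
    and "MV1X \<equiv> PiM K1 N \<Otimes>\<^sub>M MX"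
    and "P1 \<equiv> distr P (PiM K1 N \<Otimes>\<^sub>M MX) (V1X K1)"
    and "pc \<equiv> measure P {w \<in> space P. V2 K2 w = c}"
    and "\<gamma>c \<equiv> \<gamma>V c"
    and "\<chi>P \<equiv> \<integral>w. f w \<mu>X (\<gamma>V c) \<partial>P"
    and "e \<equiv> \<integral>w. f' w \<mu>X (\<gamma>V c) \<partial>P"
    and "PVZ \<equiv> law_VZ (PiM K N) MZ Q P"
  defines "\<chi>_tilde \<equiv> score K1 K2 c m g f r \<mu>X \<gamma>c pc e \<chi>P"
    and "r_n \<equiv> \<lambda>n \<omega>. r_est n (sample S' n \<omega>)"
    and "\<mu>_n \<equiv> \<lambda>n \<omega>. \<mu>_est n (sample S' n \<omega>)"
    and "p_n \<equiv> \<lambda>n \<omega>. p_est K2 c n (sample S' n \<omega>)"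
    and "\<gamma>_n \<equiv> \<lambda>n \<omega>. gamma_est Qinv K2 c g n (sample S' n \<omega>)"
  defines "e_n \<equiv> \<lambda>n \<omega>. e_est Qinv f' (\<mu>_n n \<omega>) (\<gamma>_n n \<omega>) n (sample S'' n \<omega>)"
  defines "\<chi>_n \<equiv> \<lambda>n \<omega>. score K1 K2 c m g f (r_n n \<omega>) (\<mu>_n n \<omega>) (\<gamma>_n n \<omega>) (p_n n \<omega>) (e_n n \<omega>) (\<psi>0 n \<omega>)"
  defines "\<psi>_n \<equiv> \<lambda>n \<omega>. \<psi>0 n \<omega> + avg n (Qinv (\<chi>_n n \<omega>)) (sample S n \<omega>)"
  assumes coords: "K1 \<subseteq> K" "K2 \<subseteq> K"
    and V2_finite: "finite (space (PiM K2 N))" "sets (PiM K2 N) = Pow (space (PiM K2 N))"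
    and c: "c \<in> space (PiM K2 N)"
    and P: "prob_space P" "sets P = sets (MV \<Otimes>\<^sub>M MX)"
    and pc_pos: "pc > 0"
    and mg_meas: "m \<in> borel_measurable P" "g \<in> borel_measurable P"
    and \<mu>X: "cond_mean P (V1X K1) MV1X m \<mu>X" "\<mu>X \<in> L2 P1"
    and \<gamma>V: "cond_mean P (V2 K2) (PiM K2 N) g \<gamma>V"
    and \<Gamma>: "is_interval \<Gamma>" "g ` space P \<subseteq> \<Gamma>" "\<gamma>c \<in> \<Gamma>"
    and f_meas: "\<And>\<mu> \<gamma>. \<mu> \<in> L2 P1 \<Longrightarrow> \<gamma> \<in> \<Gamma> \<Longrightarrow> (\<lambda>w. f w \<mu> \<gamma>) \<in> borel_measurable P"
      "\<And>\<mu> \<gamma>. \<mu> \<in> L2 P1 \<Longrightarrow> \<gamma> \<in> \<Gamma> \<Longrightarrow> (\<lambda>w. f' w \<mu> \<gamma>) \<in> borel_measurable P"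
      "\<And>\<mu> \<gamma>. \<mu> \<in> L2 P1 \<Longrightarrow> \<gamma> \<in> \<Gamma> \<Longrightarrow> (\<lambda>w. f'' w \<mu> \<gamma>) \<in> borel_measurable P"
    and f_integrable: "\<And>\<mu> \<gamma>. \<mu> \<in> L2 P1 \<Longrightarrow> \<gamma> \<in> \<Gamma> \<Longrightarrow> integrable P (\<lambda>w. f w \<mu> \<gamma>)"
    and f_continuous: "\<And>\<gamma> \<mu> \<epsilon>. \<gamma> \<in> \<Gamma> \<Longrightarrow> \<mu> \<in> L2 P1 \<Longrightarrow> \<epsilon> > 0 \<Longrightarrow>
      \<exists>\<delta>>0::real. \<forall>\<nu>\<in>L2 P1. L2_norm P (\<lambda>w. \<nu> (V1X K1 w) - \<mu> (V1X K1 w)) < ennreal \<delta> \<longrightarrow>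
        \<bar>(\<integral>w. f w \<nu> \<gamma> \<partial>P) - (\<integral>w. f w \<mu> \<gamma> \<partial>P)\<bar> < (\<epsilon>::real)"
    and f_linear: "\<And>\<gamma> \<mu> \<nu> a b. \<gamma> \<in> \<Gamma> \<Longrightarrow> \<mu> \<in> L2 P1 \<Longrightarrow> \<nu> \<in> L2 P1 \<Longrightarrow>
      AE w in P. f w (\<lambda>u. a * \<mu> u + b * \<nu> u) \<gamma> = a * f w \<mu> \<gamma> + b * f w \<nu> \<gamma>"
    and f_smooth: "\<And>\<mu>. \<mu> \<in> L2 P1 \<Longrightarrow> AE w in P. C2_in_gamma \<Gamma> (f w \<mu>) (f' w \<mu>) (f'' w \<mu>)"
    and square_integrable: "integrable P (\<lambda>w. (f w \<mu>X \<gamma>c)\<^sup>2)"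
      "integrable P (\<lambda>w. of_bool (V2 K2 w = c) * (g w)\<^sup>2)"
      "AE w in P. nn_cond_exp P (vimage_algebra (space P) (V1X K1) MV1X) (\<lambda>w. ennreal ((m w)\<^sup>2)) w < \<infinity>"
    and r: "r \<in> L2 P1"
      "\<And>\<mu>. \<mu> \<in> L2 P1 \<Longrightarrow> (\<integral>w. f w \<mu> \<gamma>c \<partial>P) = (\<integral>w. r (V1X K1 w) * \<mu> (V1X K1 w) \<partial>P)"
    and e_defined: "integrable P (\<lambda>w. f' w \<mu>X \<gamma>c)"
  assumes mechanism:
    "mech_delta MX MZ Q \<alpha> Qbar \<and> Qinv = inv_delta \<alpha> Qbar \<and> Ps = [P, distr P MV fst \<Otimes>\<^sub>M Qbar] \<or>
     mech_J MV MX MZ P Q xs zs \<and> Qinv = inv_J Q xs zs \<and> Ps = [P] \<and> finitely_supported MV MX P \<and>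
       (nrm = L_norm Ps \<longrightarrow> positive_density MV MX P)"
    and norm_choice:
    "nrm = L_norm Ps \<and> r_bounded = (\<exists>R. \<forall>P'\<in>set Ps. AE w in P'. \<bar>r (V1X K1 w)\<bar> \<le> R) \<or>
     nrm = sup_norm (space P) \<and> r_bounded = (sup_norm (space P) (\<lambda>w. r (V1X K1 w)) < \<infinity>)"
    and f_smooth_L: "\<And>P' \<mu>. P' \<in> set Ps \<Longrightarrow> \<mu> \<in> L2 P1 \<Longrightarrow>
      AE w in P'. C2_in_gamma \<Gamma> (f w \<mu>) (f' w \<mu>) (f'' w \<mu>)"
  assumes M: "prob_space M"
    and sample_law: "\<And>i. S i \<in> M \<rightarrow>\<^sub>M PVZ" "\<And>i. S' i \<in> M \<rightarrow>\<^sub>M PVZ" "\<And>i. S'' i \<in> M \<rightarrow>\<^sub>M PVZ"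
      "\<And>i. distr M PVZ (S i) = PVZ" "\<And>i. distr M PVZ (S' i) = PVZ" "\<And>i. distr M PVZ (S'' i) = PVZ"
    and sample_indep: "prob_space.indep_vars M (\<lambda>_. PVZ) (\<lambda>(j, i). ([S, S', S''] ! j) i) ({..<3} \<times> UNIV)"
    and est_L2: "\<And>n s. s \<in> space (PiM {..<n} (\<lambda>_. PVZ)) \<Longrightarrow> r_est n s \<in> L2 P1"
      "\<And>n s. s \<in> space (PiM {..<n} (\<lambda>_. PVZ)) \<Longrightarrow> \<mu>_est n s \<in> L2 P1"
    and est_meas: "\<And>n. (\<lambda>(s, u). r_est n s u) \<in> borel_measurable (PiM {..<n} (\<lambda>_. PVZ) \<Otimes>\<^sub>M P1)"
      "\<And>n. (\<lambda>(s, u). \<mu>_est n s u) \<in> borel_measurable (PiM {..<n} (\<lambda>_. PVZ) \<Otimes>\<^sub>M P1)"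
      "\<And>n. (\<lambda>(s, w). f w (\<mu>_est n s) (gamma_est Qinv K2 c g n s)) \<in>
        borel_measurable (PiM {..<n} (\<lambda>_. PVZ) \<Otimes>\<^sub>M P)"
      "\<And>n. (\<lambda>(s, w). f' w (\<mu>_est n s) (gamma_est Qinv K2 c g n s)) \<in>
        borel_measurable (PiM {..<n} (\<lambda>_. PVZ) \<Otimes>\<^sub>M P)"
      "\<And>n. \<psi>0 n \<in> borel_measurable M"
    and \<gamma>_n_range: "\<And>n. AE \<omega> in M. p_n n \<omega> \<noteq> 0 \<longrightarrow> \<gamma>_n n \<omega> \<in> \<Gamma>"
    \<comment> \<open>assumption (A), together with \<open>mechanism\<close>, \<open>norm_choice\<close>, \<open>f_smooth_L\<close>\<close>
  assumes finite_norm: "nrm \<chi>_tilde < \<infinity>" "\<And>n. AE \<omega> in M. p_n n \<omega> \<noteq> 0 \<longrightarrow> nrm (\<chi>_n n \<omega>) < \<infinity>"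
      "nrm (\<lambda>w. r (V1X K1 w)) < \<infinity>"
    and f_consistent: "\<And>\<epsilon>::real. \<epsilon> > 0 \<Longrightarrow> \<exists>\<delta>>0::real. \<forall>\<mu>\<in>L2 P1. \<forall>\<gamma>\<in>\<Gamma>.
      L2_norm P (\<lambda>w. \<mu> (V1X K1 w) - \<mu>X (V1X K1 w)) + ennreal \<bar>\<gamma> - \<gamma>c\<bar> < ennreal \<delta> \<longrightarrow>
      nrm (\<lambda>w. f w \<mu> \<gamma> - f w \<mu>X \<gamma>c) < ennreal \<epsilon> \<and>
      nrm (\<lambda>w. f' w \<mu> \<gamma> - f' w \<mu>X \<gamma>c) < ennreal \<epsilon>"
    and r_consistent: "o_P M (\<lambda>n \<omega>. nrm (\<lambda>w. r_n n \<omega> (V1X K1 w) - r (V1X K1 w)))"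
    and \<gamma>_consistent: "o_P M (\<lambda>n \<omega>. ennreal \<bar>\<gamma>_n n \<omega> - \<gamma>c\<bar>)"
    and p_consistent: "o_P M (\<lambda>n \<omega>. ennreal \<bar>p_n n \<omega> - pc\<bar>)"
    and \<mu>_consistent:
    "sup_norm (space P) (\<lambda>w. m w - \<mu>X (V1X K1 w)) < \<infinity> \<and>
       o_P M (\<lambda>n \<omega>. sup_norm (space P) (\<lambda>w. \<mu>X (V1X K1 w) - \<mu>_n n \<omega> (V1X K1 w))) \<or>
     O_P M (\<lambda>n \<omega>. sup_norm (space P) (\<lambda>w. m w - \<mu>_n n \<omega> (V1X K1 w))) \<and>
       o_P M (\<lambda>n \<omega>. nrm (\<lambda>w. \<mu>X (V1X K1 w) - \<mu>_n n \<omega> (V1X K1 w))) \<and> r_bounded"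
    \<comment> \<open>assumption (B)\<close>
  assumes product_rate: "o_P M (\<lambda>n \<omega>. ennreal (sqrt (real n)) * abs_mean P
      (\<lambda>w. (\<mu>_n n \<omega> (V1X K1 w) - \<mu>X (V1X K1 w)) * (r_n n \<omega> (V1X K1 w) - r (V1X K1 w))))"
    and \<gamma>_rate: "O_P M (\<lambda>n \<omega>. ennreal (sqrt (real n) * \<bar>\<gamma>_n n \<omega> - \<gamma>c\<bar>))"
    and p_rate: "O_P M (\<lambda>n \<omega>. ennreal (sqrt (real n) * \<bar>p_n n \<omega> - pc\<bar>))"
    and second_derivative: "\<And>\<gamma>'. (\<And>n. \<gamma>' n \<in> borel_measurable M) \<Longrightarrow>
      (\<And>n \<omega>. \<omega> \<in> space M \<Longrightarrow> \<gamma>' n \<omega> \<in> closed_segment (\<gamma>_n n \<omega>) \<gamma>c) \<Longrightarrow>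
      O_P M (\<lambda>n \<omega>. abs_mean P (\<lambda>w. f'' w (\<mu>_n n \<omega>) (\<gamma>' n \<omega>)))"
  shows "weak_conv_m (\<lambda>n. distr M borel (\<lambda>\<omega>. sqrt (real n) * (\<psi>_n n \<omega> - \<chi>P)))
    (centered_normal (\<integral>u. (Qinv \<chi>_tilde u)\<^sup>2 \<partial>PVZ))"
proof -
  interpret PP: prob_space P by (rule P(1))
  interpret MM: prob_space M by (rule M)
  have P2': "sets P = sets (PiM K N \<Otimes>\<^sub>M MX)" using P(2) by (simp add: MV_def)
  have V1m: "V1X K1 \<in> P \<rightarrow>\<^sub>M MV1X" unfolding MV1X_def by (rule measurable_V1X[OF coords(1) P2'])
  have V2m: "V2 K2 \<in> P \<rightarrow>\<^sub>M PiM K2 N" by (rule measurable_V2[OF coords(2) P2'])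
  have P1d: "P1 = distr P MV1X (V1X K1)" by (simp add: P1_def MV1X_def)
  have PVZd: "PVZ = law_VZ MV MZ Q P" by (simp add: PVZ_def MV_def)
  have L2c: "(\<lambda>w. \<mu> (V1X K1 w)) \<in> borel_measurable P" "integrable P (\<lambda>w. (\<mu> (V1X K1 w))\<^sup>2)"
    and L2m: "\<mu> \<in> borel_measurable MV1X" if "\<mu> \<in> L2 P1" for \<mu>
    using L2_composition[OF V1m that[unfolded P1d]] that by (auto simp: L2_def P1d)
  have ic0: "(\<lambda>v. of_bool (v = c) :: real) \<in> borel_measurable (PiM K2 N)"
  proof -
    have eq: "sets (PiM K2 N) = sets (count_space (space (PiM K2 N)))" using V2_finite(2) by simp
    show ?thesis unfolding measurable_cong_sets[OF eq refl] by simp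
  qed
  define ic where "ic w = (of_bool (V2 K2 w = c) :: real)" for w :: "('k \<Rightarrow> 'c) \<times> 'a"
  have icm: "ic \<in> borel_measurable P"
    unfolding ic_def[abs_def] by (rule measurable_compose[OF V2m ic0])
  have ic_int: "(\<integral>w. ic w \<partial>P) = pc"
  proof -
    have "V2 K2 -` {c} \<inter> space P \<in> sets P"
      by (rule measurable_sets[OF V2m]) (use V2_finite(2) c in auto)
    moreover have "V2 K2 -` {c} \<inter> space P = {w \<in> space P. V2 K2 w = c}" by auto
    ultimately have E: "{w \<in> space P. V2 K2 w = c} \<in> sets P" by simp
    have "(\<integral>w. ic w \<partial>P) = (\<integral>w. indicator {w \<in> space P. V2 K2 w = c} w \<partial>P)"
      by (rule Bochner_Integration.integral_cong) (auto simp: ic_def split: split_indicator)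
    then show ?thesis using E by (simp add: pc_def)
  qed
  have gi: "integrable P (\<lambda>w. ic w * g w)"
  proof (rule Bochner_Integration.integrable_bound[of _ "\<lambda>w. 1 + ic w * (g w)\<^sup>2"])
    have "\<bar>ic w * g w\<bar> \<le> \<bar>1 + ic w * (g w)\<^sup>2\<bar>" for w
      using sum_squares_bound[of 1 "\<bar>g w\<bar>"] by (auto simp: ic_def)
    then show "AE w in P. norm (ic w * g w) \<le> norm (1 + ic w * (g w)\<^sup>2)" by simp
    have "integrable P (\<lambda>w. ic w * (g w)\<^sup>2)" using square_integrable(2) by (simp add: ic_def)
    then show "integrable P (\<lambda>w. 1 + ic w * (g w)\<^sup>2)" by simp
    show "(\<lambda>w. ic w * g w) \<in> borel_measurable P" using icm mg_meas(2) by simp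
  qed
  \<comment> \<open>The test function is the indicator of V2 = c, on which the conditional mean is
    the constant \<open>\<gamma>c\<close>. Integrability is available for the product with g, not
    for g itself.\<close>
  have g_mean: "(\<integral>w. ic w * g w \<partial>P) = pc * \<gamma>c"
  proof -
    have "(\<integral>w. ic w * g w \<partial>P) = (\<integral>w. ic w * \<gamma>V (V2 K2 w) \<partial>P)"
      unfolding ic_def
      by (rule cond_mean_integral[OF P(1) V2m \<gamma>V mg_meas(2) ic0, symmetric]) (use gi in \<open>simp add: ic_def\<close>)
    also have "\<dots> = (\<integral>w. ic w * \<gamma>c \<partial>P)"
      by (rule Bochner_Integration.integral_cong) (auto simp: ic_def \<gamma>c_def)
    finally show ?thesis by (simp add: ic_int)
  qed
  have S1: "sample S' n \<omega> \<in> space (PiM {..<n} (\<lambda>_. PVZ))" if "\<omega> \<in> space M" for n \<omega>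
    using measurable_space[OF sample_law(2) that] by (auto simp: sample_def space_PiM)
  have \<mu>n: "\<mu>_n n \<omega> \<in> L2 P1" and rn: "r_n n \<omega> \<in> L2 P1" if "\<omega> \<in> space M" for n \<omega>
    using est_L2 S1[OF that] by (auto simp: \<mu>_n_def r_n_def)
  \<comment> \<open>Square integrability of m is extracted from \<open>\<mu>_consistent\<close>: m
    differs by a bounded function from a square-integrable one, namely \<open>\<mu>X\<close> under
    the first alternative and \<open>\<mu>_n n \<omega>\<close> for one suitable n and \<omega>
    under the second.\<close>
  have m2: "integrable P (\<lambda>w. (m w)\<^sup>2)"
    using \<mu>_consistent
  proof (elim disjE conjE)
    assume fin: "sup_norm (space P) (\<lambda>w. m w - \<mu>X (V1X K1 w)) < \<infinity>"
    obtain b where b: "b \<ge> 0" "sup_norm (space P) (\<lambda>w. m w - \<mu>X (V1X K1 w)) = ennreal b"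
      using fin by (cases "sup_norm (space P) (\<lambda>w. m w - \<mu>X (V1X K1 w))") auto
    show ?thesis
    proof (rule PP.bounded_diff_square_integrable[OF mg_meas(1) L2c(1)[OF \<mu>X(2)] _ L2c(2)[OF \<mu>X(2)]])
      show "\<bar>m w - \<mu>X (V1X K1 w)\<bar> \<le> b" if "w \<in> space P" for w
        by (rule sup_norm_bound[OF that]) (use b in auto)
    qed
  next
    assume "O_P M (\<lambda>n \<omega>. sup_norm (space P) (\<lambda>w. m w - \<mu>_n n \<omega> (V1X K1 w)))"
    then obtain C :: real where C: "eventually (\<lambda>n. outer_measure_of M
        {\<omega> \<in> space M. ennreal C < sup_norm (space P) (\<lambda>w. m w - \<mu>_n n \<omega> (V1X K1 w))} < ennreal 1) sequentially"
      unfolding O_P_def by (meson zero_less_one)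
    then obtain n where n: "outer_measure_of M
        {\<omega> \<in> space M. ennreal C < sup_norm (space P) (\<lambda>w. m w - \<mu>_n n \<omega> (V1X K1 w))} < ennreal 1"
      by (auto dest: eventually_happens)
    \<comment> \<open>An event of outer probability below 1 misses some point.\<close>
    have "\<exists>\<omega>\<in>space M. sup_norm (space P) (\<lambda>w. m w - \<mu>_n n \<omega> (V1X K1 w)) \<le> ennreal C"
    proof (rule ccontr)
      assume "\<not> ?thesis"
      then have "{\<omega> \<in> space M. ennreal C < sup_norm (space P) (\<lambda>w. m w - \<mu>_n n \<omega> (V1X K1 w))} = space M"
        by (auto simp: not_le)
      then show False using n by (simp add: MM.emeasure_space_1)
    qed
    then obtain \<omega> where \<omega>: "\<omega> \<in> space M" "sup_norm (space P) (\<lambda>w. m w - \<mu>_n n \<omega> (V1X K1 w)) \<le> ennreal C" by blast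
    have le: "sup_norm (space P) (\<lambda>w. m w - \<mu>_n n \<omega> (V1X K1 w)) \<le> ennreal (max C 0)"
      by (rule order_trans[OF \<omega>(2)]) (simp add: ennreal_leI)
    show ?thesis
    proof (rule PP.bounded_diff_square_integrable[OF mg_meas(1) L2c(1)[OF \<mu>n[OF \<omega>(1)]] _ L2c(2)[OF \<mu>n[OF \<omega>(1)]]])
      show "\<bar>m w - \<mu>_n n \<omega> (V1X K1 w)\<bar> \<le> max C 0" if "w \<in> space P" for w
        by (rule sup_norm_bound[OF that le]) simp
    qed
  qed
  have res2: "integrable P (\<lambda>w. (m w - \<mu>X (V1X K1 w))\<^sup>2)"
    by (rule square_integrable_diff[OF mg_meas(1) L2c(1)[OF \<mu>X(2)] m2 L2c(2)[OF \<mu>X(2)]])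
  \<comment> \<open>As h depends on (V1, X) alone, this covers r and, sample by sample, its
    estimate.\<close>
  have orth: "(\<integral>w. h (V1X K1 w) * (m w - \<mu>X (V1X K1 w)) \<partial>P) = 0" if h: "h \<in> L2 P1" for h
  proof -
    have i1: "integrable P (\<lambda>w. h (V1X K1 w) * m w)"
      by (rule square_integrable_product[OF L2c(1)[OF h] mg_meas(1) L2c(2)[OF h] m2])
    have i2: "integrable P (\<lambda>w. h (V1X K1 w) * \<mu>X (V1X K1 w))"
      by (rule square_integrable_product[OF L2c(1)[OF h] L2c(1)[OF \<mu>X(2)] L2c(2)[OF h] L2c(2)[OF \<mu>X(2)]])
    show ?thesis
      using cond_mean_integral[OF P(1) V1m \<mu>X(1) mg_meas(1) L2m[OF h] i1] i1 i2 by (simp add: right_diff_distrib)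
  qed
  have p_tendsto: "((\<lambda>x. p_n (fst x) (snd x) - pc) \<longlongrightarrow> 0) (wpa1 M)"
    by (rule o_P_real_tendsto[OF p_consistent])
  \<comment> \<open>The range of \<open>\<gamma>_n\<close> and the finite norm of
    \<open>\<chi>_n\<close> are available only where \<open>p_n\<close> is not 0.\<close>
  have p_nz: "eventually (\<lambda>x. p_n (fst x) (snd x) \<noteq> 0) (wpa1 M)"
  proof -
    have "eventually (\<lambda>x. \<bar>p_n (fst x) (snd x) - pc\<bar> \<le> pc / 2) (wpa1 M)"
      using p_tendsto[unfolded tendsto_wpa1_real_iff] pc_pos by (meson half_gt_zero)
    then show ?thesis by eventually_elim (use pc_pos in auto)
  qed
  have inM: "eventually (\<lambda>x. snd x \<in> space M) (wpa1 M)"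
    using eventually_wpa1_space by (rule eventually_mono) auto

  have n_pos: "eventually (\<lambda>(n, \<omega>). n > 0) (wpa1 M)"
    by (rule eventually_wpa1_sequentially) (rule eventually_gt_at_top)
  \<comment> \<open>What the four cases share. N compares \<open>sqn\<close> with the chosen norm, R
    carries the bound on r to both laws, and F leads to a finite norm of f' at the truth: through
    smoothness under the second law for \<open>mech_delta\<close>, or because every
    \<open>sqn\<close> is finite for \<open>mech_J\<close>.\<close>
  have main: ?thesis
    if pl: "private_law MV MX MZ P PVZ Qb a B \<kappa>"
      and Qeq: "Qinv = (\<lambda>h u. a * h u + (\<integral>x. \<kappa> (snd u) x * h (fst u, x) \<partial>Qb))"
      and N: "C \<ge> 0" "\<And>h. h \<in> borel_measurable P \<Longrightarrow> private_law.sqn MV P Qb h \<le> ennreal C * (nrm h)\<^sup>2"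
      and R: "r_bounded \<Longrightarrow> \<exists>R. (AE w in P. \<bar>r (V1X K1 w)\<bar> \<le> R) \<and> (AE w in private_law.P2 MV P Qb. \<bar>r (V1X K1 w)\<bar> \<le> R)"
      and F: "(\<forall>\<mu>\<in>L2 P1. AE w in private_law.P2 MV P Qb. C2_in_gamma \<Gamma> (f w \<mu>) (f' w \<mu>) (f'' w \<mu>)) \<or>
        (\<forall>k. private_law.sqn MV P Qb k < \<infinity>)"
    for Qb :: "'a measure" and a B C :: real and \<kappa>
  proof -
    interpret PL: private_law MV MX MZ P PVZ Qb a B \<kappa> by (rule pl)
    have T: "Qinv = PL.T" using Qeq by (simp add: fun_eq_iff PL.T_def)
    interpret SS: split_samples MV MX MZ P PVZ Qb a B \<kappa> M S S' S''
      by (intro split_samples.intro pl split_samples_axioms.intro M sample_law sample_indep)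
    let ?ic = "\<lambda>w. of_bool (V2 K2 w = c) :: real"
    let ?ev = "\<lambda>\<mu> w. \<mu> (V1X K1 w)"
    let ?rn = "\<lambda>n s w. r_est n s (V1X K1 w)"
    let ?\<gamma>n = "gamma_est Qinv K2 c g" and ?pn = "p_est K2 c"
    interpret NE: nuisance_estimates MV MX MZ P PVZ Qb a B \<kappa> M S S' S'' "L2 P1" ?ev \<Gamma> f f' f'' m g ?ic
        "\<lambda>w. r (V1X K1 w)" \<mu>X \<gamma>c pc e ?rn \<mu>_est ?\<gamma>n ?pn
      by unfold_locales
    have fin_norm: "PL.sqn h < \<infinity>" if "h \<in> borel_measurable P" "nrm h < \<infinity>" for h
    proof -
      have "ennreal C * (nrm h)\<^sup>2 < \<infinity>"
        using that(2) by (auto simp: power2_eq_square ennreal_mult_less_top)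
      then show ?thesis using N(2)[OF that(1)] by (rule le_less_trans[rotated])
    qed
    have small_norm: "PL.sqn h \<le> ennreal \<epsilon>" if "h \<in> borel_measurable P" "nrm h < ennreal (sqrt (\<epsilon> / (C + 1)))" "\<epsilon> > 0" for h \<epsilon>
    proof -
      have "(nrm h)\<^sup>2 \<le> (ennreal (sqrt (\<epsilon> / (C + 1))))\<^sup>2" using that(2) by (intro power_mono) auto
      also have "\<dots> = ennreal (\<epsilon> / (C + 1))" using that(3) N(1) by (simp add: ennreal_power)
      finally have "ennreal C * (nrm h)\<^sup>2 \<le> ennreal C * ennreal (\<epsilon> / (C + 1))" by (rule mult_left_mono) simp
      also have "\<dots> = ennreal (C * (\<epsilon> / (C + 1)))" using that(3) N(1) by (simp flip: ennreal_mult)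
      also have "\<dots> \<le> ennreal \<epsilon>" using that(3) N(1) by (intro ennreal_leI) (simp add: field_simps)
      finally show ?thesis using N(2)[OF that(1)] by (rule order_trans[rotated])
    qed
    have fc: "\<exists>\<delta>>0. \<forall>\<theta>\<in>L2 P1. \<forall>\<gamma>\<in>\<Gamma>.
        PL.sqn (\<lambda>w. ?ev \<theta> w - ?ev \<mu>X w) \<le> ennreal \<delta> \<longrightarrow> \<bar>\<gamma> - \<gamma>c\<bar> \<le> \<delta> \<longrightarrow>
        PL.sqn (\<lambda>w. f w \<theta> \<gamma> - f w \<mu>X \<gamma>c) \<le> ennreal \<epsilon> \<and> PL.sqn (\<lambda>w. f' w \<theta> \<gamma> - f' w \<mu>X \<gamma>c) \<le> ennreal \<epsilon>"
      if \<epsilon>: "\<epsilon> > 0" for \<epsilon> :: real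
    proof -
      have "sqrt (\<epsilon> / (C + 1)) > 0" using \<epsilon> N(1) by simp
      from f_consistent[OF this] obtain d :: real where d: "d > 0" "\<And>\<theta> \<gamma>. \<theta> \<in> L2 P1 \<Longrightarrow> \<gamma> \<in> \<Gamma> \<Longrightarrow>
          L2_norm P (\<lambda>w. \<theta> (V1X K1 w) - \<mu>X (V1X K1 w)) + ennreal \<bar>\<gamma> - \<gamma>c\<bar> < ennreal d \<Longrightarrow>
          nrm (\<lambda>w. f w \<theta> \<gamma> - f w \<mu>X \<gamma>c) < ennreal (sqrt (\<epsilon> / (C + 1))) \<and>
          nrm (\<lambda>w. f' w \<theta> \<gamma> - f' w \<mu>X \<gamma>c) < ennreal (sqrt (\<epsilon> / (C + 1)))" by blast
      \<comment> \<open>The square accounts for \<open>sqn\<close> being a squared norm. Each of the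
        two distances is then at most d / 3, which leaves room for the strict inequality.\<close>
      define \<delta> where "\<delta> = min (d / 3) ((d / 3)\<^sup>2)"
      have \<delta>: "\<delta> > 0" "\<delta> \<le> d / 3" "\<delta> \<le> (d / 3)\<^sup>2" using d(1) by (auto simp: \<delta>_def)
      show ?thesis
      proof (intro exI[of _ \<delta>] conjI \<delta>(1) ballI impI)
        fix \<theta> \<gamma> assume \<theta>: "\<theta> \<in> L2 P1" and \<gamma>: "\<gamma> \<in> \<Gamma>"
          and near: "PL.sqn (\<lambda>w. \<theta> (V1X K1 w) - \<mu>X (V1X K1 w)) \<le> ennreal \<delta>" "\<bar>\<gamma> - \<gamma>c\<bar> \<le> \<delta>"
        have "(\<integral>\<^sup>+w. ennreal ((\<theta> (V1X K1 w) - \<mu>X (V1X K1 w))\<^sup>2) \<partial>P) \<le> PL.sqn (\<lambda>w. \<theta> (V1X K1 w) - \<mu>X (V1X K1 w))"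
          by (simp add: PL.sqn_def)
        also have "\<dots> \<le> ennreal ((d / 3)\<^sup>2)" using near(1) \<delta>(3) by (auto intro: order_trans ennreal_leI)
        finally have "L2_norm P (\<lambda>w. \<theta> (V1X K1 w) - \<mu>X (V1X K1 w)) \<le> ennreal (d / 3)"
          using d(1) L2c(1)[OF \<theta>] L2c(1)[OF \<mu>X(2)] by (intro L2_norm_le) auto
        then have "L2_norm P (\<lambda>w. \<theta> (V1X K1 w) - \<mu>X (V1X K1 w)) + ennreal \<bar>\<gamma> - \<gamma>c\<bar> \<le> ennreal (d / 3) + ennreal (d / 3)"
          using near(2) \<delta>(2) by (intro add_mono ennreal_leI) auto
        also have "\<dots> < ennreal d" using d(1) by (simp add: ennreal_less_iff flip: ennreal_plus)
        finally have lt: "L2_norm P (\<lambda>w. \<theta> (V1X K1 w) - \<mu>X (V1X K1 w)) + ennreal \<bar>\<gamma> - \<gamma>c\<bar> < ennreal d" .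
        note nn = d(2)[OF \<theta> \<gamma> lt]
        show "PL.sqn (\<lambda>w. f w \<theta> \<gamma> - f w \<mu>X \<gamma>c) \<le> ennreal \<epsilon>" "PL.sqn (\<lambda>w. f' w \<theta> \<gamma> - f' w \<mu>X \<gamma>c) \<le> ennreal \<epsilon>"
          using nn f_meas(1,2)[OF \<theta> \<gamma>] f_meas(1,2)[OF \<mu>X(2) \<Gamma>(3)] \<epsilon> by (auto intro!: small_norm)
      qed
    qed
    have f'0: "PL.sqn (\<lambda>w. f' w \<mu>X \<gamma>c) < \<infinity> \<or> \<Gamma> = {\<gamma>c}"
    proof (cases "\<Gamma> = {\<gamma>c}")
      case False
      show ?thesis
        using F
      proof (elim disjE)
        assume sm: "\<forall>\<mu>\<in>L2 P1. AE w in private_law.P2 MV P Qb. C2_in_gamma \<Gamma> (f w \<mu>) (f' w \<mu>) (f'' w \<mu>)"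
        from fc[OF zero_less_one] obtain \<delta> where \<delta>: "\<delta> > 0" "\<And>\<theta> \<gamma>. \<theta> \<in> L2 P1 \<Longrightarrow> \<gamma> \<in> \<Gamma> \<Longrightarrow>
            PL.sqn (\<lambda>w. ?ev \<theta> w - ?ev \<mu>X w) \<le> ennreal \<delta> \<Longrightarrow> \<bar>\<gamma> - \<gamma>c\<bar> \<le> \<delta> \<Longrightarrow>
            PL.sqn (\<lambda>w. f w \<theta> \<gamma> - f w \<mu>X \<gamma>c) \<le> ennreal 1 \<and> PL.sqn (\<lambda>w. f' w \<theta> \<gamma> - f' w \<mu>X \<gamma>c) \<le> ennreal 1"
          by blast
        have "PL.sqn (\<lambda>w. f' w \<mu>X \<gamma>c) < \<infinity>"
        proof (rule PL.derivative_sqn_finite[OF \<Gamma>(1,3) False f_smooth[OF \<mu>X(2)] _ _ _ \<delta>(1)])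
          show "AE w in PL.P2. C2_in_gamma \<Gamma> (f w \<mu>X) (f' w \<mu>X) (f'' w \<mu>X)" using sm \<mu>X(2) by blast
          show "(\<lambda>w. f w \<mu>X s) \<in> borel_measurable P" "(\<lambda>w. f' w \<mu>X s) \<in> borel_measurable P" if "s \<in> \<Gamma>" for s
            using f_meas \<mu>X(2) that by auto
          show "PL.sqn (\<lambda>w. f w \<mu>X s - f w \<mu>X \<gamma>c) \<le> 1 \<and> PL.sqn (\<lambda>w. f' w \<mu>X s - f' w \<mu>X \<gamma>c) \<le> 1"
            if "s \<in> \<Gamma>" "\<bar>s - \<gamma>c\<bar> \<le> \<delta>" for s
            using \<delta>(2)[OF \<mu>X(2) that(1) _ that(2)] by (simp add: PL.sqn_const)
        qed
        then show ?thesis by simp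
      qed simp
    qed simp
    have S1': "s \<in> space (SS.Pn n) \<Longrightarrow> s \<in> space (PiM {..<n} (\<lambda>_. PVZ))" for s n
      by (simp add: SS.Pn_def)
    have h0_eq: "NE.h0 = (\<lambda>w. \<chi>_tilde w + \<chi>P)"
      by (rule ext) (simp add: NE.h0_def \<chi>_tilde_def score_def)
    have hn_eq: "NE.hn n (SS.U n \<omega>) = (\<lambda>w. \<chi>_n n \<omega> w + \<psi>0 n \<omega>)" for n \<omega>
      unfolding NE.hn_def NE.en_def SS.U_def \<chi>_n_def score_def e_n_def e_est_def
        r_n_def \<mu>_n_def p_n_def \<gamma>_n_def T[symmetric] by (rule ext) simp
    have \<chi>_n_meas: "\<chi>_n n \<omega> \<in> borel_measurable P"
      if \<omega>: "\<omega> \<in> space M" and ga: "\<gamma>_n n \<omega> \<in> \<Gamma>" for n \<omega>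
    proof -
      note m = L2c(1)[OF rn[OF \<omega>]] L2c(1)[OF \<mu>n[OF \<omega>]] mg_meas icm[unfolded ic_def[abs_def]] f_meas(1)[OF \<mu>n[OF \<omega>] ga]
      show ?thesis
        unfolding \<chi>_n_def score_def
        by (intro borel_measurable_diff borel_measurable_add borel_measurable_times borel_measurable_divide borel_measurable_const m)
    qed
    have \<chi>_tilde_meas: "\<chi>_tilde \<in> borel_measurable P"
    proof -
      note m = L2c(1)[OF r(1)] L2c(1)[OF \<mu>X(2)] mg_meas icm[unfolded ic_def[abs_def]] f_meas(1)[OF \<mu>X(2) \<Gamma>(3)]
      show ?thesis
        unfolding \<chi>_tilde_def score_def
        by (intro borel_measurable_diff borel_measurable_add borel_measurable_times borel_measurable_divide borel_measurable_const m)
    qed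
    have sqn_shift: "PL.sqn (\<lambda>w. h w + k) < \<infinity>" if "h \<in> borel_measurable P" "PL.sqn h < \<infinity>" for h k
    proof -
      have "2 * PL.sqn h + 2 * PL.sqn (\<lambda>w. k) < \<infinity>"
        using that(2) by (simp add: PL.sqn_const ennreal_mult_less_top)
      then show ?thesis
        using PL.sqn_add_le[OF that(1), of "\<lambda>_. k"] by (auto intro: le_less_trans)
    qed
    have \<gamma>_range: "eventually (\<lambda>x. \<gamma>_n (fst x) (snd x) \<in> \<Gamma>) (wpa1 M)"
    proof -
      have "eventually (\<lambda>(n, \<omega>). p_n n \<omega> \<noteq> 0 \<longrightarrow> \<gamma>_n n \<omega> \<in> \<Gamma>) (wpa1 M)"
        by (rule eventually_wpa1_AE) (rule \<gamma>_n_range)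
      then show ?thesis using p_nz by eventually_elim auto
    qed
    have r_tendsto: "((\<lambda>x. PL.sqn (\<lambda>w. r_n (fst x) (snd x) (V1X K1 w) - r (V1X K1 w))) \<longlongrightarrow> 0) (wpa1 M)"
    proof (rule PL.sqn_tendsto_0_norm[OF N])
      show "o_P M (\<lambda>n \<omega>. nrm (\<lambda>w. r_n (fst (n, \<omega>)) (snd (n, \<omega>)) (V1X K1 w) - r (V1X K1 w)))"
        using r_consistent by simp
      show "eventually (\<lambda>x. (\<lambda>w. r_n (fst x) (snd x) (V1X K1 w) - r (V1X K1 w)) \<in> borel_measurable P) (wpa1 M)"
        using inM by eventually_elim (intro borel_measurable_diff L2c(1) rn r(1))
    qed
    have \<mu>_meas: "eventually (\<lambda>x. (\<lambda>w. \<mu>X (V1X K1 w) - \<mu>_n (fst x) (snd x) (V1X K1 w)) \<in> borel_measurable P) (wpa1 M)"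
      using inM by eventually_elim (intro borel_measurable_diff L2c(1) \<mu>n \<mu>X(2))
    have \<mu>_tendsto: "((\<lambda>x. PL.sqn (\<lambda>w. \<mu>X (V1X K1 w) - \<mu>_n (fst x) (snd x) (V1X K1 w))) \<longlongrightarrow> 0) (wpa1 M)"
      using \<mu>_consistent
    proof (elim disjE conjE)
      assume o: "o_P M (\<lambda>n \<omega>. sup_norm (space P) (\<lambda>w. \<mu>X (V1X K1 w) - \<mu>_n n \<omega> (V1X K1 w)))"
      show ?thesis
        by (rule PL.sqn_tendsto_0_norm[OF _ PL.sqn_le_sup_norm _ \<mu>_meas]) (use o in simp_all)
    next
      assume o: "o_P M (\<lambda>n \<omega>. nrm (\<lambda>w. \<mu>X (V1X K1 w) - \<mu>_n n \<omega> (V1X K1 w)))"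
      show ?thesis
        by (rule PL.sqn_tendsto_0_norm[OF N _ \<mu>_meas]) (use o in simp_all)
    qed
    have resid: "((\<lambda>x. PL.sqn (\<lambda>w. r_n (fst x) (snd x) (V1X K1 w) * (m w - \<mu>_n (fst x) (snd x) (V1X K1 w)) -
        r (V1X K1 w) * (m w - \<mu>X (V1X K1 w)))) \<longlongrightarrow> 0) (wpa1 M)"
    proof (rule PL.residual_product_tendsto_0[OF L2c(1)[OF r(1)] fin_norm[OF L2c(1)[OF r(1)] finite_norm(3)] mg_meas(1) L2c(1)[OF \<mu>X(2)] _ r_tendsto])
      show "eventually (\<lambda>x. (\<lambda>w. r_n (fst x) (snd x) (V1X K1 w)) \<in> borel_measurable P \<and>
          (\<lambda>w. \<mu>_n (fst x) (snd x) (V1X K1 w)) \<in> borel_measurable P) (wpa1 M)"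
        using inM by eventually_elim (intro conjI L2c(1) rn \<mu>n)
      show "sup_norm (space P) (\<lambda>w. m w - \<mu>X (V1X K1 w)) < \<infinity> \<and>
          o_P M (\<lambda>n \<omega>. sup_norm (space P) (\<lambda>w. \<mu>X (V1X K1 w) - \<mu>_n (fst (n, \<omega>)) (snd (n, \<omega>)) (V1X K1 w))) \<or>
        O_P M (\<lambda>n \<omega>. sup_norm (space P) (\<lambda>w. m w - \<mu>_n (fst (n, \<omega>)) (snd (n, \<omega>)) (V1X K1 w))) \<and>
          ((\<lambda>x. PL.sqn (\<lambda>w. \<mu>X (V1X K1 w) - \<mu>_n (fst x) (snd x) (V1X K1 w))) \<longlongrightarrow> 0) (wpa1 M) \<and>
          (\<exists>R. (AE w in P. \<bar>r (V1X K1 w)\<bar> \<le> R) \<and> (AE w in PL.P2. \<bar>r (V1X K1 w)\<bar> \<le> R))"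
        using \<mu>_consistent
      proof (elim disjE conjE)
        assume "O_P M (\<lambda>n \<omega>. sup_norm (space P) (\<lambda>w. m w - \<mu>_n n \<omega> (V1X K1 w)))" and rb: r_bounded
        with R[OF rb] \<mu>_tendsto show ?thesis by simp
      qed simp
    qed
    have fin_hn: "eventually (\<lambda>x. PL.sqn (NE.hn (fst x) (SS.U (fst x) (snd x))) < \<infinity>) (wpa1 M)"
    proof -
      have "eventually (\<lambda>(n, \<omega>). p_n n \<omega> \<noteq> 0 \<longrightarrow> nrm (\<chi>_n n \<omega>) < \<infinity>) (wpa1 M)"
        by (rule eventually_wpa1_AE) (rule finite_norm(2))
      then show ?thesis
        using p_nz inM \<gamma>_range
      proof eventually_elim
        case (elim x)
        then have "nrm (\<chi>_n (fst x) (snd x)) < \<infinity>" by (auto simp: case_prod_beta')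
        with elim show ?case
          unfolding hn_eq by (intro sqn_shift fin_norm \<chi>_n_meas)
      qed
    qed
    have prod: "((\<lambda>x. sqrt (real (fst x)) * (\<integral>w. (\<mu>_n (fst x) (snd x) (V1X K1 w) - \<mu>X (V1X K1 w)) *
        (r_n (fst x) (snd x) (V1X K1 w) - r (V1X K1 w)) \<partial>P)) \<longlongrightarrow> 0) (wpa1 M)"
      unfolding tendsto_wpa1_real_iff
    proof safe
      fix \<epsilon> :: real assume \<epsilon>: "\<epsilon> > 0"
      show "eventually (\<lambda>x. \<bar>sqrt (real (fst x)) * (\<integral>w. (\<mu>_n (fst x) (snd x) (V1X K1 w) - \<mu>X (V1X K1 w)) *
          (r_n (fst x) (snd x) (V1X K1 w) - r (V1X K1 w)) \<partial>P)\<bar> \<le> \<epsilon>) (wpa1 M)"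
        using o_P_eventually_le[OF product_rate \<epsilon>] n_pos
      proof eventually_elim
        case (elim x)
        let ?k = "\<lambda>w. (\<mu>_n (fst x) (snd x) (V1X K1 w) - \<mu>X (V1X K1 w)) * (r_n (fst x) (snd x) (V1X K1 w) - r (V1X K1 w))"
        \<comment> \<open>At n = 0 the product 0 times \<infinity> is 0 and would hide an infinite
          \<open>abs_mean\<close>, hence a non-integrable product.\<close>
        have n0: "fst x > 0" using elim by (auto simp: case_prod_beta')
        have "integrable P ?k"
        proof (rule ccontr)
          assume "\<not> integrable P ?k"
          then have "abs_mean P ?k = \<infinity>" by (simp add: abs_mean_def)
          then show False using elim(1) n0 by (simp add: ennreal_mult_top top_unique)
        qed
        then have "ennreal (sqrt (real (fst x))) * ennreal \<bar>\<integral>w. ?k w \<partial>P\<bar> \<le> ennreal \<epsilon>"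
          using elim(1) by (simp add: abs_mean_def)
        then show ?case using \<epsilon> by (simp add: abs_mult flip: ennreal_mult)
      qed
    qed
    have V1P1: "V1X K1 \<in> P \<rightarrow>\<^sub>M P1" unfolding P1d using V1m by simp
    have V1pair: "(\<lambda>p. (fst p, V1X K1 (snd p))) \<in> PiM {..<n} (\<lambda>_. PVZ) \<Otimes>\<^sub>M P \<rightarrow>\<^sub>M PiM {..<n} (\<lambda>_. PVZ) \<Otimes>\<^sub>M P1" for n
      by (intro measurable_Pair measurable_fst measurable_compose[OF measurable_snd V1P1])
    have avg_meas: "avg n h \<in> borel_measurable (SS.Pn n)" if h: "h \<in> borel_measurable PVZ" for n h
    proof -
      have "(\<lambda>s. h (s i)) \<in> borel_measurable (SS.Pn n)" if "i \<in> {..<n}" for i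
        unfolding SS.Pn_def by (rule measurable_compose[OF measurable_component_singleton[OF that] h])
      then show ?thesis
        unfolding avg_def[abs_def] by (intro borel_measurable_times borel_measurable_const borel_measurable_sum)
    qed
    have pn_meas: "?pn n \<in> borel_measurable (SS.Pn n)" for n
    proof -
      have "V2 K2 \<in> PVZ \<rightarrow>\<^sub>M PiM K2 N"
        by (rule measurable_V2[OF coords(2)]) (use PL.PVZ(2) in \<open>simp add: MV_def\<close>)
      then show ?thesis
        unfolding p_est_def[abs_def] by (intro avg_meas measurable_compose[OF _ ic0])
    qed
    have \<gamma>n_meas: "?\<gamma>n n \<in> borel_measurable (SS.Pn n)" for n
    proof -
      have "Qinv (\<lambda>w. of_bool (V2 K2 w = c) * g w) \<in> borel_measurable PVZ"
        unfolding T using icm mg_meas(2) by (intro PL.T_measurable1 borel_measurable_times) (simp_all add: ic_def[abs_def])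
      from avg_meas[OF this] pn_meas show ?thesis
        unfolding gamma_est_def[abs_def] by (intro borel_measurable_times borel_measurable_divide) auto
    qed
    interpret CN: consistent_nuisance MV MX MZ P PVZ Qb a B \<kappa> M S S' S'' "L2 P1" ?ev \<Gamma> f f' f'' m g ?ic
        "\<lambda>w. r (V1X K1 w)" \<mu>X \<gamma>c pc e ?rn \<mu>_est ?\<gamma>n ?pn
    proof unfold_locales
      show "m \<in> borel_measurable P" "g \<in> borel_measurable P" by fact+
      show "?ic \<in> borel_measurable P" using icm by (simp add: ic_def[abs_def])
      show "(\<lambda>w. r (V1X K1 w)) \<in> borel_measurable P" by (rule L2c(1)[OF r(1)])
      show "?ev \<theta> \<in> borel_measurable P" if "\<theta> \<in> L2 P1" for \<theta> by (rule L2c(1)[OF that])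
      show "(\<lambda>w. f w \<theta> \<gamma>) \<in> borel_measurable P" "(\<lambda>w. f' w \<theta> \<gamma>) \<in> borel_measurable P"
        if "\<theta> \<in> L2 P1" "\<gamma> \<in> \<Gamma>" for \<theta> \<gamma> using f_meas that by auto
      show "?ic w = 0 \<or> ?ic w = 1" for w by simp
      show "(\<integral>w. ?ic w \<partial>P) = pc" using ic_int by (simp add: ic_def)
      show "pc > 0" by fact
      show "integrable P (\<lambda>w. ?ic w * g w)" "(\<integral>w. ?ic w * g w \<partial>P) = pc * \<gamma>c"
        using gi g_mean by (simp_all add: ic_def)
      show "is_interval \<Gamma>" "\<gamma>c \<in> \<Gamma>" by fact+
      show "g w \<in> \<Gamma>" if "w \<in> space P" for w using \<Gamma>(2) that by blast
      show "\<mu>X \<in> L2 P1" by fact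
      show "\<mu>_est n s \<in> L2 P1" if "s \<in> space (SS.Pn n)" for n s by (rule est_L2(2)[OF S1'[OF that]])
      show "integrable P (\<lambda>w. f w \<theta> \<gamma>)" if "\<theta> \<in> L2 P1" "\<gamma> \<in> \<Gamma>" for \<theta> \<gamma> by (rule f_integrable[OF that])
      show "AE w in P. C2_in_gamma \<Gamma> (f w \<theta>) (f' w \<theta>) (f'' w \<theta>)" if "\<theta> \<in> L2 P1" for \<theta> by (rule f_smooth[OF that])
      show "PL.sqn (\<lambda>w. f' w \<mu>X \<gamma>c) < \<infinity> \<or> \<Gamma> = {\<gamma>c}" by fact
      show "integrable P (\<lambda>w. f' w \<mu>X \<gamma>c)" by fact
      show "(\<integral>w. f' w \<mu>X \<gamma>c \<partial>P) = e" by (simp add: e_def \<gamma>c_def)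
      show "(\<integral>w. f w \<theta> \<gamma>c \<partial>P) = (\<integral>w. r (V1X K1 w) * ?ev \<theta> w \<partial>P)" if "\<theta> \<in> L2 P1" for \<theta> by (rule r(2)[OF that])
      show "integrable P (\<lambda>w. (?ev \<theta> w)\<^sup>2)" if "\<theta> \<in> L2 P1" for \<theta> by (rule L2c(2)[OF that])
      show "integrable P (\<lambda>w. (r (V1X K1 w))\<^sup>2)" by (rule L2c(2)[OF r(1)])
      show "integrable P (\<lambda>w. (?rn n s w)\<^sup>2)" if "s \<in> space (SS.Pn n)" for n s by (rule L2c(2)[OF est_L2(1)[OF S1'[OF that]]])
      show "integrable P (\<lambda>w. (m w - ?ev \<mu>X w)\<^sup>2)" by (rule res2)
      show "(\<integral>w. r (V1X K1 w) * (m w - ?ev \<mu>X w) \<partial>P) = 0" by (rule orth[OF r(1)])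
      show "(\<integral>w. ?rn n s w * (m w - ?ev \<mu>X w) \<partial>P) = 0" if "s \<in> space (SS.Pn n)" for n s by (rule orth[OF est_L2(1)[OF S1'[OF that]]])
      show "(\<lambda>(s, w). ?rn n s w) \<in> borel_measurable (SS.Pn n \<Otimes>\<^sub>M P)" for n
        using measurable_compose[OF V1pair est_meas(1)] by (simp add: SS.Pn_def case_prod_beta')
      show "(\<lambda>(s, w). ?ev (\<mu>_est n s) w) \<in> borel_measurable (SS.Pn n \<Otimes>\<^sub>M P)" for n
        using measurable_compose[OF V1pair est_meas(2)] by (simp add: SS.Pn_def case_prod_beta')
      show "(\<lambda>(s, w). f w (\<mu>_est n s) (?\<gamma>n n s)) \<in> borel_measurable (SS.Pn n \<Otimes>\<^sub>M P)"
        "(\<lambda>(s, w). f' w (\<mu>_est n s) (?\<gamma>n n s)) \<in> borel_measurable (SS.Pn n \<Otimes>\<^sub>M P)" for n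
        using est_meas(3,4) by (simp_all add: SS.Pn_def)
      show "?\<gamma>n n \<in> borel_measurable (SS.Pn n)" "?pn n \<in> borel_measurable (SS.Pn n)" for n
        by (rule \<gamma>n_meas, rule pn_meas)
      show "PL.sqn NE.h0 < \<infinity>"
        unfolding h0_eq by (rule sqn_shift[OF \<chi>_tilde_meas fin_norm[OF \<chi>_tilde_meas finite_norm(1)]])
      show "eventually (\<lambda>x. PL.sqn (NE.hn (fst x) (SS.U (fst x) (snd x))) < \<infinity>) (wpa1 M)" by fact
      show "\<exists>\<delta>>0. \<forall>\<theta>\<in>L2 P1. \<forall>\<gamma>\<in>\<Gamma>.
          PL.sqn (\<lambda>w. ?ev \<theta> w - ?ev \<mu>X w) \<le> ennreal \<delta> \<longrightarrow> \<bar>\<gamma> - \<gamma>c\<bar> \<le> \<delta> \<longrightarrow>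
          PL.sqn (\<lambda>w. f w \<theta> \<gamma> - f w \<mu>X \<gamma>c) \<le> ennreal \<epsilon> \<and> PL.sqn (\<lambda>w. f' w \<theta> \<gamma> - f' w \<mu>X \<gamma>c) \<le> ennreal \<epsilon>"
        if "\<epsilon> > 0" for \<epsilon> by (rule fc[OF that])
      show "eventually (\<lambda>x. ?\<gamma>n (fst x) (sample S' (fst x) (snd x)) \<in> \<Gamma>) (wpa1 M)"
        using \<gamma>_range by (simp add: \<gamma>_n_def)
      show "((\<lambda>x. ?\<gamma>n (fst x) (sample S' (fst x) (snd x)) - \<gamma>c) \<longlongrightarrow> 0) (wpa1 M)"
        using o_P_real_tendsto[OF \<gamma>_consistent] by (simp add: \<gamma>_n_def)
      show "((\<lambda>x. ?pn (fst x) (sample S' (fst x) (snd x)) - pc) \<longlongrightarrow> 0) (wpa1 M)"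
        using p_tendsto by (simp add: p_n_def)
      show "((\<lambda>x. PL.sqn (\<lambda>w. ?ev (\<mu>_est (fst x) (sample S' (fst x) (snd x))) w - ?ev \<mu>X w)) \<longlongrightarrow> 0) (wpa1 M)"
        using \<mu>_tendsto by (simp add: \<mu>_n_def PL.sqn_def power2_commute)
      show "((\<lambda>x. PL.sqn (NE.resid x)) \<longlongrightarrow> 0) (wpa1 M)"
        using resid by (simp add: NE.resid_def[abs_def] r_n_def \<mu>_n_def)
      show "((\<lambda>x. sqrt (real (fst x)) * (\<integral>w. (?ev (\<mu>_est (fst x) (sample S' (fst x) (snd x))) w - ?ev \<mu>X w) *
          (?rn (fst x) (sample S' (fst x) (snd x)) w - r (V1X K1 w)) \<partial>P)) \<longlongrightarrow> 0) (wpa1 M)"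
        using prod by (simp add: r_n_def \<mu>_n_def)
      show "O_P M (\<lambda>n \<omega>. ennreal \<bar>sqrt (real (fst (n, \<omega>))) * (?\<gamma>n (fst (n, \<omega>)) (sample S' (fst (n, \<omega>)) (snd (n, \<omega>))) - \<gamma>c)\<bar>)"
        using \<gamma>_rate by (simp add: \<gamma>_n_def abs_mult)
    qed
    have \<chi>P: "(\<integral>w. f w \<mu>X \<gamma>c \<partial>P) = \<chi>P" by (simp add: \<chi>P_def \<gamma>c_def)
    have Tn: "PL.T (\<lambda>w. NE.hn n (SS.U n \<omega>) w - \<psi>0 n \<omega>) = Qinv (\<chi>_n n \<omega>)" for n \<omega>
      unfolding hn_eq T[symmetric] by simp
    have T0: "PL.T (\<lambda>w. NE.h0 w - \<chi>P) = Qinv \<chi>_tilde"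
      unfolding h0_eq T[symmetric] by simp
    show ?thesis
      using CN.one_step_asymptotic_normality[of \<psi>0, OF est_meas(5)]
      unfolding \<chi>P Tn T0 by (simp add: \<psi>_n_def)
  qed
  show ?thesis
    using mechanism
  proof (elim disjE conjE)
    assume D: "mech_delta MX MZ Q \<alpha> Qbar" and Qi: "Qinv = inv_delta \<alpha> Qbar"
      and Ps: "Ps = [P, distr P MV fst \<Otimes>\<^sub>M Qbar]"
    have pl: "private_law MV MX MZ P PVZ Qbar (1 / \<alpha>) ((1 - \<alpha>) / \<alpha>) (\<lambda>_ _. - ((1 - \<alpha>) / \<alpha>))"
      unfolding PVZd by (rule private_law_delta[OF P D])
    interpret PL: private_law MV MX MZ P PVZ Qbar "1 / \<alpha>" "(1 - \<alpha>) / \<alpha>" "\<lambda>_ _. - ((1 - \<alpha>) / \<alpha>)" by (rule pl)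
    have Ps': "Ps = [P, PL.P2]" by (simp add: Ps PL.P2_def PL.PV_def)
    have sm: "\<forall>\<mu>\<in>L2 P1. AE w in PL.P2. C2_in_gamma \<Gamma> (f w \<mu>) (f' w \<mu>) (f'' w \<mu>)"
      using f_smooth_L[of PL.P2] by (simp add: Ps')
    have Qeq: "Qinv = (\<lambda>h u. 1 / \<alpha> * h u + (\<integral>x. - ((1 - \<alpha>) / \<alpha>) * h (fst u, x) \<partial>Qbar))"
      unfolding Qi by (rule ext) (rule inv_delta_eq)
    show ?thesis
      using norm_choice
    proof (elim disjE conjE)
      assume nrm: "nrm = L_norm Ps" and rb: "r_bounded = (\<exists>R. \<forall>P'\<in>set Ps. AE w in P'. \<bar>r (V1X K1 w)\<bar> \<le> R)"
      show ?thesis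
        by (rule main[OF pl Qeq zero_le_one PL.sqn_le_L_norm[folded Ps' nrm] _ disjI1[OF sm]]) (simp add: rb Ps')
    next
      assume nrm: "nrm = sup_norm (space P)" and rb: "r_bounded = (sup_norm (space P) (\<lambda>w. r (V1X K1 w)) < \<infinity>)"
      show ?thesis
        by (rule main[OF pl Qeq zero_le_numeral PL.sqn_le_sup_norm[folded nrm] _ disjI1[OF sm]])
          (simp only: rb, rule PL.sup_norm_AE_bound)
    qed
  next
    assume J: "mech_J MV MX MZ P Q xs zs" and Qi: "Qinv = inv_J Q xs zs" and Ps: "Ps = [P]"
      and fs: "finitely_supported MV MX P" and pos: "nrm = L_norm Ps \<longrightarrow> positive_density MV MX P"
    have xs: "bij_betw xs UNIV (space MX)" and SX: "sets MX = Pow (space MX)"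
      using J by (auto simp: mech_J_def)
    have finX: "finite (space MX)" using bij_betw_finite[OF xs] by simp
    let ?Qb = "uniform_count_measure (space MX)"
    obtain B where pl: "private_law MV MX MZ P PVZ ?Qb 0 B (kernel_J Q xs zs)"
      unfolding PVZd using private_law_J[OF P J] by blast
    interpret PL: private_law MV MX MZ P PVZ ?Qb 0 B "kernel_J Q xs zs" by (rule pl)
    obtain A where A: "A \<subseteq> space MV" "finite A" "\<And>v. v \<in> A \<Longrightarrow> {v} \<in> sets MV" "measure P (A \<times> space MX) = 1"
      using fs by (auto simp: finitely_supported_def)
    have fin: "\<forall>k. PL.sqn k < \<infinity>"
      using PL.sqn_finite_support[OF A(2,3,4) finX] by blast
    have Qeq: "Qinv = (\<lambda>h u. 0 * h u + (\<integral>x. kernel_J Q xs zs (snd u) x * h (fst u, x) \<partial>?Qb))"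
      unfolding Qi by (rule ext) (rule inv_J_eq[OF xs])
    show ?thesis
      using norm_choice
    proof (elim disjE conjE)
      assume nrm: "nrm = L_norm Ps" and rb: "r_bounded = (\<exists>R. \<forall>P'\<in>set Ps. AE w in P'. \<bar>r (V1X K1 w)\<bar> \<le> R)"
      \<comment> \<open>The product with the uniform measure belongs to the unified operator and is
        absent from this norm; domination by P brings it under control.\<close>
      have "\<exists>C::real. C \<ge> 0 \<and> (\<forall>k\<in>borel_measurable P. (\<integral>\<^sup>+w. k w \<partial>PL.P2) \<le> ennreal C * (\<integral>\<^sup>+w. k w \<partial>P))"
        using PL.P2_dominated[OF A(2,3,4,1) finX SX] pos nrm by blast
      then obtain C :: real where C: "C \<ge> 0" "\<And>k. k \<in> borel_measurable P \<Longrightarrow> (\<integral>\<^sup>+w. k w \<partial>PL.P2) \<le> ennreal C * (\<integral>\<^sup>+w. k w \<partial>P)"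
        by blast
      have C1: "1 + C \<ge> 0" using C(1) by simp
      show ?thesis
      proof (rule main[OF pl Qeq C1 PL.sqn_le_L_norm_dominated[OF C, folded Ps nrm] _ disjI2[OF fin]])
        assume r_bounded
        then obtain R where "\<forall>P'\<in>set Ps. AE w in P'. \<bar>r (V1X K1 w)\<bar> \<le> R" unfolding rb by blast
        moreover have "P \<in> set Ps" unfolding Ps by simp
        ultimately have "AE w in P. \<bar>r (V1X K1 w)\<bar> \<le> R" by blast
        then show "\<exists>R. (AE w in P. \<bar>r (V1X K1 w)\<bar> \<le> R) \<and> (AE w in PL.P2. \<bar>r (V1X K1 w)\<bar> \<le> R)"
          using PL.AE_P2_dominated[OF C(2)] by blast
      qed
    next
      assume nrm: "nrm = sup_norm (space P)" and rb: "r_bounded = (sup_norm (space P) (\<lambda>w. r (V1X K1 w)) < \<infinity>)"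
      show ?thesis
        by (rule main[OF pl Qeq zero_le_numeral PL.sqn_le_sup_norm[folded nrm] _ disjI2[OF fin]])
          (simp only: rb, rule PL.sup_norm_AE_bound)
    qed
  qed
qed

end
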